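(* Let $k>0$, $0<q\neq 1$, and let $u^{\mathrm{in}}$ be an incident wave with wave number $k$. Assume the following. (1) $\Gamma$ is a simple closed curve parametrized counterclockwise by $x(t)=(x_1(t),x_2(t))$, $t\in[-\pi,\pi]$, where $x'$ vanishes at no more than finitely many points, and $x_1,x_2$ extend to complex analytic functions in an open set $\mathcal T\subset\mathbb C$ containing the interval $[-\pi,\pi]$. (2) $D$, the domain enclosed by $\Gamma$, has constant refractive index $q$. (3) $g(t)=x_1(t)+ix_2(t)$ has a simple critical point at $t_0\in\mathcal T$, i.e. $g'$ has a simple zero at $t_0$, and $t_0\neq\pm\pi$. (4) There exists a contour $\mathcal C$ in $\mathcal T$ joining $-\pi$ to $\pi$ (and containing both endpoints), into which $[-\pi,\pi]$ can be deformed within $\mathcal T$ with endpoints fixed, that passes through $t_0$ and satisfies $\Re g(t)<\Re g(t_0)$ for all $t\in\mathcal C\setminus\{t_0\}$. (5) $u^{\mathrm{in}}(x_1,x_2)$ extends to an analytic function of two complex variables in some open subset of $\mathbb C^2$ containing $\{(x_1(t),x_2(t)):t\in\mathcal T\}$. Let $$I(\lambda)=\int_{-\pi}^{\pi}\left[(x_2',-x_1')\cdot V+i\lambda g'v+i\tilde\lambda x_1'v\right]e^{\lambda g+i\tilde\lambda x_2}\,dt,$$ $$C_1=k^2(q-1)\sqrt{\frac{-2\pi}{g''(t_0)}}\;u^{\mathrm{in}}(x(t_0))\,x_2'(t_0),\qquad f=\frac{k^2q}{2}(x_2'+ix_1')v+V'\cdot(i,1).$$ If $C_1=0$, then, as $\lambda\to\infty$,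 $$I(\lambda)=\frac{1}{\lambda^{5/2}}e^{\lambda g(t_0)}\left[C_2+O\left(\tfrac1\lambda\right)\right],$$ where $$C_2=\frac{2\sqrt\pi}{(-2g''(t_0))^{3/2}}\left[f''(t_0)-f'(t_0)\frac{g'''(t_0)}{g''(t_0)}-ik^2q\,g''(t_0)\,x_2'(t_0)\,V(t_0)\cdot(i,1)\right].$$ In particular, if $C_1=0$ and $C_2\neq0$, then the incident wave $u^{\mathrm{in}}$ is scattered by $D$.
   Context: An incident wave with wave number $k>0$ is a non-trivial solution $u^{\mathrm{in}}$ of $\Delta u^{\mathrm{in}}+k^2u^{\mathrm{in}}=0$ in $\mathbb R^2$. For a bounded simply connected planar domain $D$ with constant refractive index $q$ (the index is $1$ outside $D$), $u^{\mathrm{in}}$ is called nonscattering for $D$ if there is $u\in H^2_{\mathrm{loc}}(\mathbb R^2)$ with $u=0$ in $\mathbb R^2\setminus D$ and $\Delta u+k^2qu=k^2(1-q)u^{\mathrm{in}}\chi_D$ in $\mathbb R^2$, where $\chi_D$ is the indicator function of $D$ (here $u$ is the total field minus $u^{\mathrm{in}}$). Otherwise $u^{\mathrm{in}}$ is said to be scattered by $D$. Notation: $\tilde\lambda=\sqrt{\lambda^2+k^2q}-\lambda$ for $\lambda\ge 0$; $v(t)=u^{\mathrm{in}}(x(t))$ and $V(t)=\nabla u^{\mathrm{in}}(x(t))$; primes are derivatives in $t$; $a\cdot b=a_1b_1+a_2b_2$ (no complex conjugation). Values at complex $t$ refer to the analytic extensions. Branches: the powers $(-g''(t_0))^{1/2}$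 (in $\sqrt{-2\pi/g''(t_0)}=\sqrt{2\pi}/(-g''(t_0))^{1/2}$) and $(-2g''(t_0))^{3/2}=2^{3/2}(-g''(t_0))^{3/2}$ are formed using the value $\omega_0=\arg(-g''(t_0))$ that satisfies $|\omega_0+2\omega|\le\pi/2$, with $\omega$ the limiting value of $\arg(t-t_0)$ as $t\to t_0$ along the part of $\mathcal C$ joining $t_0$ to $\pi$.
   Formalization: "Passes through t_0" is made precise: the contour must enter t_0 from the valley of Re g opposite to the one in which it leaves; if it only touches t_0 and returns into the same valley, I(λ) is exponentially smaller than e^{λg(t_0)} and the expansion fails when C_2≠0. *)

theory Defs
  imports "HOL-Complex_Analysis.Complex_Analysis" "HOL-Library.Landau_Symbols"
begin

section \<open>Function spaces and weak derivatives\<close>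

abbreviation partial_deriv ::
  "'a::euclidean_space \<Rightarrow> ('a \<Rightarrow> 'b::real_normed_vector) \<Rightarrow> 'a \<Rightarrow> 'b" where
  "partial_deriv b u \<equiv> (\<lambda>x. frechet_derivative u (at x) b)"

definition laplacian :: "('a::euclidean_space \<Rightarrow> 'b::real_normed_vector) \<Rightarrow> 'a \<Rightarrow> 'b" where
  "laplacian u x = (\<Sum>b\<in>Basis. partial_deriv b (partial_deriv b u) x)"

fun C_k :: "nat \<Rightarrow> ('a::euclidean_space \<Rightarrow> 'b::real_normed_vector) \<Rightarrow> bool" where
  "C_k 0 u \<longleftrightarrow> continuous_on UNIV u"
| "C_k (Suc n) u \<longleftrightarrow> u differentiable_on UNIV \<and> (\<forall>b\<in>Basis. C_k n (partial_deriv b u))"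

definition test_function :: "('a::euclidean_space \<Rightarrow> real) \<Rightarrow> bool" where
  "test_function \<phi> \<longleftrightarrow> (\<forall>n. C_k n \<phi>) \<and> compact (closure {x. \<phi> x \<noteq> 0})"

definition L1_loc :: "('a::euclidean_space \<Rightarrow> complex) \<Rightarrow> bool" where
  "L1_loc u \<longleftrightarrow> u \<in> borel_measurable lebesgue \<and> (\<forall>K. compact K \<longrightarrow> set_integrable lebesgue K u)"

definition L2_loc :: "('a::euclidean_space \<Rightarrow> complex) \<Rightarrow> bool" where
  "L2_loc u \<longleftrightarrow> u \<in> borel_measurable lebesgue \<and>
     (\<forall>K. compact K \<longrightarrow> set_integrable lebesgue K (\<lambda>x. (cmod (u x))\<^sup>2))"

definition weak_partial ::
  "'a::euclidean_space \<Rightarrow> ('a \<Rightarrow> complex) \<Rightarrow> ('a \<Rightarrow> complex) \<Rightarrow> bool" where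
  "weak_partial b u w \<longleftrightarrow> L1_loc u \<and> L1_loc w \<and>
     (\<forall>\<phi>. test_function \<phi> \<longrightarrow>
        (LINT x|lebesgue. partial_deriv b \<phi> x *\<^sub>R u x) = - (LINT x|lebesgue. \<phi> x *\<^sub>R w x))"

fun H_loc :: "nat \<Rightarrow> ('a::euclidean_space \<Rightarrow> complex) \<Rightarrow> bool" where
  "H_loc 0 u \<longleftrightarrow> L2_loc u"
| "H_loc (Suc m) u \<longleftrightarrow> L2_loc u \<and> (\<forall>b\<in>Basis. \<exists>w. weak_partial b u w \<and> H_loc m w)"

definition weak_laplacian :: "('a::euclidean_space \<Rightarrow> complex) \<Rightarrow> ('a \<Rightarrow> complex) \<Rightarrow> bool" where
  "weak_laplacian u w \<longleftrightarrow>
     (\<exists>d dd. (\<forall>b\<in>Basis. weak_partial b u (d b) \<and> weak_partial b (d b) (dd b)) \<and>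
             w = (\<lambda>x. \<Sum>b\<in>Basis. dd b x))"

section \<open>Incident waves and scattering\<close>

definition incident_wave :: "real \<Rightarrow> (real \<times> real \<Rightarrow> complex) \<Rightarrow> bool" where
  "incident_wave k uin \<longleftrightarrow>
     C_k 2 uin \<and> (\<forall>x. laplacian uin x + of_real (k\<^sup>2) * uin x = 0) \<and> (\<exists>x. uin x \<noteq> 0)"

text \<open>As usual for Sobolev functions, both conditions on \<open>u\<close> are understood almost everywhere.\<close>

definition nonscattering ::
  "real \<Rightarrow> real \<Rightarrow> (real \<times> real) set \<Rightarrow> (real \<times> real \<Rightarrow> complex) \<Rightarrow> bool" where
  "nonscattering k q D uin \<longleftrightarrow>
     (\<exists>u w. H_loc 2 u \<and> weak_laplacian u w \<and>
        (AE x in lebesgue. x \<notin> D \<longrightarrow> u x = 0) \<and>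
        (AE x in lebesgue. w x + of_real (k\<^sup>2 * q) * u x
            = of_real (k\<^sup>2 * (1 - q)) * uin x * indicator D x))"

definition scattered ::
  "real \<Rightarrow> real \<Rightarrow> (real \<times> real) set \<Rightarrow> (real \<times> real \<Rightarrow> complex) \<Rightarrow> bool" where
  "scattered k q D uin \<longleftrightarrow> \<not> nonscattering k q D uin"

section \<open>The boundary curve\<close>

text \<open>Paths in the library live on the unit interval; \<open>linepath\<close> rescales it to
  \<open>[-pi, pi]\<close>.\<close>

definition boundary_curve :: "(real \<Rightarrow> real) \<Rightarrow> (real \<Rightarrow> real) \<Rightarrow> real \<Rightarrow> real \<times> real" where
  "boundary_curve x1 x2 = (\<lambda>t. (x1 t, x2 t)) \<circ> linepath (- pi) pi"

definition counterclockwise :: "(real \<Rightarrow> real \<times> real) \<Rightarrow> bool" where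
  "counterclockwise \<gamma> \<longleftrightarrow>
     (\<forall>(a, b) \<in> inside (path_image \<gamma>).
        winding_number (\<lambda>s. Complex (fst (\<gamma> s)) (snd (\<gamma> s))) (Complex a b) = 1)"

text \<open>\<open>I(lam)\<close>, built from the real parametrization and from the wave on the real plane. The
  functions \<open>x1\<close>, \<open>x2\<close> are only specified on \<open>[-pi, pi]\<close>, so \<open>deriv\<close> is
  meaningful only in the interior; the two endpoints do not affect the integral.\<close>

definition lambda_tilde :: "real \<Rightarrow> real \<Rightarrow> real \<Rightarrow> real" where
  "lambda_tilde k q lam = sqrt (lam\<^sup>2 + k\<^sup>2 * q) - lam"

definition boundary_integral ::
  "real \<Rightarrow> real \<Rightarrow> (real \<times> real \<Rightarrow> complex) \<Rightarrow> (real \<Rightarrow> real) \<Rightarrow> (real \<Rightarrow> real) \<Rightarrow> real \<Rightarrow> complex" where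
  "boundary_integral k q uin x1 x2 lam =
     integral {- pi..pi} (\<lambda>t.
       let x = (x1 t, x2 t);
           dx1 = complex_of_real (deriv x1 t); dx2 = complex_of_real (deriv x2 t);
           g = of_real (x1 t) + \<i> * of_real (x2 t); dg = dx1 + \<i> * dx2;
           v = uin x; V1 = partial_deriv (1, 0) uin x; V2 = partial_deriv (0, 1) uin x;
           lt = complex_of_real (lambda_tilde k q lam)
       in (dx2 * V1 - dx1 * V2 + \<i> * of_real lam * dg * v + \<i> * lt * dx1 * v)
          * exp (of_real lam * g + \<i> * lt * of_real (x2 t)))"

section \<open>Analytic extensions\<close>

text \<open>Complex differentiability: the derivative at every point is linear over the complex
  numbers.\<close>

definition holomorphic2_on ::
  "(complex \<times> complex \<Rightarrow> complex) \<Rightarrow> (complex \<times> complex) set \<Rightarrow> bool" where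
  "holomorphic2_on U W \<longleftrightarrow>
     (\<forall>p\<in>W. \<exists>a b. (U has_derivative (\<lambda>(h1, h2). a * h1 + b * h2)) (at p))"

text \<open>Below \<open>X1\<close>, \<open>X2\<close> are the analytic extensions of \<open>x1\<close>, \<open>x2\<close>
  and \<open>U\<close> is the one of the incident wave.\<close>

definition g_ext :: "(complex \<Rightarrow> complex) \<Rightarrow> (complex \<Rightarrow> complex) \<Rightarrow> complex \<Rightarrow> complex" where
  "g_ext X1 X2 t = X1 t + \<i> * X2 t"

definition v_ext ::
  "(complex \<times> complex \<Rightarrow> complex) \<Rightarrow> (complex \<Rightarrow> complex) \<Rightarrow> (complex \<Rightarrow> complex) \<Rightarrow> complex \<Rightarrow> complex" where
  "v_ext U X1 X2 t = U (X1 t, X2 t)"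

definition V1_ext ::
  "(complex \<times> complex \<Rightarrow> complex) \<Rightarrow> (complex \<Rightarrow> complex) \<Rightarrow> (complex \<Rightarrow> complex) \<Rightarrow> complex \<Rightarrow> complex" where
  "V1_ext U X1 X2 t = deriv (\<lambda>z. U (z, X2 t)) (X1 t)"

definition V2_ext ::
  "(complex \<times> complex \<Rightarrow> complex) \<Rightarrow> (complex \<Rightarrow> complex) \<Rightarrow> (complex \<Rightarrow> complex) \<Rightarrow> complex \<Rightarrow> complex" where
  "V2_ext U X1 X2 t = deriv (\<lambda>z. U (X1 t, z)) (X2 t)"

definition f_ext ::
  "real \<Rightarrow> real \<Rightarrow> (complex \<times> complex \<Rightarrow> complex) \<Rightarrow> (complex \<Rightarrow> complex) \<Rightarrow> (complex \<Rightarrow> complex)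
     \<Rightarrow> complex \<Rightarrow> complex" where
  "f_ext k q U X1 X2 t =
     of_real (k\<^sup>2 * q / 2) * (deriv X2 t + \<i> * deriv X1 t) * v_ext U X1 X2 t
     + (\<i> * deriv (V1_ext U X1 X2) t + deriv (V2_ext U X1 X2) t)"

section \<open>Passing through the saddle point\<close>

text \<open>\<open>arg_along \<gamma> s t0 \<omega>\<close>: \<open>\<omega>\<close> is a limiting value of the argument of
  \<open>t - t0\<close> as \<open>t\<close> tends to \<open>t0\<close> along the part of \<open>\<gamma>\<close> after the
  parameter \<open>s\<close>. A change of \<open>\<omega>\<close> by \<open>2 * pi\<close> changes \<open>\<omega>0\<close> below by
  \<open>4 * pi\<close> and does not affect half-integer powers.\<close>

definition arg_along :: "(real \<Rightarrow> complex) \<Rightarrow> real \<Rightarrow> complex \<Rightarrow> real \<Rightarrow> bool" where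
  "arg_along \<gamma> s t0 \<omega> \<longleftrightarrow> ((\<lambda>r. sgn (\<gamma> r - t0)) \<longlongrightarrow> cis \<omega>) (at_right s)"

text \<open>Near a simple critical point \<open>t0\<close> of \<open>g\<close>, the set where
  \<open>Re g < Re (g t0)\<close> consists of two opposite valleys. If \<open>\<omega>0\<close> is an argument of
  \<open>- g'' t0\<close> with \<open>\<bar>\<omega>0 + 2 * \<omega>\<bar> \<le> pi / 2\<close>, then the valley in which the contour
  leaves is centred at the direction \<open>cis (- \<omega>0 / 2)\<close>; the other one lies in the half-plane
  below. The condition says that the contour arrives in the other valley, so that it really
  passes through the saddle point. A contour that turns back into the valley it came from can be
  pushed off \<open>t0\<close>, and then \<open>t0\<close> contributes nothing to the integral.\<close>

definition arrives_opposite :: "(real \<Rightarrow> complex) \<Rightarrow> real \<Rightarrow> complex \<Rightarrow> real \<Rightarrow> bool" where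
  "arrives_opposite \<gamma> s t0 \<omega>0 \<longleftrightarrow>
     (\<forall>\<^sub>F r in at_left s. Re ((\<gamma> r - t0) * cis (\<omega>0 / 2)) < 0)"

text \<open>The power \<open>z ^ a\<close> formed with the value \<open>\<theta>\<close> of the argument of \<open>z\<close>.\<close>

definition branch_powr :: "real \<Rightarrow> complex \<Rightarrow> real \<Rightarrow> complex" where
  "branch_powr \<theta> z a = rcis (cmod z powr a) (a * \<theta>)"

definition C1_coeff ::
  "real \<Rightarrow> real \<Rightarrow> (complex \<times> complex \<Rightarrow> complex) \<Rightarrow> (complex \<Rightarrow> complex) \<Rightarrow> (complex \<Rightarrow> complex)
     \<Rightarrow> complex \<Rightarrow> real \<Rightarrow> complex" where
  "C1_coeff k q U X1 X2 t0 \<omega>0 =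
     (let g2 = (deriv ^^ 2) (g_ext X1 X2) t0
      in of_real (k\<^sup>2 * (q - 1)) * (of_real (sqrt (2 * pi)) / branch_powr \<omega>0 (- g2) (1/2))
         * v_ext U X1 X2 t0 * deriv X2 t0)"

definition C2_coeff ::
  "real \<Rightarrow> real \<Rightarrow> (complex \<times> complex \<Rightarrow> complex) \<Rightarrow> (complex \<Rightarrow> complex) \<Rightarrow> (complex \<Rightarrow> complex)
     \<Rightarrow> complex \<Rightarrow> real \<Rightarrow> complex" where
  "C2_coeff k q U X1 X2 t0 \<omega>0 =
     (let g2 = (deriv ^^ 2) (g_ext X1 X2) t0; g3 = (deriv ^^ 3) (g_ext X1 X2) t0;
          f = f_ext k q U X1 X2
      in of_real (2 * sqrt pi) / branch_powr \<omega>0 (- 2 * g2) (3/2)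
         * ((deriv ^^ 2) f t0 - deriv f t0 * g3 / g2
            - \<i> * of_real (k\<^sup>2 * q) * g2 * deriv X2 t0
              * (\<i> * V1_ext U X1 X2 t0 + V2_ext U X1 X2 t0)))"

end

theory Submission
  imports Defs "HOL-Probability.Distributions" "HOL-Probability.Sinc_Integral"
begin

text \<open>
  Since \<open>\<lambda>~ = O(1/\<lambda>)\<close>, one integration by parts along the closed boundary turns \<open>\<lambda> I(\<lambda>)\<close> into
  \<open>\<integral> Q e\<^sup>\<lambda>\<^sup>g\<close> with \<open>Q = f + O(1/\<lambda>)\<close>. Near \<open>t0\<close> the chart \<open>g = g(t0) - w^2\<close>, \<open>dt/dw(0) = a\<close>,
  \<open>a^2 g''(t0) = -2\<close>, straightens the valley: away from \<open>t0\<close> the contour contributes an exponentially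
  smaller term, and the rest deforms to a real segment in \<open>w\<close>, where Gaussian moments give an
  expansion with leading coefficients \<open>f(t0)\<close> and a combination of \<open>f'(t0)\<close> and \<open>f''(t0)\<close>. At the
  critical point, Helmholtz' equation (extended to complex arguments) and \<open>x1' = -i x2'\<close> give
  \<open>f(t0) = k^2 (q - 1) u\<^sup>i\<^sup>n(x(t0)) x2'(t0)\<close>; thus \<open>C1 = 0\<close> kills the leading
  term, and \<open>C2\<close> collects \<open>f\<close> at second order and the \<open>1/\<lambda>\<close> part of \<open>Q\<close> at first order.

  If the wave is nonscattering, its weak solution \<open>u\<close> vanishes outside \<open>D\<close>, so testing against cut-off
  real and imaginary parts of \<open>\<psi> = e^(\<lambda> x + i (\<lambda> + \<lambda>~) y)\<close>, which solves \<open>\<Delta>\<psi> + k^2 q \<psi> = 0\<close>, gives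
  \<open>\<integral>\<^sub>D \<psi> u\<^sup>i\<^sup>n = 0\<close>. Green's formula then makes this integral a multiple of \<open>I(\<lambda>)\<close>, which therefore vanishes
  for all \<open>\<lambda>\<close> and forces \<open>C2 = 0\<close>. As the boundary may have cusps, Green's formula is derived from
  the Cauchy-Pompeiu formula, Fubini's theorem and the winding number of the boundary.
\<close>

section \<open>Holomorphic functions of two variables\<close>

text \<open>Two obstacles shape the proof. After the integration by parts the amplitude still
  depends on \<lambda> through \<open>exp (i \<lambda>~ x2)\<close>, so an expansion for a fixed
  amplitude does not suffice. It is split into a fixed amplitude, \<lambda>~ times another fixed
  one, and a remainder of size \<lambda>~^2 that moves with \<lambda>; hence the saddle estimates
  have constants chosen before the amplitude and are linear in its supremum, on a relatively compact
  neighbourhood of the contour where that supremum is finite. On the scattering side the domain is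
  seen only through the winding number of its boundary. The Cauchy-Pompeiu formula writes the value
  of a function at each boundary point as an area integral against the Cauchy kernel; after the
  exchange of integrals the inner integral is the winding integral, which is 2 pi i on the domain
  and 0 outside, off a null set. The two-variable calculus exists because \<open>f\<close> contains
  derivatives of the extended gradient, which must be holomorphic along complex
  \<open>t\<close>.\<close>

definition pd1 :: "(complex \<times> complex \<Rightarrow> complex) \<Rightarrow> complex \<times> complex \<Rightarrow> complex" where
  "pd1 U p = deriv (\<lambda>z. U (z, snd p)) (fst p)"

definition pd2 :: "(complex \<times> complex \<Rightarrow> complex) \<Rightarrow> complex \<times> complex \<Rightarrow> complex" where
  "pd2 U p = deriv (\<lambda>z. U (fst p, z)) (snd p)"

lemma holomorphic2_onD:
  assumes "holomorphic2_on U W" "(z, w) \<in> W"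
  shows "(U has_derivative (\<lambda>h. pd1 U (z, w) * fst h + pd2 U (z, w) * snd h)) (at (z, w))"
    and "((\<lambda>z. U (z, w)) has_field_derivative pd1 U (z, w)) (at z)"
    and "((\<lambda>w. U (z, w)) has_field_derivative pd2 U (z, w)) (at w)"
proof -
  obtain a b where ab: "(U has_derivative (\<lambda>(h1, h2). a * h1 + b * h2)) (at (z, w))"
    using assms unfolding holomorphic2_on_def by blast
  have "((\<lambda>z. (z, w)) has_derivative (\<lambda>h. (h, 0))) (at z)"
    by (auto intro!: derivative_eq_intros)
  from has_derivative_compose[OF this ab]
  have 1: "((\<lambda>z. U (z, w)) has_field_derivative a) (at z)"
    by (auto simp: has_field_derivative_def elim!: has_derivative_eq_rhs)
  have "((\<lambda>w. (z, w)) has_derivative (\<lambda>h. (0, h))) (at w)"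
    by (auto intro!: derivative_eq_intros)
  from has_derivative_compose[OF this ab]
  have 2: "((\<lambda>w. U (z, w)) has_field_derivative b) (at w)"
    by (auto simp: has_field_derivative_def elim!: has_derivative_eq_rhs)
  have e: "pd1 U (z, w) = a" "pd2 U (z, w) = b"
    using DERIV_imp_deriv[OF 1] DERIV_imp_deriv[OF 2] by (simp_all add: pd1_def pd2_def)
  show "(U has_derivative (\<lambda>h. pd1 U (z, w) * fst h + pd2 U (z, w) * snd h)) (at (z, w))"
    using ab by (simp add: e case_prod_unfold)
  show "((\<lambda>z. U (z, w)) has_field_derivative pd1 U (z, w)) (at z)"
    "((\<lambda>w. U (z, w)) has_field_derivative pd2 U (z, w)) (at w)"
    using 1 2 by (simp_all add: e)
qed

lemma holomorphic2_on_imp_continuous_on: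
  assumes "holomorphic2_on U W"
  shows "continuous_on W U"
  using holomorphic2_onD(1)[OF assms]
  by (intro continuous_at_imp_continuous_on) (auto intro: has_derivative_continuous)

lemma holomorphic2_on_compose:
  assumes "holomorphic2_on U W" "(X1 t, X2 t) \<in> W"
    and "(X1 has_field_derivative X1') (at t)" "(X2 has_field_derivative X2') (at t)"
  shows "((\<lambda>t. U (X1 t, X2 t)) has_field_derivative
           pd1 U (X1 t, X2 t) * X1' + pd2 U (X1 t, X2 t) * X2') (at t)"
proof -
  have "((\<lambda>t. (X1 t, X2 t)) has_derivative (\<lambda>h. (X1' * h, X2' * h))) (at t)"
    using assms(3,4) by (auto intro!: derivative_eq_intros simp: has_field_derivative_def)
  from has_derivative_compose[OF this holomorphic2_onD(1)[OF assms(1,2)]]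
  show ?thesis
    unfolding has_field_derivative_def
    by (rule has_derivative_eq_rhs) (auto simp: algebra_simps)
qed

text \<open>With \<open>pd_swap\<close> this transfers every fact about \<open>pd1\<close> to
  \<open>pd2\<close>, so Cauchy's formula is only ever written in the first variable.\<close>

lemma holomorphic2_on_swap:
  assumes "holomorphic2_on U W"
  shows "holomorphic2_on (\<lambda>p. U (snd p, fst p)) ((\<lambda>p. (snd p, fst p)) -` W)"
  unfolding holomorphic2_on_def
proof
  fix p assume p: "p \<in> (\<lambda>p. (snd p, fst p)) -` W"
  have "((\<lambda>p. (snd p, fst p)) has_derivative (\<lambda>p. (snd p, fst p))) (at p)"
    by (auto intro!: derivative_eq_intros)
  from has_derivative_compose[OF this holomorphic2_onD(1)[OF assms]] p
  have "((\<lambda>p. U (snd p, fst p)) has_derivative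
      (\<lambda>(h1, h2). pd2 U (snd p, fst p) * h1 + pd1 U (snd p, fst p) * h2)) (at p)"
    by (auto simp: case_prod_unfold add.commute)
  then show "\<exists>a b. ((\<lambda>p. U (snd p, fst p)) has_derivative (\<lambda>(h1, h2). a * h1 + b * h2)) (at p)"
    by blast
qed

lemma pd_swap:
  "pd1 (\<lambda>p. U (snd p, fst p)) = (\<lambda>p. pd2 U (snd p, fst p))"
  "pd2 (\<lambda>p. U (snd p, fst p)) = (\<lambda>p. pd1 U (snd p, fst p))"
  by (auto simp: pd1_def pd2_def)

lemma open_swap_vimage:
  "open W \<Longrightarrow> open ((\<lambda>p. (snd p, fst p)) -` W)"
  by (rule open_vimage) (auto intro!: continuous_on_Pair continuous_on_fst continuous_on_snd)

text \<open>Differentiability is asked in the first variable alone, because the formula is also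
  applied to \<open>F = pd2 U\<close> at a stage where only its slices are known to be holomorphic.
  As an integral over a fixed circle, \<open>pd1 F\<close> inherits continuity and differentiability
  in the second variable from the integrand.\<close>

lemma pd1_Cauchy:
  assumes F: "\<And>z. z \<in> cball z0 r \<Longrightarrow> (\<lambda>z. F (z, w)) field_differentiable at z" and z: "z \<in> ball z0 r"
  shows "pd1 F (z, w) = 1 / (2 * of_real pi * \<i>) *
    integral (cbox 0 1) (\<lambda>t. F (circlepath z0 r t, w) / (circlepath z0 r t - z)\<^sup>2
       * vector_derivative (circlepath z0 r) (at t))"
proof -
  have "(\<lambda>z. F (z, w)) holomorphic_on cball z0 r"
    using F by (simp add: field_differentiable_at_within holomorphic_on_def)
  then have "continuous_on (cball z0 r) (\<lambda>z. F (z, w))" "(\<lambda>z. F (z, w)) holomorphic_on ball z0 r"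
    using holomorphic_on_imp_continuous_on holomorphic_on_subset ball_subset_cball by blast+
  from DERIV_imp_deriv[OF Cauchy_derivative_integral_circlepath(2)[OF this z]]
  show ?thesis by (simp add: contour_integral_integral pd1_def)
qed

lemma polydisc_subset:
  fixes W :: "(complex \<times> complex) set"
  assumes "open W" "(z0, w0) \<in> W"
  obtains r where "r > 0" "cball z0 r \<times> ball w0 r \<subseteq> W"
proof -
  obtain A B where AB: "open A" "open B" "z0 \<in> A" "w0 \<in> B" "A \<times> B \<subseteq> W"
    using open_prod_elim[OF assms] by (metis mem_Sigma_iff)
  obtain e d where "e > 0" "cball z0 e \<subseteq> A" "d > 0" "ball w0 d \<subseteq> B"
    using open_contains_cball_eq[OF AB(1)] open_contains_ball_eq[OF AB(2)] AB(3,4) by blast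
  then have "cball z0 (min e d) \<times> ball w0 (min e d) \<subseteq> W"
    using AB(5) by (auto simp: subset_iff)
  with that[of "min e d"] \<open>e > 0\<close> \<open>d > 0\<close> show thesis by simp
qed

lemma continuous_on_Cauchy_kernel:
  fixes F :: "complex \<times> complex \<Rightarrow> complex"
  assumes F: "continuous_on (cball z0 r \<times> S) F"
  shows "continuous_on ((ball z0 r \<times> S) \<times> cbox (0::real) 1)
     (\<lambda>(p, t). F (circlepath z0 r t, snd p) / (circlepath z0 r t - fst p)\<^sup>2
        * vector_derivative (circlepath z0 r) (at t))"
proof -
  have c: "continuous_on X (\<lambda>q. circlepath z0 r (f q))" if "continuous_on X f"
      for f :: "(complex \<times> complex) \<times> real \<Rightarrow> real" and X
    unfolding circlepath by (intro continuous_intros that)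
  have n: "circlepath z0 r t \<noteq> z" if "z \<in> ball z0 r" for t z
  proof
    assume "circlepath z0 r t = z"
    then have "z - z0 = of_real r * exp (2 * of_real pi * \<i> * of_real t)"
      by (auto simp: circlepath)
    then have "norm (z - z0) = \<bar>r\<bar>" by (simp add: norm_mult)
    then show False using that by (auto simp: dist_norm norm_minus_commute)
  qed
  have i: "circlepath z0 r t \<in> cball z0 r" if "z \<in> ball z0 r" for z t
  proof -
    have "r \<ge> 0" using that by (metis ball_eq_empty empty_iff linear)
    then show ?thesis by (simp add: circlepath dist_norm norm_mult)
  qed
  show ?thesis
    unfolding case_prod_unfold vector_derivative_circlepath
    by (intro continuous_intros c continuous_on_compose2[OF F])
       (use n i in \<open>auto intro!: continuous_intros\<close>)
qed

lemma continuous_on_pd1: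
  assumes W: "open W" and F: "continuous_on W F"
    and d: "\<And>z w. (z, w) \<in> W \<Longrightarrow> (\<lambda>z. F (z, w)) field_differentiable at z"
  shows "continuous_on W (pd1 F)"
proof (rule continuous_at_imp_continuous_on, safe)
  fix z0 w0 assume "(z0, w0) \<in> W"
  from polydisc_subset[OF W this] obtain r where r: "r > 0" "cball z0 r \<times> ball w0 r \<subseteq> W"
    by blast
  have "continuous_on (cball z0 r \<times> ball w0 r) F"
    using r F continuous_on_subset by blast
  from integral_continuous_on_param[OF continuous_on_Cauchy_kernel[OF this]]
  have "continuous_on (ball z0 r \<times> ball w0 r) (\<lambda>p. 1 / (2 * of_real pi * \<i>) *
    integral (cbox 0 1) (\<lambda>t. F (circlepath z0 r t, snd p) / (circlepath z0 r t - fst p)\<^sup>2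
       * vector_derivative (circlepath z0 r) (at t)))"
    by (intro continuous_on_mult continuous_on_const)
  moreover have "pd1 F p = 1 / (2 * of_real pi * \<i>) *
    integral (cbox 0 1) (\<lambda>t. F (circlepath z0 r t, snd p) / (circlepath z0 r t - fst p)\<^sup>2
       * vector_derivative (circlepath z0 r) (at t))" if "p \<in> ball z0 r \<times> ball w0 r" for p
    using pd1_Cauchy[of z0 r F "snd p" "fst p"] d r(2) that by (auto simp: subset_iff)
  ultimately have "continuous_on (ball z0 r \<times> ball w0 r) (pd1 F)"
    by (subst continuous_on_cong[OF refl]) auto
  moreover have "open (ball z0 r \<times> ball w0 r)" "(z0, w0) \<in> ball z0 r \<times> ball w0 r"
    using r by (auto intro: open_Times)
  ultimately show "isCont (pd1 F) (z0, w0)"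
    by (simp add: continuous_on_eq_continuous_at)
qed

lemma continuous_on_pd2:
  assumes W: "open W" and U: "holomorphic2_on U W"
  shows "continuous_on W (pd2 U)"
proof -
  have "(\<lambda>z. U (w, z)) field_differentiable at z" if "(w, z) \<in> W" for z w
    using holomorphic2_onD(3)[OF U that] field_differentiable_def by blast
  then have "continuous_on ((\<lambda>p. (snd p, fst p)) -` W) (\<lambda>p. pd2 U (snd p, fst p))"
    using continuous_on_pd1[OF open_swap_vimage[OF W]
        holomorphic2_on_imp_continuous_on[OF holomorphic2_on_swap[OF U]]]
    by (simp add: pd_swap)
  then have "continuous_on W (\<lambda>p. pd2 U (snd (snd p, fst p), fst (snd p, fst p)))"
    by (rule continuous_on_compose2[where f = "\<lambda>p. (snd p, fst p)"])
       (auto intro!: continuous_on_Pair continuous_on_fst continuous_on_snd)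
  then show ?thesis by simp
qed

text \<open>Differentiation under the integral sign moves the second-variable derivative onto
  \<open>U\<close>. The resulting integral is Cauchy's formula for \<open>pd1 (pd2 U)\<close>, but
  it can be read that way only once \<open>pd2 U\<close> is known to be holomorphic in the first
  variable.\<close>

lemma has_field_derivative_pd1_second:
  assumes U: "holomorphic2_on U W" and W: "open W"
    and r: "r > 0" "cball z0 r \<times> ball w0 r \<subseteq> W" and z: "z \<in> ball z0 r" and w: "w \<in> ball w0 r"
  shows "((\<lambda>w. pd1 U (z, w)) has_field_derivative 1 / (2 * of_real pi * \<i>) *
      integral (cbox 0 1) (\<lambda>t. pd2 U (circlepath z0 r t, w) / (circlepath z0 r t - z)\<^sup>2
         * vector_derivative (circlepath z0 r) (at t))) (at w)"
proof -
  let ?K = "\<lambda>F w t. F (circlepath z0 r t, w) / (circlepath z0 r t - z)\<^sup>2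
         * vector_derivative (circlepath z0 r) (at t)"
  have cont: "continuous_on (ball w0 r \<times> cbox 0 1) (\<lambda>(w, t). ?K F w t)"
    if "continuous_on W F" for F
  proof -
    have "continuous_on (cball z0 r \<times> ball w0 r) F"
      using r that continuous_on_subset by blast
    from continuous_on_compose2[OF continuous_on_Cauchy_kernel[OF this],
        of "ball w0 r \<times> cbox 0 1" "\<lambda>q. ((z, fst q), snd q)"]
    have "continuous_on (ball w0 r \<times> cbox 0 1) (\<lambda>q. case ((z, fst q), snd q) of (p, t) \<Rightarrow>
        F (circlepath z0 r t, snd p) / (circlepath z0 r t - fst p)\<^sup>2
          * vector_derivative (circlepath z0 r) (at t))"
      using z by (simp add: continuous_on_Pair continuous_on_fst continuous_on_snd image_subset_iff)
    then show ?thesis by (simp only: case_prod_unfold fst_conv snd_conv)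
  qed
  have i: "circlepath z0 r t \<in> cball z0 r" for t
    using r by (simp add: circlepath dist_norm norm_mult)
  have "((\<lambda>w. integral (cbox 0 1) (?K U w)) has_field_derivative
      integral (cbox 0 1) (?K (pd2 U) w)) (at w within ball w0 r)"
  proof (rule leibniz_rule_field_derivative)
    show "((\<lambda>w. ?K U w t) has_field_derivative ?K (pd2 U) w t) (at w within ball w0 r)"
      if "w \<in> ball w0 r" "t \<in> cbox 0 1" for w t
    proof -
      have "(circlepath z0 r t, w) \<in> W" using r(2) i that by blast
      then have "((\<lambda>w. U (circlepath z0 r t, w)) has_field_derivative
          pd2 U (circlepath z0 r t, w)) (at w within ball w0 r)"
        using holomorphic2_onD(3)[OF U] DERIV_subset by blast
      then show ?thesis
        by (intro DERIV_cmult_right DERIV_cdivide)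
    qed
    show "?K U w integrable_on cbox 0 1" if "w \<in> ball w0 r" for w
    proof (rule integrable_continuous)
      show "continuous_on (cbox 0 1) (?K U w)"
        using continuous_on_compose2[OF cont[OF holomorphic2_on_imp_continuous_on[OF U]],
            of "cbox 0 1" "\<lambda>t. (w, t)"] that
        by (simp add: continuous_on_Pair image_subset_iff)
    qed
    show "continuous_on (ball w0 r \<times> cbox 0 1) (\<lambda>(w, t). ?K (pd2 U) w t)"
      by (rule cont[OF continuous_on_pd2[OF W U]])
  qed (use w in auto)
  then have "((\<lambda>w. 1 / (2 * of_real pi * \<i>) * integral (cbox 0 1) (?K U w)) has_field_derivative
      1 / (2 * of_real pi * \<i>) * integral (cbox 0 1) (?K (pd2 U) w)) (at w)"
    using w by (intro DERIV_cmult) (simp add: at_within_open[OF _ open_ball])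
  then show ?thesis
  proof (rule has_field_derivative_transform_within_open[OF _ open_ball w])
    fix w assume "w \<in> ball w0 r"
    then show "1 / (2 * of_real pi * \<i>) * integral (cbox 0 1) (?K U w) = pd1 U (z, w)"
    proof (intro pd1_Cauchy[symmetric] z)
      fix x assume "x \<in> cball z0 r"
      then have "(x, w) \<in> W" using r \<open>w \<in> ball w0 r\<close> by auto
      then show "(\<lambda>z. U (z, w)) field_differentiable at x"
        using holomorphic2_onD(2)[OF U] field_differentiable_def by blast
    qed
  qed
qed

text \<open>Swapping the variables turns \<open>pd2 U\<close> into a \<open>pd1\<close> and the
  claim into the preceding lemma. Symmetry of the mixed derivatives then follows by comparing two
  Cauchy integrals.\<close>

lemma field_differentiable_pd2_first:
  assumes U: "holomorphic2_on U W" and W: "open W" and p: "(z, w) \<in> W"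
  shows "(\<lambda>z. pd2 U (z, w)) field_differentiable at z"
proof -
  have "(w, z) \<in> (\<lambda>p. (snd p, fst p)) -` W" using p by simp
  from polydisc_subset[OF open_swap_vimage[OF W] this]
  obtain r where r: "r > 0" "cball w r \<times> ball z r \<subseteq> (\<lambda>p. (snd p, fst p)) -` W" by blast
  from has_field_derivative_pd1_second[OF holomorphic2_on_swap[OF U] open_swap_vimage[OF W] r, of w z] r(1)
  show ?thesis by (auto simp: pd_swap field_differentiable_def)
qed

lemma has_field_derivative_pd1_second':
  assumes U: "holomorphic2_on U W" and W: "open W" and p: "(z, w) \<in> W"
  shows "((\<lambda>w. pd1 U (z, w)) has_field_derivative pd1 (pd2 U) (z, w)) (at w)"
proof -
  obtain r where r: "r > 0" "cball z r \<times> ball w r \<subseteq> W"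
    using polydisc_subset[OF W p] .
  have "pd1 (pd2 U) (z, w) = 1 / (2 * of_real pi * \<i>) *
    integral (cbox 0 1) (\<lambda>t. pd2 U (circlepath z r t, w) / (circlepath z r t - z)\<^sup>2
       * vector_derivative (circlepath z r) (at t))"
  proof (rule pd1_Cauchy)
    fix x assume "x \<in> cball z r"
    then have "(x, w) \<in> W" using r by auto
    then show "(\<lambda>z. pd2 U (z, w)) field_differentiable at x"
      by (rule field_differentiable_pd2_first[OF U W])
  qed (use r in simp)
  then show ?thesis
    using has_field_derivative_pd1_second[OF U W r, of z w] r(1) by simp
qed

lemma holomorphic2_on_pd1:
  assumes U: "holomorphic2_on U W" and W: "open W"
  shows "holomorphic2_on (pd1 U) W"
  unfolding holomorphic2_on_def
proof safe
  fix z w assume p: "(z, w) \<in> W"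
  obtain A B where AB: "open A" "open B" "z \<in> A" "w \<in> B" "A \<times> B \<subseteq> W"
    using open_prod_elim[OF W p] by (metis mem_Sigma_iff)
  obtain d where d: "d > 0" "ball w d \<subseteq> B"
    using open_contains_ball_eq[OF AB(2)] AB(4) by blast
  have "(\<lambda>z. U (z, w)) holomorphic_on A"
    unfolding holomorphic_on_open[OF AB(1)] using holomorphic2_onD(2)[OF U] AB(4,5) by blast
  then have "(\<lambda>z. pd1 U (z, w)) holomorphic_on A"
    using AB by (simp add: pd1_def holomorphic_deriv)
  then obtain c where c: "((\<lambda>z. pd1 U (z, w)) has_field_derivative c) (at z within A)"
    using AB(3) unfolding holomorphic_on_def field_differentiable_def by blast
  \<comment> \<open>Total differentiability from partial derivatives: one partial at the point, the
    other on a neighbourhood and continuous at the point. The second one is the mixed derivative,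
    continuous as \<open>pd1\<close> of the continuous \<open>pd2 U\<close>.\<close>
  have "((\<lambda>(x, y). pd1 U (x, y)) has_derivative
      (\<lambda>(tx, ty). (*) c tx + blinfun_mult_right (pd1 (pd2 U) (z, w)) ty))
      (at (z, w) within A \<times> ball w d)"
  proof (rule has_derivative_partialsI)
    show "((\<lambda>x. pd1 U (x, w)) has_derivative (*) c) (at z within A)"
      using c by (simp add: has_field_derivative_def)
    show "((\<lambda>y. pd1 U (x, y)) has_derivative blinfun_apply (blinfun_mult_right (pd1 (pd2 U) (x, y))))
        (at y within ball w d)" if "x \<in> A" "y \<in> ball w d" for x y
    proof -
      have "(x, y) \<in> W" using AB d that by blast
      from has_field_derivative_pd1_second'[OF U W this]
      show ?thesis by (simp add: has_field_derivative_def has_derivative_at_withinI)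
    qed
    have "continuous_on W (pd1 (pd2 U))"
      using continuous_on_pd1[OF W continuous_on_pd2[OF W U]] field_differentiable_pd2_first[OF U W]
      by blast
    then have "continuous_on W (\<lambda>p. blinfun_mult_right (pd1 (pd2 U) p))"
      by (intro continuous_intros)
    then have "isCont (\<lambda>p. blinfun_mult_right (pd1 (pd2 U) p)) (z, w)"
      using continuous_on_eq_continuous_at[OF W] p by blast
    then show "continuous (at (z, w) within A \<times> ball w d) (\<lambda>(x, y). blinfun_mult_right (pd1 (pd2 U) (x, y)))"
      by (simp add: case_prod_unfold continuous_at_imp_continuous_at_within)
  qed (use d in auto)
  moreover have "at (z, w) within A \<times> ball w d = at (z, w)"
    using AB d by (intro at_within_open open_Times open_ball) auto
  ultimately have "(pd1 U has_derivative (\<lambda>(h1, h2). c * h1 + pd1 (pd2 U) (z, w) * h2)) (at (z, w))"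
    by (simp add: case_prod_unfold)
  then show "\<exists>a b. (pd1 U has_derivative (\<lambda>(h1, h2). a * h1 + b * h2)) (at (z, w))"
    by blast
qed

lemma holomorphic2_on_pd2:
  assumes U: "holomorphic2_on U W" and W: "open W"
  shows "holomorphic2_on (pd2 U) W"
proof -
  from holomorphic2_on_swap[OF holomorphic2_on_pd1[OF holomorphic2_on_swap[OF U] open_swap_vimage[OF W]]]
  show ?thesis by (simp add: pd_swap vimage_def)
qed

lemma pd2_pd1:
  assumes U: "holomorphic2_on U W" and W: "open W" and p: "p \<in> W"
  shows "pd2 (pd1 U) p = pd1 (pd2 U) p"
  using has_field_derivative_pd1_second'[OF U W, of "fst p" "snd p"] p
  by (simp add: pd2_def[of "pd1 U"] DERIV_imp_deriv)

section \<open>Laplace asymptotics at a simple saddle point\<close>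

lemma has_bochner_integral_gaussian_even:
  assumes "lam > 0"
  shows "has_bochner_integral lborel (\<lambda>x. exp (- (lam * x\<^sup>2)) * x ^ (2 * k))
    (sqrt pi * (fact (2 * k) / (2 ^ (2 * k) * fact k)) * lam powr - (real k + 1 / 2))"
proof -
  have "has_bochner_integral lborel (\<lambda>x. exp (-x\<^sup>2) * x ^ (2 * k))
      (sqrt pi * (fact (2 * k) / (2 ^ (2 * k) * fact k)))" (is "has_bochner_integral _ _ ?m")
    using has_bochner_integral_even_function[OF gaussian_moment_even_pos[where k=k]] by simp
  then have "has_bochner_integral lborel
      (\<lambda>x. exp (- (0 + sqrt lam * x)\<^sup>2) * (0 + sqrt lam * x) ^ (2 * k)) (?m /\<^sub>R \<bar>sqrt lam\<bar>)"
    using assms by (subst (asm) lborel_has_bochner_integral_real_affine_iff[where c = "sqrt lam" and t = 0]) auto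
  then have "has_bochner_integral lborel
      (\<lambda>x. (exp (- (0 + sqrt lam * x)\<^sup>2) * (0 + sqrt lam * x) ^ (2 * k)) * lam powr - real k)
      (?m /\<^sub>R \<bar>sqrt lam\<bar> * lam powr - real k)"
    by (rule has_bochner_integral_mult_left)
  also have "(\<lambda>x. (exp (- (0 + sqrt lam * x)\<^sup>2) * (0 + sqrt lam * x) ^ (2 * k)) * lam powr - real k)
      = (\<lambda>x. exp (- (lam * x\<^sup>2)) * x ^ (2 * k))"
    using assms by (auto simp: power_mult_distrib power_mult powr_minus powr_realpow)
  also have "?m /\<^sub>R \<bar>sqrt lam\<bar> * lam powr - real k = ?m * lam powr - (real k + 1 / 2)"
  proof -
    have "lam powr - (real k + 1 / 2) = lam powr - real k / sqrt lam"
      by (simp only: minus_add_distrib add_uminus_conv_diff powr_diff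
          powr_half_sqrt[OF less_imp_le[OF assms]])
    then show ?thesis using assms by (simp only: divide_inverse real_scaleR_def abs_of_pos real_sqrt_gt_0_iff mult_ac)
  qed
  finally show ?thesis .
qed

lemma has_bochner_integral_gaussian_odd:
  assumes "lam > 0"
  shows "has_bochner_integral lborel (\<lambda>x::real. exp (- (lam * x\<^sup>2)) * x ^ (2 * k + 1)) 0"
proof -
  have "has_bochner_integral lborel (\<lambda>x. exp (- x\<^sup>2) * x ^ (2 * k + 1) :: real) 0"
    using gaussian_moment_odd_pos by (rule has_bochner_integral_odd_function) simp
  then have "has_bochner_integral lborel
      (\<lambda>x. exp (- (0 + sqrt lam * x)\<^sup>2) * (0 + sqrt lam * x) ^ (2 * k + 1)) (0 /\<^sub>R \<bar>sqrt lam\<bar>)"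
    using assms by (subst (asm) lborel_has_bochner_integral_real_affine_iff[where c = "sqrt lam" and t = 0]) auto
  then have "has_bochner_integral lborel
      (\<lambda>x. (exp (- (0 + sqrt lam * x)\<^sup>2) * (0 + sqrt lam * x) ^ (2 * k + 1)) * (1 / sqrt lam ^ (2 * k + 1)))
      (0 /\<^sub>R \<bar>sqrt lam\<bar> * (1 / sqrt lam ^ (2 * k + 1)))"
    by (rule has_bochner_integral_mult_left)
  also have "(\<lambda>x. (exp (- (0 + sqrt lam * x)\<^sup>2) * (0 + sqrt lam * x) ^ (2 * k + 1)) * (1 / sqrt lam ^ (2 * k + 1)))
      = (\<lambda>x. exp (- (lam * x\<^sup>2)) * x ^ (2 * k + 1))"
    using assms by (auto simp: power_mult_distrib)
  finally show ?thesis by simp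
qed

text \<open>The order is three because the odd Gaussian moments vanish: the cubic term costs
  nothing, and the quartic remainder gives an error \<open>lam powr (-5/2)\<close>, a full power of
  \<open>lam\<close> below the second term.\<close>

lemma holomorphic_cubic_Taylor_bound:
  assumes G: "G holomorphic_on ball 0 \<rho>" and r: "0 < r" "r < \<rho>"
  obtains M where "\<And>z. norm z \<le> r \<Longrightarrow>
    norm (G z - (\<Sum>i\<le>3. (deriv ^^ i) G 0 * z ^ i / fact i)) \<le> M * norm z ^ 4" "M \<ge> 0"
proof -
  have h: "(deriv ^^ i) G holomorphic_on ball 0 \<rho>" for i
    using G by (simp add: holomorphic_higher_deriv)
  have sub: "cball 0 r \<subseteq> ball 0 \<rho>" using r by auto
  have "compact ((deriv ^^ 4) G ` cball 0 r)"
    by (intro compact_continuous_image compact_cball holomorphic_on_imp_continuous_on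
        holomorphic_on_subset[OF h sub])
  then obtain B where B: "B > 0" "\<And>z. z \<in> cball 0 r \<Longrightarrow> norm ((deriv ^^ 4) G z) \<le> B"
    using compact_imp_bounded bounded_pos by (metis imageI)
  show thesis
  proof (rule that[of "B / fact 3"])
    fix z :: complex assume z: "norm z \<le> r"
    have "norm ((deriv ^^ 0) G z - (\<Sum>i\<le>3. (deriv ^^ i) G 0 * (z - 0) ^ i / fact i))
        \<le> B * cmod (z - 0) ^ Suc 3 / fact 3"
    proof (rule complex_Taylor[of "cball 0 r"])
      show "((deriv ^^ i) G has_field_derivative (deriv ^^ Suc i) G x) (at x within cball 0 r)"
        if "x \<in> cball 0 r" for i x
      proof -
        have "((deriv ^^ i) G has_field_derivative deriv ((deriv ^^ i) G) x) (at x)"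
          using that r by (intro holomorphic_derivI[OF h]) auto
        then show ?thesis by (simp add: has_field_derivative_at_within)
      qed
    next
      show "z \<in> cball 0 r" "(0::complex) \<in> cball 0 r" using z r by auto
      show "norm ((deriv ^^ Suc 3) G x) \<le> B" if "x \<in> cball 0 r" for x
        using B(2)[OF that] by (simp add: eval_nat_numeral)
    qed simp
    then show "norm (G z - (\<Sum>i\<le>3. (deriv ^^ i) G 0 * z ^ i / fact i)) \<le> B / fact 3 * norm z ^ 4"
      by (simp add: eval_nat_numeral)
  qed (use B in simp)
qed

text \<open>The polynomial is integrated over the whole line, \<open>G\<close> only over the
  segment. Extended by zero, \<open>G\<close> still differs from \<open>p\<close> by at most a
  multiple of \<open>x ^ 4\<close>, since \<open>\<bar>x\<bar> ^ i \<le> x ^ 4 / r ^ (4 - i)\<close>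
  for \<open>\<bar>x\<bar> > r\<close>; so the fourth moment controls the Taylor error and the
  missing tails together.\<close>

lemma Laplace_real_axis:
  assumes G: "G holomorphic_on ball 0 \<rho>" and r: "0 < r" "r < \<rho>"
  obtains K where "\<And>lam. lam > 0 \<Longrightarrow>
    norm (contour_integral (linepath (- of_real r) (of_real r)) (\<lambda>w. G w * exp (- (of_real lam * w\<^sup>2)))
       - of_real (sqrt pi) * (G 0 * of_real (lam powr (-1/2)) + (deriv ^^ 2) G 0 / 4 * of_real (lam powr (-3/2))))
    \<le> K * lam powr (-5/2)"
proof -
  define c where "c i = (deriv ^^ i) G 0 / fact i" for i
  define p where "p x = (\<Sum>i\<le>3. c i * of_real x ^ i)" for x :: real
  define q where "q x = (if x \<in> {-r..r} then G (of_real x) else 0)" for x :: real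
  obtain M where M: "M \<ge> 0" "\<And>z. norm z \<le> r \<Longrightarrow>
    norm (G z - (\<Sum>i\<le>3. (deriv ^^ i) G 0 * z ^ i / fact i)) \<le> M * norm z ^ 4"
    using holomorphic_cubic_Taylor_bound[OF G r] by blast
  define M' where "M' = M + (\<Sum>i\<le>3. norm (c i) / r ^ (4 - i))"
  have bound: "norm (q x - p x) \<le> M' * x ^ 4" for x
  proof (cases "x \<in> {-r..r}")
    case True
    have "norm (q x - p x) \<le> M * x ^ 4"
      using M(2)[of "of_real x"] True by (simp add: q_def p_def c_def abs_le_iff)
    also have "\<dots> \<le> M' * x ^ 4"
      using r by (intro mult_right_mono) (auto simp: M'_def intro!: sum_nonneg)
    finally show ?thesis .
  next
    case False
    then have x: "\<bar>x\<bar> > r" by auto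
    have "norm (q x - p x) \<le> (\<Sum>i\<le>3. norm (c i * of_real x ^ i))"
      using False by (auto simp: q_def p_def intro: norm_sum)
    also have "\<dots> \<le> (\<Sum>i\<le>3. norm (c i) / r ^ (4 - i) * x ^ 4)"
    proof (rule sum_mono)
      fix i :: nat assume i: "i \<in> {..3}"
      have "r ^ (4 - i) \<le> \<bar>x\<bar> ^ (4 - i)" using x r by (intro power_mono) auto
      then have "\<bar>x\<bar> ^ i * r ^ (4 - i) \<le> \<bar>x\<bar> ^ i * \<bar>x\<bar> ^ (4 - i)" by (intro mult_left_mono) auto
      also have "\<dots> = \<bar>x\<bar> ^ 4" using i by (simp flip: power_add)
      also have "\<dots> = x ^ 4" by simp
      finally have "\<bar>x\<bar> ^ i \<le> x ^ 4 / r ^ (4 - i)" using r by (simp add: pos_le_divide_eq)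
      from mult_left_mono[OF this, of "norm (c i)"]
      show "norm (c i * of_real x ^ i) \<le> norm (c i) / r ^ (4 - i) * x ^ 4"
        by (simp add: norm_mult norm_power)
    qed
    also have "\<dots> \<le> M' * x ^ 4"
      using M(1) by (simp add: M'_def algebra_simps sum_distrib_left)
    finally show ?thesis .
  qed
  show thesis
  proof (rule that[of "M' * (sqrt pi * (fact (2*2) / (2 ^ (2*2) * fact 2)))"])
    fix lam :: real assume lam: "lam > 0"
    define e where "e x = exp (- (lam * x\<^sup>2))" for x :: real
    have m: "has_bochner_integral lborel (\<lambda>x. c i * of_real (e x * x ^ i)) (c i * of_real v)"
      if "has_bochner_integral lborel (\<lambda>x. e x * x ^ i) v" for i v
      by (intro has_bochner_integral_mult_right has_bochner_integral_of_real that)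
    have p: "has_bochner_integral lborel (\<lambda>x. of_real (e x) * p x)
      (of_real (sqrt pi) * (G 0 * of_real (lam powr (-1/2)) + (deriv ^^ 2) G 0 / 4 * of_real (lam powr (-3/2))))"
    proof -
      have i: "has_bochner_integral lborel (\<lambda>x. e x * x ^ 0) (sqrt pi * lam powr (-1/2))"
        "has_bochner_integral lborel (\<lambda>x. e x * x ^ 1) 0"
        "has_bochner_integral lborel (\<lambda>x. e x * x ^ 2) (sqrt pi / 2 * lam powr (-3/2))"
        "has_bochner_integral lborel (\<lambda>x. e x * x ^ 3) 0"
        using has_bochner_integral_gaussian_even[OF lam, of 0] has_bochner_integral_gaussian_even[OF lam, of 1]
          has_bochner_integral_gaussian_odd[OF lam, of 0] has_bochner_integral_gaussian_odd[OF lam, of 1]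
        by (simp_all add: e_def)
      have "has_bochner_integral lborel
         (\<lambda>x. c 0 * of_real (e x * x ^ 0) + c 1 * of_real (e x * x ^ 1) + c 2 * of_real (e x * x ^ 2)
            + c 3 * of_real (e x * x ^ 3))
         (c 0 * of_real (sqrt pi * lam powr (-1/2)) + c 1 * of_real 0
           + c 2 * of_real (sqrt pi / 2 * lam powr (-3/2)) + c 3 * of_real 0)"
        by (intro has_bochner_integral_add m i)
      then show ?thesis
        by (simp add: p_def c_def eval_nat_numeral algebra_simps)
    qed
    have Gc: "continuous_on {-r..r} (\<lambda>x. G (of_real x))"
      by (rule continuous_on_compose2[OF holomorphic_on_imp_continuous_on[OF G]])
         (use r in \<open>auto intro!: continuous_intros\<close>)
    have qc: "set_integrable lborel {-r..r} (\<lambda>x. of_real (e x) * G (of_real x))"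
      unfolding e_def by (intro borel_integrable_atLeastAtMost' continuous_intros Gc)
    have qe: "(\<lambda>x. of_real (e x) * q x) = (\<lambda>x. indicator {-r..r} x *\<^sub>R (of_real (e x) * G (of_real x)))"
      by (auto simp: q_def fun_eq_iff)
    have q: "integrable lborel (\<lambda>x. of_real (e x) * q x)"
      using qc by (simp add: qe set_integrable_def)
    have "contour_integral (linepath (- of_real r) (of_real r)) (\<lambda>w. G w * exp (- (of_real lam * w\<^sup>2)))
        = integral {-r..r} (\<lambda>x. G (of_real x) * exp (- (of_real lam * (of_real x)\<^sup>2)))"
      using r by (subst contour_integral_linepath_Reals_eq) auto
    also have "\<dots> = integral {-r..r} (\<lambda>x. of_real (e x) * G (of_real x))"
      by (intro integral_cong) (simp add: e_def exp_of_real[symmetric])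
    also have "\<dots> = (LINT x|lborel. of_real (e x) * q x)"
      using set_borel_integral_eq_integral(2)[OF qc] by (simp add: qe set_lebesgue_integral_def)
    finally have C: "contour_integral (linepath (- of_real r) (of_real r)) (\<lambda>w. G w * exp (- (of_real lam * w\<^sup>2)))
        = (LINT x|lborel. of_real (e x) * q x)" .
    have 4: "has_bochner_integral lborel (\<lambda>x. M' * (e x * x ^ 4))
        (M' * (sqrt pi * (fact (2*2) / (2 ^ (2*2) * fact 2)) * lam powr (-5/2)))"
      using has_bochner_integral_mult_right[OF has_bochner_integral_gaussian_even[OF lam, of 2], of M']
      by (simp add: e_def)
    have "norm (LINT x|lborel. of_real (e x) * q x - of_real (e x) * p x)
        \<le> (LINT x|lborel. M' * (e x * x ^ 4))"
    proof (rule Bochner_Integration.integral_norm_bound_integral)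
      show "integrable lborel (\<lambda>x. of_real (e x) * q x - of_real (e x) * p x)"
        using q p by (simp add: has_bochner_integral_iff)
      show "integrable lborel (\<lambda>x. M' * (e x * x ^ 4))" using 4 by (simp add: has_bochner_integral_iff)
      fix x
      have "norm (of_real (e x) * q x - of_real (e x) * p x) = e x * norm (q x - p x)"
        by (simp add: norm_mult e_def flip: right_diff_distrib)
      also have "\<dots> \<le> e x * (M' * x ^ 4)" by (intro mult_left_mono bound) (simp add: e_def)
      finally show "norm (of_real (e x) * q x - of_real (e x) * p x) \<le> M' * (e x * x ^ 4)"
        by (simp add: mult_ac)
    qed
    also have "(LINT x|lborel. of_real (e x) * q x - of_real (e x) * p x) =
        (LINT x|lborel. of_real (e x) * q x) - of_real (sqrt pi) *
          (G 0 * of_real (lam powr (-1/2)) + (deriv ^^ 2) G 0 / 4 * of_real (lam powr (-3/2)))"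
      using q p by (simp add: has_bochner_integral_iff)
    also have "(LINT x|lborel. M' * (e x * x ^ 4))
        = M' * (sqrt pi * (fact (2*2) / (2 ^ (2*2) * fact 2))) * lam powr (-5/2)"
      using has_bochner_integral_integral_eq[OF 4] by simp
    finally show "norm (contour_integral (linepath (- of_real r) (of_real r)) (\<lambda>w. G w * exp (- (of_real lam * w\<^sup>2)))
       - of_real (sqrt pi) * (G 0 * of_real (lam powr (-1/2)) + (deriv ^^ 2) G 0 / 4 * of_real (lam powr (-3/2))))
      \<le> M' * (sqrt pi * (fact (2*2) / (2 ^ (2*2) * fact 2))) * lam powr (-5/2)"
      unfolding C .
  qed
qed

section \<open>The chart at a simple saddle point and its two valleys\<close>

lemma holomorphic_saddle_chart:
  assumes g: "g holomorphic_on T" "open T" "t0 \<in> T" and g1: "deriv g t0 = 0"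
    and a: "a\<^sup>2 * (deriv ^^ 2) g t0 = - 2"
  obtains \<phi> \<psi> N \<rho> where "\<rho> > 0" "open N" "t0 \<in> N" "N \<subseteq> T" "\<phi> holomorphic_on N"
    "\<psi> holomorphic_on ball 0 \<rho>" "\<And>t. t \<in> N \<Longrightarrow> \<phi> t \<in> ball 0 \<rho> \<and> \<psi> (\<phi> t) = t \<and> g t = g t0 - (\<phi> t)\<^sup>2"
    "\<And>w. w \<in> ball 0 \<rho> \<Longrightarrow> \<psi> w \<in> N \<and> \<phi> (\<psi> w) = w" "\<phi> t0 = 0" "deriv \<psi> 0 = a" "deriv \<phi> t0 * a = 1"
proof -
  have hg: "(\<lambda>t. - g t) holomorphic_on T" using g by (intro holomorphic_intros)
  have d2: "(deriv ^^ i) (\<lambda>t. - g t) t0 = - (deriv ^^ i) g t0" for i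
    by (rule higher_deriv_uminus[OF g])
  have n2: "(deriv ^^ 2) (\<lambda>t. - g t) t0 \<noteq> 0"
    using a by (auto simp: d2)
  have n1: "(deriv ^^ i) (\<lambda>t. - g t) t0 = 0" if "0 < i" "i < 2" for i
    using d2[of 1] g1 that by (auto simp: less_2_cases_iff)
  obtain s r where s: "0 < r" "s holomorphic_on ball t0 r"
      "\<And>w. w \<in> ball t0 r \<Longrightarrow> - g w - - g t0 = ((w - t0) * s w)\<^sup>2"
  proof (rule holomorphic_factor_order_of_zero_strong[OF hg g(2,3) zero_less_numeral n2 n1])
    fix s r assume "0 < r" "s holomorphic_on ball t0 r"
      "\<And>w. w \<in> ball t0 r \<Longrightarrow> - g w - - g t0 = ((w - t0) * s w)\<^sup>2"
    then show thesis by (rule that)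
  qed
  \<comment> \<open>\<open>(t - t0) * s t\<close> is a square root of \<open>g t0 - g\<close>. The
    factor \<open>a * s t0\<close> has square 1, so it is a sign; it selects the root whose inverse
    has derivative \<open>a\<close> and not \<open>- a\<close>, which fixes the orientation of the
    real segment. The requirement on \<open>a\<close> is the quadratic Taylor coefficient of
    \<open>g (\<psi> w) = g t0 - w^2\<close>.\<close>
  define F where "F t = (a * s t0) * ((t - t0) * s t)" for t
  obtain r' where r': "0 < r'" "r' \<le> r" "ball t0 r' \<subseteq> T"
  proof -
    obtain d where "d > 0" "ball t0 d \<subseteq> T" using open_contains_ball_eq[OF g(2)] g(3) by blast
    then have "0 < min d r" "min d r \<le> r" "ball t0 (min d r) \<subseteq> T" using s(1) by auto
    then show ?thesis by (rule that)
  qed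
  have hF: "F holomorphic_on ball t0 r'"
    unfolding F_def
    by (intro holomorphic_intros holomorphic_on_subset[OF s(2)] subset_ball r')
  have t0: "t0 \<in> ball t0 r'" using r' by simp
  have sd: "(s has_field_derivative deriv s t0) (at t0)"
    by (rule holomorphic_derivI[OF s(2)]) (use s(1) in auto)
  have Fd: "(F has_field_derivative (a * s t0) * s t0) (at t0)"
    unfolding F_def by (auto intro!: derivative_eq_intros sd)
  have "(deriv ^^ 2) g t0 = - 2 * (s t0)\<^sup>2"
  proof -
    define L where "L t = (t - t0) * s t" for t
    have hL: "L holomorphic_on ball t0 r" unfolding L_def by (intro holomorphic_intros s)
    have L: "(L has_field_derivative s t0) (at t0)"
      unfolding L_def by (auto intro!: derivative_eq_intros sd)
    have "deriv g t = - 2 * L t * deriv L t" if t: "t \<in> ball t0 r" for t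
    proof -
      have "((\<lambda>t. g t0 - (L t)\<^sup>2) has_field_derivative - 2 * L t * deriv L t) (at t)"
        by (auto intro!: derivative_eq_intros holomorphic_derivI[OF hL _ t])
      then have "(g has_field_derivative - 2 * L t * deriv L t) (at t)"
        by (rule has_field_derivative_transform_within_open[OF _ open_ball t])
           (use s(3) in \<open>auto simp: L_def algebra_simps\<close>)
      then show ?thesis by (rule DERIV_imp_deriv)
    qed
    moreover have "((\<lambda>t. - 2 * L t * deriv L t) has_field_derivative - 2 * (s t0)\<^sup>2) (at t0)"
    proof -
      have "(deriv L has_field_derivative deriv (deriv L) t0) (at t0)"
        by (rule holomorphic_derivI[of _ "ball t0 r"]) (use hL s(1) in \<open>auto intro: holomorphic_deriv\<close>)
      then have "((\<lambda>t. - 2 * L t * deriv L t) has_field_derivative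
          (- 2 * s t0) * deriv L t0 + deriv (deriv L) t0 * (- 2 * L t0)) (at t0)"
        by (intro DERIV_mult DERIV_cmult L)
      then show ?thesis using DERIV_imp_deriv[OF L] by (simp add: L_def power2_eq_square mult.assoc)
    qed
    ultimately have "(deriv g has_field_derivative - 2 * (s t0)\<^sup>2) (at t0)"
      using s(1) by (elim has_field_derivative_transform_within_open[of _ _ _ "ball t0 r"]) auto
    then show ?thesis by (simp add: eval_nat_numeral DERIV_imp_deriv)
  qed
  then have as: "(a * s t0)\<^sup>2 = 1" using a by (simp add: power_mult_distrib)
  have F1: "deriv F t0 * a = 1" using as by (simp add: DERIV_imp_deriv[OF Fd] power2_eq_square mult_ac)
  then have "deriv F t0 \<noteq> 0" by auto
  from has_complex_derivative_locally_injective[OF hF t0 open_ball this]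
  obtain r1 where r1: "r1 > 0" "ball t0 r1 \<subseteq> ball t0 r'" "inj_on F (ball t0 r1)" by blast
  have hF1: "F holomorphic_on ball t0 r1" using hF r1(2) holomorphic_on_subset by blast
  obtain \<psi> where \<psi>: "\<psi> holomorphic_on (F ` ball t0 r1)"
      "\<And>z. z \<in> ball t0 r1 \<Longrightarrow> deriv F z * deriv \<psi> (F z) = 1"
      "\<And>z. z \<in> ball t0 r1 \<Longrightarrow> \<psi> (F z) = z"
    using holomorphic_has_inverse[OF hF1 open_ball r1(3)] by blast
  have "open (F ` ball t0 r1)" by (rule open_mapping_thm3[OF hF1 open_ball r1(3)])
  moreover have F0: "F t0 = 0" by (simp add: F_def)
  moreover have "0 \<in> F ` ball t0 r1" using F0 r1(1) by (auto intro!: image_eqI[of _ _ t0])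
  ultimately obtain \<rho> where \<rho>: "\<rho> > 0" "ball 0 \<rho> \<subseteq> F ` ball t0 r1"
    using open_contains_ball_eq by blast
  define N where "N = ball t0 r1 \<inter> F -` ball 0 \<rho>"
  show thesis
  proof (rule that[of \<rho> N F \<psi>])
    show "open N"
      unfolding N_def using continuous_open_preimage[OF holomorphic_on_imp_continuous_on[OF hF1]] by blast
    show "t0 \<in> N" using F0 \<rho> r1 by (simp add: N_def)
    show "N \<subseteq> T" using r1 r' by (auto simp: N_def)
    show "F holomorphic_on N" by (rule holomorphic_on_subset[OF hF1]) (simp add: N_def)
    show "\<psi> holomorphic_on ball 0 \<rho>" using \<psi>(1) \<rho>(2) holomorphic_on_subset by blast
    show "F t \<in> ball 0 \<rho> \<and> \<psi> (F t) = t \<and> g t = g t0 - (F t)\<^sup>2" if t: "t \<in> N" for t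
    proof -
      have "t \<in> ball t0 r" using t r1 r' by (auto simp: N_def)
      from s(3)[OF this] have "g t = g t0 - ((t - t0) * s t)\<^sup>2" by (simp add: algebra_simps)
      also have "((t - t0) * s t)\<^sup>2 = (F t)\<^sup>2" by (simp add: F_def power_mult_distrib[of "a * s t0"] as)
      finally show ?thesis using t \<psi>(3) by (simp add: N_def)
    qed
    show "\<psi> w \<in> N \<and> F (\<psi> w) = w" if w: "w \<in> ball 0 \<rho>" for w
      using w \<rho>(2) \<psi>(3) by (auto simp: N_def)
    show "deriv \<psi> 0 = a"
    proof -
      have "deriv F t0 * deriv \<psi> 0 = deriv F t0 * a" using \<psi>(2)[of t0] F1 F0 r1(1) by simp
      then show ?thesis using \<open>deriv F t0 \<noteq> 0\<close> by simp
    qed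
  qed (use \<rho> F0 F1 in auto)
qed

text \<open>\<open>Re (w^2) > 0\<close> places \<open>w\<close> in the double cone around the real
  axis, where \<open>norm w / 2 < \<bar>Re w\<bar>\<close>; a perturbation of at most
  \<open>norm w / 2\<close> cannot change the sign of the real part. Here \<open>w\<close> is the
  chart coordinate of a contour point and \<open>\<tau>\<close> its linearization.\<close>

lemma saddle_sign:
  fixes w \<tau> :: complex
  assumes "Re (w\<^sup>2) > 0" "norm (\<tau> - w) \<le> norm w / 2"
  shows "Re w \<noteq> 0" "sgn (Re \<tau>) = sgn (Re w)" "\<bar>Im w\<bar> < \<bar>Re w\<bar>"
proof -
  have 1: "(Im w)\<^sup>2 < (Re w)\<^sup>2" using assms(1) by (simp add: power2_eq_square)
  then show "\<bar>Im w\<bar> < \<bar>Re w\<bar>" by (simp add: abs_square_less_1 power2_less_imp_less abs_le_square_iff[symmetric] flip: not_le)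
  show "Re w \<noteq> 0" using 1 by auto
  have "(norm w / 2)\<^sup>2 < (Re w)\<^sup>2"
  proof -
    have gen: "y < x \<Longrightarrow> 0 \<le> y \<Longrightarrow> (x + y) / 4 < x" for x y :: real by simp
    have "(norm w / 2)\<^sup>2 = ((Re w)\<^sup>2 + (Im w)\<^sup>2) / 4" by (simp add: cmod_power2 power_divide)
    also have "\<dots> < (Re w)\<^sup>2" by (rule gen[OF 1 zero_le_power2])
    finally show ?thesis .
  qed
  then have "norm w / 2 < \<bar>Re w\<bar>"
    by (metis abs_ge_zero power2_abs power2_less_imp_less)
  then have "\<bar>Re \<tau> - Re w\<bar> < \<bar>Re w\<bar>"
    using assms(2) abs_Re_le_cmod[of "\<tau> - w"] by simp
  then show "sgn (Re \<tau>) = sgn (Re w)" by (auto simp: sgn_if split: if_splits)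
qed

text \<open>In the chart coordinate the valley \<open>Re (w^2) > 0\<close> is the union of two
  opposite convex cones, so a segment between two points of the same cone never leaves the
  valley.\<close>

lemma convex_right_cone: "convex {w. \<bar>Im w\<bar> < Re w}"
proof -
  have "{w. \<bar>Im w\<bar> < Re w} = {w. Im w - Re w < 0} \<inter> {w. - Im w - Re w < 0}" by auto
  moreover have "convex {w. Im w - Re w < 0}" "convex {w. - Im w - Re w < 0}"
    using convex_halfspace_lt[of "Complex (-1) 1" 0] convex_halfspace_lt[of "Complex (-1) (-1)" 0]
    by (simp_all add: inner_complex_def algebra_simps)
  ultimately show ?thesis by (simp add: convex_Int)
qed

text \<open>\<open>L\<close> and \<open>m\<close> are produced before \<open>F\<close>,
  \<open>B\<close> and \<open>lam\<close> are chosen: the estimate is later applied to an amplitude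
  that varies with \<open>lam\<close>.\<close>

lemma valley_segment_bound:
  fixes \<psi> :: "complex \<Rightarrow> complex"
  assumes \<psi>: "\<psi> holomorphic_on ball 0 \<rho>" "\<psi> ` ball 0 \<rho> \<subseteq> T"
    and u: "u \<in> ball 0 \<rho>" "v \<in> ball 0 \<rho>" and cone: "closed_segment u v \<subseteq> {w. Re (w\<^sup>2) > 0}"
  obtains L m where "m > 0" "L \<ge> 0" "\<And>F B lam. F holomorphic_on T \<Longrightarrow> \<forall>z\<in>T. norm (F z) \<le> B \<Longrightarrow> lam \<ge> 0 \<Longrightarrow>
     norm (contour_integral (linepath u v) (\<lambda>w. F (\<psi> w) * deriv \<psi> w * exp (- (of_real lam * w\<^sup>2))))
       \<le> L * B * exp (- (lam * m))"
proof -
  have seg: "closed_segment u v \<subseteq> ball 0 \<rho>" using u by (simp add: closed_segment_subset)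
  have h: "deriv \<psi> holomorphic_on ball 0 \<rho>" using \<psi> by (simp add: holomorphic_deriv)
  have "compact (deriv \<psi> ` closed_segment u v)"
    by (intro compact_continuous_image compact_segment holomorphic_on_imp_continuous_on
        holomorphic_on_subset[OF h seg])
  then obtain D where D: "D > 0" "\<And>z. z \<in> closed_segment u v \<Longrightarrow> norm (deriv \<psi> z) \<le> D"
    using compact_imp_bounded bounded_pos by (metis imageI)
  have "compact ((\<lambda>w. Re (w\<^sup>2)) ` closed_segment u v)"
    by (intro compact_continuous_image compact_segment continuous_intros)
  moreover have "(\<lambda>w. Re (w\<^sup>2)) ` closed_segment u v \<noteq> {}" by simp
  ultimately obtain w0 where w0: "w0 \<in> closed_segment u v" "\<And>w. w \<in> closed_segment u v \<Longrightarrow> Re (w0\<^sup>2) \<le> Re (w\<^sup>2)"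
    using compact_attains_inf[of "(\<lambda>w. Re (w\<^sup>2)) ` closed_segment u v"] by auto
  show thesis
  proof (rule that[of "Re (w0\<^sup>2)" "D * norm (v - u)"])
    show "Re (w0\<^sup>2) > 0" using w0 cone by blast
    show "D * norm (v - u) \<ge> 0" using D by simp
    fix F B lam assume F: "F holomorphic_on T" "\<forall>z\<in>T. norm (F z) \<le> B" and lam: "(lam::real) \<ge> 0"
    have B: "B \<ge> 0" using F(2) \<psi>(2) u(1) norm_ge_zero by (meson image_subset_iff order_trans)
    let ?H = "\<lambda>w. F (\<psi> w) * deriv \<psi> w * exp (- (of_real lam * w\<^sup>2))"
    have "(F \<circ> \<psi>) holomorphic_on ball 0 \<rho>" by (rule holomorphic_on_compose_gen[OF \<psi>(1) F(1) \<psi>(2)])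
    then have "?H holomorphic_on ball 0 \<rho>" by (intro holomorphic_intros h) (simp add: o_def)
    then have "continuous_on (closed_segment u v) ?H"
      using seg holomorphic_on_imp_continuous_on holomorphic_on_subset by blast
    then have "norm (contour_integral (linepath u v) ?H) \<le> (B * D * exp (- (lam * Re (w0\<^sup>2)))) * norm (v - u)"
    proof (intro contour_integral_bound_linepath contour_integrable_continuous_linepath)
      fix w assume w: "w \<in> closed_segment u v"
      have "norm (?H w) = norm (F (\<psi> w)) * norm (deriv \<psi> w) * exp (- (lam * Re (w\<^sup>2)))"
        by (simp add: norm_mult)
      also have "\<dots> \<le> B * D * exp (- (lam * Re (w0\<^sup>2)))"
        using F(2) D(2)[OF w] B D(1) w0(2)[OF w] \<psi>(2) seg w lam
        by (intro mult_mono) (auto intro: mult_left_mono)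
      finally show "norm (?H w) \<le> B * D * exp (- (lam * Re (w0\<^sup>2)))" .
    qed (use B D in auto)
    then show "norm (contour_integral (linepath u v) ?H) \<le> D * norm (v - u) * B * exp (- (lam * Re (w0\<^sup>2)))"
      by (simp add: mult_ac)
  qed
qed

lemma valley_path_bound:
  assumes T: "open T" and g: "g holomorphic_on T" and p: "valid_path p" "path_image p \<subseteq> T"
    and val: "\<forall>t\<in>path_image p. Re (g t) < b"
  obtains L m where "m > 0" "L \<ge> 0" "\<And>F B lam. F holomorphic_on T \<Longrightarrow> \<forall>z\<in>T. norm (F z) \<le> B \<Longrightarrow> lam \<ge> 0 \<Longrightarrow>
     norm (contour_integral p (\<lambda>t. F t * exp (of_real lam * g t))) \<le> L * B * exp (lam * (b - m))"
proof -
  have cg: "continuous_on T g" by (rule holomorphic_on_imp_continuous_on[OF g])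
  have "compact ((\<lambda>t. Re (g t)) ` path_image p)"
    by (intro compact_continuous_image continuous_intros continuous_on_subset[OF cg] p(2)
        compact_path_image valid_path_imp_path p(1))
  moreover have "(\<lambda>t. Re (g t)) ` path_image p \<noteq> {}" by simp
  ultimately obtain t1 where t1: "t1 \<in> path_image p" "\<And>t. t \<in> path_image p \<Longrightarrow> Re (g t) \<le> Re (g t1)"
    using compact_attains_sup[of "(\<lambda>t. Re (g t)) ` path_image p"] by auto
  \<comment> \<open>Half the gap: on the path \<open>Re g \<le> b - 2 * m\<close>, which leaves room
    for an open set \<open>S\<close> around the path with \<open>Re g < b - m\<close>. The bound for
    contour integrals takes the supremum over an open set.\<close>
  define m where "m = (b - Re (g t1)) / 2"
  have m: "m > 0" using val t1(1) by (simp add: m_def)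
  define S where "S = T \<inter> g -` {z. Re z < b - m}"
  have S: "open S" unfolding S_def
    by (rule continuous_open_preimage[OF cg T]) (simp add: open_halfspace_Re_lt)
  have "path_image p \<subseteq> S"
    using p(2) t1(2) m by (force simp: S_def m_def field_simps)
  from contour_integral_bound_exists[OF S p(1) this] obtain L where L: "L > 0"
    "\<And>f B. f holomorphic_on S \<and> (\<forall>z\<in>S. norm (f z) \<le> B) \<Longrightarrow> norm (contour_integral p f) \<le> L * B"
    by meson
  show thesis
  proof (rule that[OF m, of L])
    fix F B lam assume F: "F holomorphic_on T" "\<forall>z\<in>T. norm (F z) \<le> B" and lam: "(lam::real) \<ge> 0"
    have "norm (contour_integral p (\<lambda>t. F t * exp (of_real lam * g t))) \<le> L * (B * exp (lam * (b - m)))"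
    proof (intro L conjI ballI)
      show "(\<lambda>t. F t * exp (of_real lam * g t)) holomorphic_on S"
        by (intro holomorphic_intros holomorphic_on_subset[OF F(1)] holomorphic_on_subset[OF g])
           (auto simp: S_def)
      fix z assume z: "z \<in> S"
      have "norm (F z * exp (of_real lam * g z)) = norm (F z) * exp (lam * Re (g z))"
        by (simp add: norm_mult)
      also have "\<dots> \<le> B * exp (lam * (b - m))"
        using F(2) z lam by (intro mult_mono) (auto simp: S_def intro!: mult_left_mono intro: order_trans[OF norm_ge_zero])
      finally show "norm (F z * exp (of_real lam * g z)) \<le> B * exp (lam * (b - m))" .
    qed
    then show "norm (contour_integral p (\<lambda>t. F t * exp (of_real lam * g t))) \<le> L * B * exp (lam * (b - m))"
      by (simp add: mult_ac)
  qed (use L in simp)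
qed

lemma convex_left_cone: "convex {w. \<bar>Im w\<bar> < - Re w}"
proof -
  have "{w. \<bar>Im w\<bar> < - Re w} = uminus ` {w. \<bar>Im w\<bar> < Re w}"
    by (auto intro!: image_eqI[of _ _ "- w" for w])
  then show ?thesis using convex_negations[OF convex_right_cone] by simp
qed

text \<open>Inside the chart the integrand has a primitive, so the path from \<open>c sm\<close> to
  \<open>c sp\<close> may be replaced by the polygon through \<open>wm\<close>, \<open>- r\<close>,
  \<open>r\<close>, \<open>wp\<close>. Its two outer legs stay in the valley because
  \<open>wm\<close> lies in the left cone and \<open>wp\<close> in the right one; this is where
  arrival and departure on opposite sides enter.\<close>

lemma saddle_localization:
  assumes T: "open T" and g: "g holomorphic_on T" and g1: "deriv g t0 = 0"
    and a: "a\<^sup>2 * (deriv ^^ 2) g t0 = - 2"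
    and c: "valid_path c" "path_image c \<subseteq> T" and s0: "s0 \<in> {0<..<1}" "c s0 = t0"
    and val: "\<forall>s\<in>{0..1} - {s0}. Re (g (c s)) < Re (g t0)"
    and right: "\<forall>\<^sub>F s in at_right s0. Re ((c s - t0) / a) > 0"
    and left: "\<forall>\<^sub>F s in at_left s0. Re ((c s - t0) / a) < 0"
  obtains \<psi> \<rho> r L m where "0 < r" "r < \<rho>" "m > 0" "L \<ge> 0"
    "\<psi> holomorphic_on ball 0 \<rho>" "\<psi> ` ball 0 \<rho> \<subseteq> T" "\<psi> 0 = t0" "deriv \<psi> 0 = a"
    "\<And>w. w \<in> ball 0 \<rho> \<Longrightarrow> g (\<psi> w) = g t0 - w\<^sup>2"
    "\<And>F B lam. F holomorphic_on T \<Longrightarrow> \<forall>z\<in>T. norm (F z) \<le> B \<Longrightarrow> lam \<ge> 0 \<Longrightarrow>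
      norm (contour_integral c (\<lambda>t. F t * exp (of_real lam * g t)) - exp (of_real lam * g t0) *
         contour_integral (linepath (- of_real r) (of_real r))
           (\<lambda>w. F (\<psi> w) * deriv \<psi> w * exp (- (of_real lam * w\<^sup>2))))
      \<le> L * B * exp (lam * (Re (g t0) - m))"
proof -
  have t0: "t0 \<in> T" using c(2) s0 by (auto simp: path_image_def)
  have a0: "a \<noteq> 0" using a by auto
  obtain \<phi> \<psi> N \<rho> where \<rho>: "\<rho> > 0" and N: "open N" "t0 \<in> N" "N \<subseteq> T" and \<phi>: "\<phi> holomorphic_on N"
    and \<psi>: "\<psi> holomorphic_on ball 0 \<rho>"
    and \<phi>\<psi>: "\<And>t. t \<in> N \<Longrightarrow> \<phi> t \<in> ball 0 \<rho> \<and> \<psi> (\<phi> t) = t \<and> g t = g t0 - (\<phi> t)\<^sup>2"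
    and \<psi>\<phi>: "\<And>w. w \<in> ball 0 \<rho> \<Longrightarrow> \<psi> w \<in> N \<and> \<phi> (\<psi> w) = w"
    and \<phi>0: "\<phi> t0 = 0" and \<psi>1: "deriv \<psi> 0 = a" and \<phi>1: "deriv \<phi> t0 * a = 1"
    by (rule holomorphic_saddle_chart[OF g T t0 g1 a]) (rule that)
  have \<psi>0: "\<psi> 0 = t0" using \<phi>\<psi>[OF N(2)] \<phi>0 by simp
  have \<psi>T: "\<psi> ` ball 0 \<rho> \<subseteq> T" using \<psi>\<phi> N(3) by blast
  have d\<psi>: "(\<psi> has_field_derivative a) (at 0)"
    using holomorphic_derivI[OF \<psi> open_ball, of 0] \<rho> \<psi>1 by simp
  \<comment> \<open>The tolerance \<open>norm a / 2\<close> becomes the relative error 1/2 of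
    \<open>saddle_sign\<close> after division by \<open>a\<close>. It links the direction
    hypotheses, stated for \<open>(c s - t0) / a\<close>, with the chart coordinate.\<close>
  obtain \<delta> where \<delta>: "\<delta> > 0"
    "\<And>w. norm w < \<delta> \<Longrightarrow> norm (\<psi> w - t0 - a * w) \<le> norm a / 2 * norm w"
    using d\<psi> a0 unfolding has_field_derivative_def has_derivative_at_alt
    by (auto simp: \<psi>0 dest!: spec[of _ "norm a / 2"])
  define M where "M = N \<inter> \<phi> -` ball 0 \<delta>"
  have "open M" unfolding M_def
    by (rule continuous_open_preimage[OF holomorphic_on_imp_continuous_on[OF \<phi>] N(1) open_ball])
  moreover have "t0 \<in> M" using N \<phi>0 \<delta>(1) by (simp add: M_def)
  ultimately obtain e where e: "e > 0" "ball t0 e \<subseteq> M" using open_contains_ball_eq by blast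
  have cc: "continuous_on {0..1} c"
    using valid_path_imp_path[OF c(1)] by (simp add: path_def)
  then obtain \<eta> where \<eta>: "\<eta> > 0" "\<And>s. s \<in> {0..1} \<Longrightarrow> \<bar>s - s0\<bar> < \<eta> \<Longrightarrow> c s \<in> M"
  proof -
    obtain d where "d > 0" "\<And>s. s \<in> {0..1} \<Longrightarrow> dist s s0 < d \<Longrightarrow> dist (c s) (c s0) < e"
      using cc e(1) s0(1) unfolding continuous_on_iff by (metis greaterThanLessThan_iff atLeastAtMost_iff less_imp_le)
    then show thesis
      using that[of d] e(2) s0(2) by (metis dist_commute dist_real_def mem_ball subsetD)
  qed
  have sq: "Re ((\<phi> (c s))\<^sup>2) > 0" if "s \<in> {0..1}" "s \<noteq> s0" "c s \<in> M" for s
  proof -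
    have "Re (g (c s)) < Re (g t0)" using val that(1,2) by blast
    then show ?thesis using \<phi>\<psi>[of "c s"] that(3) by (simp add: M_def)
  qed
  have \<tau>: "norm ((t - t0) / a - \<phi> t) \<le> norm (\<phi> t) / 2" if "t \<in> M" for t
  proof -
    have "norm (t - t0 - a * \<phi> t) \<le> norm a / 2 * norm (\<phi> t)"
      using \<delta>(2)[of "\<phi> t"] \<phi>\<psi>[of t] that by (simp add: M_def)
    moreover have "(t - t0) / a - \<phi> t = (t - t0 - a * \<phi> t) / a" using a0 by (simp add: field_simps)
    ultimately show ?thesis using a0 by (simp add: norm_divide field_simps)
  qed
  obtain b1 where b1: "b1 > s0" "\<And>s. s0 < s \<Longrightarrow> s < b1 \<Longrightarrow> Re ((c s - t0) / a) > 0"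
    using right unfolding eventually_at_right_field by blast
  obtain b2 where b2: "b2 < s0" "\<And>s. s < s0 \<Longrightarrow> b2 < s \<Longrightarrow> Re ((c s - t0) / a) < 0"
    using left unfolding eventually_at_left_field by blast
  \<comment> \<open>Half way from \<open>s0\<close> to the nearest obstruction: the end of the range
    where the direction is controlled, the exit from the chart, the end of the parameter
    interval.\<close>
  define sp where "sp = (s0 + min b1 (min (s0 + \<eta>) 1)) / 2"
  define sm where "sm = (s0 + max b2 (max (s0 - \<eta>) 0)) / 2"
  have sp: "s0 < sp" "sp < b1" "sp < s0 + \<eta>" "sp < 1"
    using b1(1) \<eta>(1) s0(1) by (auto simp: sp_def)
  have sm: "sm < s0" "b2 < sm" "s0 - \<eta> < sm" "0 < sm"
    using b2(1) \<eta>(1) s0(1) by (auto simp: sm_def)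
  have s01: "sp \<in> {0..1}" "sm \<in> {0..1}" using sp sm s0 by auto
  have mid: "c s \<in> M" if "s \<in> {sm..sp}" for s
    using that \<eta>(2)[of s] sp sm by auto
  define wp where "wp = \<phi> (c sp)"
  define wm where "wm = \<phi> (c sm)"
  have wp: "wp \<in> ball 0 \<rho>" "\<bar>Im wp\<bar> < Re wp"
  proof -
    have M: "c sp \<in> M" using mid sp sm by auto
    then show "wp \<in> ball 0 \<rho>" using \<phi>\<psi> by (simp add: M_def wp_def)
    have s: "Re (wp\<^sup>2) > 0" using sq[OF s01(1) _ M] sp by (simp add: wp_def)
    note ss = saddle_sign[OF s, of "(c sp - t0) / a"] \<tau>[OF M, folded wp_def]
    have "Re ((c sp - t0) / a) > 0" using b1(2) sp by simp
    then have "Re wp > 0" using ss by (auto simp: sgn_if split: if_splits)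
    then show "\<bar>Im wp\<bar> < Re wp" using ss by auto
  qed
  have wm: "wm \<in> ball 0 \<rho>" "\<bar>Im wm\<bar> < - Re wm"
  proof -
    have M: "c sm \<in> M" using mid sp sm by auto
    then show "wm \<in> ball 0 \<rho>" using \<phi>\<psi> by (simp add: M_def wm_def)
    have s: "Re (wm\<^sup>2) > 0" using sq[OF s01(2) _ M] sm by (simp add: wm_def)
    note ss = saddle_sign[OF s, of "(c sm - t0) / a"] \<tau>[OF M, folded wm_def]
    have "Re ((c sm - t0) / a) < 0" using b2(2) sm by simp
    then have "Re wm < 0" using ss by (auto simp: sgn_if split: if_splits)
    then show "\<bar>Im wm\<bar> < - Re wm" using ss by auto
  qed
  define r where "r = \<rho> / 2"
  have r: "0 < r" "r < \<rho>" using \<rho> by (auto simp: r_def)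
  have rb: "of_real r \<in> ball (0::complex) \<rho>" "- of_real r \<in> ball (0::complex) \<rho>" using r by auto
  have cone: "Re (w\<^sup>2) > 0" if "\<bar>Im w\<bar> < \<bar>Re w\<bar>" for w
    using power_strict_mono[OF that abs_ge_zero, of 2] by (simp add: power2_eq_square)
  have "closed_segment (of_real r) wp \<subseteq> {w. \<bar>Im w\<bar> < Re w}"
    using wp r by (intro closed_segment_subset convex_right_cone) auto
  also have "\<dots> \<subseteq> {w. Re (w\<^sup>2) > 0}" using cone by force
  finally obtain L1 m1 where L1: "m1 > 0" "L1 \<ge> 0" "\<And>F B lam. F holomorphic_on T \<Longrightarrow> \<forall>z\<in>T. norm (F z) \<le> B \<Longrightarrow> lam \<ge> 0 \<Longrightarrow>
     norm (contour_integral (linepath (of_real r) wp) (\<lambda>w. F (\<psi> w) * deriv \<psi> w * exp (- (of_real lam * w\<^sup>2))))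
       \<le> L1 * B * exp (- (lam * m1))"
    by (rule valley_segment_bound[OF \<psi> \<psi>T rb(1) wp(1)]) (rule that)
  have "closed_segment wm (- of_real r) \<subseteq> {w. \<bar>Im w\<bar> < - Re w}"
    using wm r by (intro closed_segment_subset convex_left_cone) auto
  also have "\<dots> \<subseteq> {w. Re (w\<^sup>2) > 0}" using cone by force
  finally obtain L2 m2 where L2: "m2 > 0" "L2 \<ge> 0" "\<And>F B lam. F holomorphic_on T \<Longrightarrow> \<forall>z\<in>T. norm (F z) \<le> B \<Longrightarrow> lam \<ge> 0 \<Longrightarrow>
     norm (contour_integral (linepath wm (- of_real r)) (\<lambda>w. F (\<psi> w) * deriv \<psi> w * exp (- (of_real lam * w\<^sup>2))))
       \<le> L2 * B * exp (- (lam * m2))"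
    by (rule valley_segment_bound[OF \<psi> \<psi>T wm(1) rb(2)]) (rule that)
  have subT: "path_image (subpath u v c) \<subseteq> T" if "u \<in> {0..1}" "v \<in> {0..1}" for u v
    using path_image_subpath_subset[OF that] c(2) by blast
  have vsub: "valid_path (subpath u v c)" if "u \<in> {0..1}" "v \<in> {0..1}" for u v
    by (rule valid_path_subpath[OF c(1) that])
  have v3: "\<forall>t\<in>path_image (subpath 0 sm c). Re (g t) < Re (g t0)"
    using val sm sp s0 by (auto simp: path_image_subpath)
  have i01: "(0::real) \<in> {0..1}" "(1::real) \<in> {0..1}" by auto
  obtain L3 m3 where L3: "m3 > 0" "L3 \<ge> 0" "\<And>F B lam. F holomorphic_on T \<Longrightarrow> \<forall>z\<in>T. norm (F z) \<le> B \<Longrightarrow> lam \<ge> 0 \<Longrightarrow>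
     norm (contour_integral (subpath 0 sm c) (\<lambda>t. F t * exp (of_real lam * g t))) \<le> L3 * B * exp (lam * (Re (g t0) - m3))"
    by (rule valley_path_bound[OF T g vsub[OF i01(1) s01(2)] subT[OF i01(1) s01(2)] v3]) (rule that)
  have v4: "\<forall>t\<in>path_image (subpath sp 1 c). Re (g t) < Re (g t0)"
    using val sm sp s0 by (auto simp: path_image_subpath)
  obtain L4 m4 where L4: "m4 > 0" "L4 \<ge> 0" "\<And>F B lam. F holomorphic_on T \<Longrightarrow> \<forall>z\<in>T. norm (F z) \<le> B \<Longrightarrow> lam \<ge> 0 \<Longrightarrow>
     norm (contour_integral (subpath sp 1 c) (\<lambda>t. F t * exp (of_real lam * g t))) \<le> L4 * B * exp (lam * (Re (g t0) - m4))"
    by (rule valley_path_bound[OF T g vsub[OF s01(1) i01(2)] subT[OF s01(1) i01(2)] v4]) (rule that)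
  define m where "m = min (min m1 m2) (min m3 m4)"
  show thesis
  proof (rule that[of r \<rho> m "L1 + L2 + L3 + L4" \<psi>])
    show "g (\<psi> w) = g t0 - w\<^sup>2" if "w \<in> ball 0 \<rho>" for w
      using \<phi>\<psi>[of "\<psi> w"] \<psi>\<phi>[OF that] by simp
    fix F B lam assume F: "F holomorphic_on T" "\<forall>z\<in>T. norm (F z) \<le> B" and lam: "(lam::real) \<ge> 0"
    have B: "B \<ge> 0" using F(2) t0 norm_ge_zero order_trans by blast
    define f where "f t = F t * exp (of_real lam * g t)" for t
    define H where "H w = F (\<psi> w) * deriv \<psi> w * exp (- (of_real lam * w\<^sup>2))" for w
    define E where "E = exp (of_real lam * g t0)"
    have hf: "f holomorphic_on T" unfolding f_def by (intro holomorphic_intros F g)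
    have "(F \<circ> \<psi>) holomorphic_on ball 0 \<rho>" by (rule holomorphic_on_compose_gen[OF \<psi> F(1) \<psi>T])
    then have "H holomorphic_on ball 0 \<rho>"
      unfolding H_def by (intro holomorphic_intros holomorphic_deriv[OF \<psi>]) (simp_all add: o_def)
    then obtain P where P: "\<And>w. w \<in> ball 0 \<rho> \<Longrightarrow> (P has_field_derivative H w) (at w within ball 0 \<rho>)"
      using holomorphic_convex_primitive'[OF convex_ball open_ball] by metis
    have P': "(P has_field_derivative H w) (at w)" if "w \<in> ball 0 \<rho>" for w
      using P[OF that] that by (simp add: at_within_open[OF _ open_ball])
    have lin: "contour_integral (linepath u v) H = P v - P u" if "u \<in> ball 0 \<rho>" "v \<in> ball 0 \<rho>" for u v
      using contour_integral_primitive[OF P, of "linepath u v"] that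
      by (simp add: closed_segment_subset contour_integral_unique)
    \<comment> \<open>The change of variables is done on primitives: because \<open>\<phi>\<close>
      and \<open>\<psi>\<close> have reciprocal derivatives, \<open>E * P (\<phi> t)\<close> is a
      primitive of \<open>f\<close> on \<open>N\<close>, and the middle piece of the contour depends
      on its end points only.\<close>
    have "((\<lambda>t. E * P (\<phi> t)) has_field_derivative f t) (at t within N)" if t: "t \<in> N" for t
    proof -
      have w: "\<phi> t \<in> ball 0 \<rho>" "\<psi> (\<phi> t) = t" "g t = g t0 - (\<phi> t)\<^sup>2" using \<phi>\<psi>[OF t] by auto
      have dp: "(\<phi> has_field_derivative deriv \<phi> t) (at t)" by (rule holomorphic_derivI[OF \<phi> N(1) t])
      have dq: "(\<psi> has_field_derivative deriv \<psi> (\<phi> t)) (at (\<phi> t))" by (rule holomorphic_derivI[OF \<psi> open_ball w(1)])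
      have "((\<lambda>t. \<psi> (\<phi> t)) has_field_derivative deriv \<psi> (\<phi> t) * deriv \<phi> t) (at t)"
        by (rule DERIV_chain2[OF dq dp])
      then have "((\<lambda>t. t) has_field_derivative deriv \<psi> (\<phi> t) * deriv \<phi> t) (at t)"
        by (rule has_field_derivative_transform_within_open[OF _ N(1) t]) (use \<phi>\<psi> in auto)
      then have one: "deriv \<psi> (\<phi> t) * deriv \<phi> t = 1" using DERIV_unique DERIV_ident by blast
      have "((\<lambda>t. E * P (\<phi> t)) has_field_derivative E * (H (\<phi> t) * deriv \<phi> t)) (at t)"
        by (intro DERIV_cmult DERIV_chain2[OF P'[OF w(1)] dp])
      also have "E * (H (\<phi> t) * deriv \<phi> t) = F t * (E * exp (- (of_real lam * (\<phi> t)\<^sup>2))) * (deriv \<psi> (\<phi> t) * deriv \<phi> t)"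
        by (simp add: H_def w mult_ac)
      also have "\<dots> = f t" by (simp add: one f_def E_def w(3) flip: exp_add) (simp add: algebra_simps)
      finally show ?thesis by (rule has_field_derivative_at_within)
    qed
    moreover have "path_image (subpath sm sp c) \<subseteq> N"
      using mid sp sm by (auto simp: path_image_subpath M_def)
    ultimately have "(f has_contour_integral (E * P wp - E * P wm)) (subpath sm sp c)"
      using contour_integral_primitive[OF _ vsub[OF s01(2,1)], of N "\<lambda>t. E * P (\<phi> t)" f]
      by (simp add: wp_def wm_def)
    then have m: "contour_integral (subpath sm sp c) f = E * (P wp - P wm)"
      by (simp add: contour_integral_unique algebra_simps)
    have tri: "norm (x + y + z * (u + w)) \<le> norm x + norm y + norm z * (norm u + norm w)"
      for x y z u w :: complex
    proof -
      have "norm (x + y + z * (u + w)) \<le> norm (x + y) + norm (z * (u + w))" by (rule norm_triangle_ineq)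
      also have "\<dots> \<le> (norm x + norm y) + norm z * (norm u + norm w)"
        unfolding norm_mult by (intro add_mono mult_left_mono norm_triangle_ineq norm_ge_zero)
      finally show ?thesis .
    qed
    have ci: "f contour_integrable_on c" by (rule contour_integrable_holomorphic_simple[OF hf T c])
    have "contour_integral c f = contour_integral (subpath 0 sm c) f + contour_integral (subpath sm 1 c) f"
      using contour_integral_subpath_combine[OF ci c(1), of 0 sm 1] s01 by simp
    also have "contour_integral (subpath sm 1 c) f = contour_integral (subpath sm sp c) f + contour_integral (subpath sp 1 c) f"
      using contour_integral_subpath_combine[OF ci c(1), of sm sp 1] s01 by simp
    finally have eq: "contour_integral c f - E * contour_integral (linepath (- of_real r) (of_real r)) H =
      contour_integral (subpath 0 sm c) f + contour_integral (subpath sp 1 c) f +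
      E * (contour_integral (linepath (of_real r) wp) H + contour_integral (linepath wm (- of_real r)) H)"
      using wp(1) wm(1) rb by (simp add: m lin algebra_simps)
    have "norm (contour_integral c f - E * contour_integral (linepath (- of_real r) (of_real r)) H)
      \<le> norm (contour_integral (subpath 0 sm c) f) + norm (contour_integral (subpath sp 1 c) f) +
      norm E * (norm (contour_integral (linepath (of_real r) wp) H) + norm (contour_integral (linepath wm (- of_real r)) H))"
      unfolding eq by (rule tri)
    also have "\<dots> \<le> L3 * B * exp (lam * (Re (g t0) - m)) + L4 * B * exp (lam * (Re (g t0) - m)) +
      norm E * (L1 * B * exp (- (lam * m)) + L2 * B * exp (- (lam * m)))"
    proof (intro add_mono mult_left_mono)
      have mono: "x \<le> L * B * exp u" if "x \<le> L * B * exp v" "v \<le> u" "L \<ge> 0" for x L u v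
      proof -
        have "L * B * exp v \<le> L * B * exp u" using that B by (intro mult_left_mono) auto
        then show ?thesis using that by simp
      qed
      show "norm (contour_integral (subpath 0 sm c) f) \<le> L3 * B * exp (lam * (Re (g t0) - m))"
        by (rule mono[OF L3(3)[OF F lam, folded f_def] _ L3(2)]) (use lam in \<open>auto simp: m_def intro!: mult_left_mono\<close>)
      show "norm (contour_integral (subpath sp 1 c) f) \<le> L4 * B * exp (lam * (Re (g t0) - m))"
        by (rule mono[OF L4(3)[OF F lam, folded f_def] _ L4(2)]) (use lam in \<open>auto simp: m_def intro!: mult_left_mono\<close>)
      show "norm (contour_integral (linepath (of_real r) wp) H) \<le> L1 * B * exp (- (lam * m))"
        by (rule mono[OF L1(3)[OF F lam, folded H_def] _ L1(2)]) (use lam in \<open>auto simp: m_def intro!: mult_left_mono\<close>)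
      show "norm (contour_integral (linepath wm (- of_real r)) H) \<le> L2 * B * exp (- (lam * m))"
        by (rule mono[OF L2(3)[OF F lam, folded H_def] _ L2(2)]) (use lam in \<open>auto simp: m_def intro!: mult_left_mono\<close>)
    qed simp
    also have "norm E = exp (lam * Re (g t0))" by (simp add: E_def)
    also have "L3 * B * exp (lam * (Re (g t0) - m)) + L4 * B * exp (lam * (Re (g t0) - m)) +
      exp (lam * Re (g t0)) * (L1 * B * exp (- (lam * m)) + L2 * B * exp (- (lam * m)))
      = (L1 + L2 + L3 + L4) * B * exp (lam * (Re (g t0) - m))"
      by (simp add: algebra_simps exp_diff exp_minus divide_inverse)
    finally show "norm (contour_integral c (\<lambda>t. F t * exp (of_real lam * g t)) - exp (of_real lam * g t0) *
         contour_integral (linepath (- of_real r) (of_real r))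
           (\<lambda>w. F (\<psi> w) * deriv \<psi> w * exp (- (of_real lam * w\<^sup>2))))
      \<le> (L1 + L2 + L3 + L4) * B * exp (lam * (Re (g t0) - m))"
      by (simp add: f_def[symmetric] H_def[symmetric] E_def[symmetric])
  qed (use r L1 L2 L3 L4 \<psi> \<psi>T \<psi>0 \<psi>1 in \<open>auto simp: m_def\<close>)
qed

text \<open>Vanishing of \<open>F\<close> at the saddle removes the term with the third derivative
  of \<open>\<psi>\<close>. The formula serves twice: for the amplitude, and for
  \<open>deriv g\<close>, whose pullback is \<open>- 2 * w\<close>; the latter determines the second
  derivative of \<open>\<psi>\<close>.\<close>

lemma second_deriv_pullback:
  assumes T: "open T" and F: "F holomorphic_on T" and \<psi>: "\<psi> holomorphic_on ball 0 \<rho>" "\<psi> ` ball 0 \<rho> \<subseteq> T"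
    and \<rho>: "\<rho> > 0" and F0: "F (\<psi> 0) = 0"
  shows "(deriv ^^ 2) (\<lambda>w. F (\<psi> w) * deriv \<psi> w) 0 =
    (deriv ^^ 2) F (\<psi> 0) * deriv \<psi> 0 ^ 3 + 3 * deriv F (\<psi> 0) * deriv \<psi> 0 * (deriv ^^ 2) \<psi> 0"
proof -
  define p1 where "p1 = deriv \<psi>"
  define p2 where "p2 = deriv p1"
  have h1: "p1 holomorphic_on ball 0 \<rho>" and h2: "p2 holomorphic_on ball 0 \<rho>"
    unfolding p1_def p2_def by (intro holomorphic_deriv \<psi> open_ball)+
  have hF: "deriv F holomorphic_on T" using F T by (rule holomorphic_deriv)
  have d0: "(\<psi> has_field_derivative p1 w) (at w)" if "w \<in> ball 0 \<rho>" for w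
    unfolding p1_def by (rule holomorphic_derivI[OF \<psi>(1) open_ball that])
  have d1: "(p1 has_field_derivative p2 w) (at w)" if "w \<in> ball 0 \<rho>" for w
    unfolding p2_def by (rule holomorphic_derivI[OF h1 open_ball that])
  have d2: "(p2 has_field_derivative deriv p2 w) (at w)" if "w \<in> ball 0 \<rho>" for w
    by (rule holomorphic_derivI[OF h2 open_ball that])
  have e0: "((\<lambda>w. F (\<psi> w)) has_field_derivative deriv F (\<psi> w) * p1 w) (at w)" if "w \<in> ball 0 \<rho>" for w
    using that \<psi>(2) by (intro DERIV_chain2[OF _ d0] holomorphic_derivI[OF F T]) auto
  have e1: "((\<lambda>w. deriv F (\<psi> w)) has_field_derivative deriv (deriv F) (\<psi> w) * p1 w) (at w)" if "w \<in> ball 0 \<rho>" for w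
    using that \<psi>(2) by (intro DERIV_chain2[OF _ d0] holomorphic_derivI[OF hF T]) auto
  have "deriv (\<lambda>w. F (\<psi> w) * p1 w) w = deriv F (\<psi> w) * (p1 w)\<^sup>2 + F (\<psi> w) * p2 w" if "w \<in> ball 0 \<rho>" for w
    by (rule DERIV_imp_deriv) (auto intro!: derivative_eq_intros e0 d1 that simp: power2_eq_square algebra_simps)
  moreover have "((\<lambda>w. deriv F (\<psi> w) * (p1 w)\<^sup>2 + F (\<psi> w) * p2 w) has_field_derivative
      deriv (deriv F) (\<psi> 0) * p1 0 ^ 3 + 3 * deriv F (\<psi> 0) * p1 0 * p2 0) (at 0)"
    using \<rho> F0 by (auto intro!: derivative_eq_intros e0 e1 d1 d2 simp: power2_eq_square power3_eq_cube algebra_simps)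
  ultimately have "(deriv (\<lambda>w. F (\<psi> w) * p1 w) has_field_derivative
      deriv (deriv F) (\<psi> 0) * p1 0 ^ 3 + 3 * deriv F (\<psi> 0) * p1 0 * p2 0) (at 0)"
    using \<rho> by (elim has_field_derivative_transform_within_open[of _ _ _ "ball 0 \<rho>"]) auto
  then have "deriv (deriv (\<lambda>w. F (\<psi> w) * p1 w)) 0 = deriv (deriv F) (\<psi> 0) * p1 0 ^ 3 + 3 * deriv F (\<psi> 0) * p1 0 * p2 0"
    by (rule DERIV_imp_deriv)
  then show ?thesis by (simp add: eval_nat_numeral p1_def p2_def)
qed

lemma exp_decay_le_powr:
  assumes "m > (0::real)"
  obtains C where "C \<ge> 0" "\<And>lam. lam \<ge> 1 \<Longrightarrow> exp (- (lam * m)) \<le> C * lam powr (-5/2)"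
proof
  \<comment> \<open>From \<open>(x / 3)^3 \<le> (1 + x / 3)^3 \<le> exp x\<close> with
    \<open>x = lam * m\<close>; three is the least integer exponent above 5/2.\<close>
  show "27 / m ^ 3 \<ge> 0" using assms by simp
  fix lam :: real assume lam: "lam \<ge> 1"
  have "(lam * m / 3) ^ 3 \<le> (1 + (lam * m) / of_nat 3) ^ 3"
    using lam assms by (intro power_mono) auto
  also have "\<dots> \<le> exp (lam * m)"
    by (rule exp_ge_one_plus_x_over_n_power_n) (use lam assms in \<open>auto intro: order_trans[of _ 0]\<close>)
  finally have "exp (- (lam * m)) \<le> 27 / m ^ 3 * (1 / lam ^ 3)"
    using lam assms by (simp add: exp_minus field_simps power_mult_distrib)
  also have "1 / lam ^ 3 = lam powr (-3)" using lam by (simp add: powr_minus_divide)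
  also have "27 / m ^ 3 * lam powr (-3) \<le> 27 / m ^ 3 * lam powr (-5/2)"
    using lam assms by (intro mult_left_mono powr_mono) auto
  finally show "exp (- (lam * m)) \<le> 27 / m ^ 3 * lam powr (-5/2)" .
qed

text \<open>The constant of the first claim is uniform in the amplitude, that of the second depends
  on it. \<open>c2\<close> is the second derivative of the pulled back amplitude at 0. Its closed
  form is claimed for \<open>F t0 = 0\<close>, where the third derivative of the chart drops out;
  for the amplitude that is weighted by \<open>lambda_tilde\<close> the existence of a coefficient
  is enough.\<close>

lemma saddle_expansion:
  assumes T: "open T" and g: "g holomorphic_on T" and g1: "deriv g t0 = 0"
    and a: "a\<^sup>2 * (deriv ^^ 2) g t0 = - 2"
    and c: "valid_path c" "path_image c \<subseteq> T" and s0: "s0 \<in> {0<..<1}" "c s0 = t0"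
    and val: "\<forall>s\<in>{0..1} - {s0}. Re (g (c s)) < Re (g t0)"
    and right: "\<forall>\<^sub>F s in at_right s0. Re ((c s - t0) / a) > 0"
    and left: "\<forall>\<^sub>F s in at_left s0. Re ((c s - t0) / a) < 0"
  shows "\<exists>K. \<forall>F B lam. F holomorphic_on T \<longrightarrow> (\<forall>z\<in>T. norm (F z) \<le> B) \<longrightarrow> lam \<ge> 1 \<longrightarrow>
      norm (contour_integral c (\<lambda>t. F t * exp (of_real lam * g t)))
        \<le> K * B * exp (lam * Re (g t0)) * lam powr (-1/2)" (is ?bound)
    and "F holomorphic_on T \<Longrightarrow> \<forall>z\<in>T. norm (F z) \<le> B \<Longrightarrow>
      \<exists>K c2. (F t0 = 0 \<longrightarrow> c2 = a ^ 3 * ((deriv ^^ 2) F t0 - deriv F t0 * (deriv ^^ 3) g t0 / (deriv ^^ 2) g t0)) \<and>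
        (\<forall>lam\<ge>1. norm (contour_integral c (\<lambda>t. F t * exp (of_real lam * g t)) -
             exp (of_real lam * g t0) * of_real (sqrt pi) *
               (F t0 * a * of_real (lam powr (-1/2)) + c2 / 4 * of_real (lam powr (-3/2))))
          \<le> K * exp (lam * Re (g t0)) * lam powr (-5/2))"
proof -
  obtain \<psi> \<rho> r L m where r: "0 < r" "r < \<rho>" and m: "m > 0" and L: "L \<ge> 0"
    and \<psi>: "\<psi> holomorphic_on ball 0 \<rho>" "\<psi> ` ball 0 \<rho> \<subseteq> T" "\<psi> 0 = t0" "deriv \<psi> 0 = a"
    and g\<psi>: "\<And>w. w \<in> ball 0 \<rho> \<Longrightarrow> g (\<psi> w) = g t0 - w\<^sup>2"
    and loc: "\<And>F B lam. F holomorphic_on T \<Longrightarrow> \<forall>z\<in>T. norm (F z) \<le> B \<Longrightarrow> lam \<ge> 0 \<Longrightarrow>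
      norm (contour_integral c (\<lambda>t. F t * exp (of_real lam * g t)) - exp (of_real lam * g t0) *
         contour_integral (linepath (- of_real r) (of_real r))
           (\<lambda>w. F (\<psi> w) * deriv \<psi> w * exp (- (of_real lam * w\<^sup>2))))
      \<le> L * B * exp (lam * (Re (g t0) - m))"
    by (rule saddle_localization[OF T g g1 a c s0 val right left]) (rule that)
  have t0: "t0 \<in> T" using c(2) s0 by (auto simp: path_image_def)
  have g20: "(deriv ^^ 2) g t0 \<noteq> 0" using a by auto
  have \<rho>: "\<rho> > 0" using r by simp
  have h1: "deriv \<psi> holomorphic_on ball 0 \<rho>" using \<psi>(1) by (intro holomorphic_deriv open_ball)
  have hG: "(\<lambda>w. F (\<psi> w) * deriv \<psi> w) holomorphic_on ball 0 \<rho>" if "F holomorphic_on T" for F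
    using holomorphic_on_compose_gen[OF \<psi>(1) that \<psi>(2)] h1 by (auto simp: o_def intro: holomorphic_intros)
  show ?bound
  proof -
    have sub: "closed_segment (- of_real r) (of_real r) \<subseteq> ball (0::complex) \<rho>"
      using r by (intro closed_segment_subset convex_ball) auto
    have "compact (deriv \<psi> ` closed_segment (- of_real r) (of_real r))"
      by (intro compact_continuous_image compact_segment holomorphic_on_imp_continuous_on
          holomorphic_on_subset[OF h1 sub])
    then obtain D where D: "D > 0" "\<And>z. z \<in> closed_segment (- of_real r) (of_real r) \<Longrightarrow> norm (deriv \<psi> z) \<le> D"
      using compact_imp_bounded bounded_pos by (metis imageI)
    obtain C where C: "C \<ge> 0" "\<And>lam. lam \<ge> 1 \<Longrightarrow> exp (- (lam * m)) \<le> C * lam powr (-5/2)"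
      using exp_decay_le_powr[OF m] by blast
    have "norm (contour_integral c (\<lambda>t. F t * exp (of_real lam * g t)))
        \<le> (L * C + D * sqrt pi) * B * exp (lam * Re (g t0)) * lam powr (-1/2)"
      if F: "F holomorphic_on T" "\<forall>z\<in>T. norm (F z) \<le> B" and lam: "lam \<ge> 1" for F B lam
    proof -
      have B: "B \<ge> 0" using F(2) t0 norm_ge_zero order_trans by blast
      let ?H = "\<lambda>w. F (\<psi> w) * deriv \<psi> w * exp (- (of_real lam * w\<^sup>2))"
      have "?H holomorphic_on ball 0 \<rho>" by (intro holomorphic_intros hG F)
      then have cH: "continuous_on {-r..r} (\<lambda>x. ?H (of_real x))"
        by (rule continuous_on_compose2[OF holomorphic_on_imp_continuous_on])
           (use r in \<open>auto intro!: continuous_intros\<close>)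
      have gi: "has_bochner_integral lborel (\<lambda>x. exp (- (lam * x\<^sup>2))) (sqrt pi * lam powr (-1/2))"
        using has_bochner_integral_gaussian_even[of lam 0] lam by simp
      have si: "set_integrable lborel {-r..r} (\<lambda>x. exp (- (lam * x\<^sup>2)))"
        by (intro borel_integrable_atLeastAtMost' continuous_intros)
      have "contour_integral (linepath (- of_real r) (of_real r)) ?H = integral {-r..r} (\<lambda>x. ?H (of_real x))"
        using r by (subst contour_integral_linepath_Reals_eq) auto
      also have "norm \<dots> \<le> integral {-r..r} (\<lambda>x. B * D * exp (- (lam * x\<^sup>2)))"
      proof (rule integral_norm_bound_integral)
        show "(\<lambda>x. ?H (of_real x)) integrable_on {-r..r}"
          using cH integrable_continuous_interval by blast
        show "(\<lambda>x. B * D * exp (- (lam * x\<^sup>2))) integrable_on {-r..r}"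
          by (intro integrable_continuous_interval continuous_intros)
        fix x assume x: "x \<in> {-r..r}"
        have "of_real x \<in> closed_segment (- of_real r) (of_real r :: complex)"
          using x by (metis closed_segment_eq_real_ivl1 closed_segment_of_real image_eqI of_real_minus atLeastAtMost_iff order_trans)
        then have "norm (F (\<psi> (of_real x))) \<le> B" "norm (deriv \<psi> (of_real x)) \<le> D"
          using F(2) D(2) \<psi>(2) sub by (blast, blast)
        moreover have "norm (exp (- (of_real lam * (of_real x)\<^sup>2)) :: complex) = exp (- (lam * x\<^sup>2))"
          by (simp flip: of_real_power of_real_mult)
        ultimately show "norm (?H (of_real x)) \<le> B * D * exp (- (lam * x\<^sup>2))"
          unfolding norm_mult using B D(1) by (intro mult_mono) auto
      qed
      also have "\<dots> = B * D * (LINT x:{-r..r}|lborel. exp (- (lam * x\<^sup>2)))"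
        using set_borel_integral_eq_integral(2)[OF si] by simp
      also have "(LINT x:{-r..r}|lborel. exp (- (lam * x\<^sup>2))) \<le> (LINT x|lborel. exp (- (lam * x\<^sup>2)))"
        unfolding set_lebesgue_integral_def
        using si gi by (intro integral_mono) (auto simp: set_integrable_def has_bochner_integral_iff indicator_def)
      also have "\<dots> = sqrt pi * lam powr (-1/2)" by (rule has_bochner_integral_integral_eq[OF gi])
      finally have 1: "norm (contour_integral (linepath (- of_real r) (of_real r)) ?H) \<le> B * D * (sqrt pi * lam powr (-1/2))"
        using B D by (simp add: mult_left_mono)
      have "exp (- (lam * m)) \<le> C * lam powr (-5/2)" by (rule C(2)[OF lam])
      also have "\<dots> \<le> C * lam powr (-1/2)" using lam C(1) by (intro mult_left_mono powr_mono) auto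
      finally have 2: "exp (- (lam * m)) \<le> C * lam powr (-1/2)" .
      have "norm (contour_integral c (\<lambda>t. F t * exp (of_real lam * g t))) \<le>
         L * B * exp (lam * (Re (g t0) - m)) + norm (exp (of_real lam * g t0) *
          contour_integral (linepath (- of_real r) (of_real r)) ?H)"
        using loc[OF F, of lam] lam by (smt (verit) norm_triangle_sub)
      also have "exp (lam * (Re (g t0) - m)) = exp (lam * Re (g t0)) * exp (- (lam * m))"
        by (simp add: algebra_simps flip: exp_add)
      also have "L * B * (exp (lam * Re (g t0)) * exp (- (lam * m))) + norm (exp (of_real lam * g t0) *
          contour_integral (linepath (- of_real r) (of_real r)) ?H)
         \<le> L * B * (exp (lam * Re (g t0)) * (C * lam powr (-1/2))) + exp (lam * Re (g t0)) * (B * D * (sqrt pi * lam powr (-1/2)))"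
        using 1 2 L B by (intro add_mono) (auto simp: norm_mult intro!: mult_left_mono)
      also have "\<dots> = (L * C + D * sqrt pi) * B * exp (lam * Re (g t0)) * lam powr (-1/2)"
        by (simp add: algebra_simps)
      finally show ?thesis .
    qed
    then show ?thesis by blast
  qed
  show "\<exists>K c2. (F t0 = 0 \<longrightarrow> c2 = a ^ 3 * ((deriv ^^ 2) F t0 - deriv F t0 * (deriv ^^ 3) g t0 / (deriv ^^ 2) g t0)) \<and>
        (\<forall>lam\<ge>1. norm (contour_integral c (\<lambda>t. F t * exp (of_real lam * g t)) -
             exp (of_real lam * g t0) * of_real (sqrt pi) *
               (F t0 * a * of_real (lam powr (-1/2)) + c2 / 4 * of_real (lam powr (-3/2))))
          \<le> K * exp (lam * Re (g t0)) * lam powr (-5/2))"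
    if F: "F holomorphic_on T" "\<forall>z\<in>T. norm (F z) \<le> B"
  proof -
    have B: "B \<ge> 0" using F(2) t0 norm_ge_zero order_trans by blast
    define G where "G w = F (\<psi> w) * deriv \<psi> w" for w
    obtain K where K: "\<And>lam. lam > 0 \<Longrightarrow>
      norm (contour_integral (linepath (- of_real r) (of_real r)) (\<lambda>w. G w * exp (- (of_real lam * w\<^sup>2)))
       - of_real (sqrt pi) * (G 0 * of_real (lam powr (-1/2)) + (deriv ^^ 2) G 0 / 4 * of_real (lam powr (-3/2))))
      \<le> K * lam powr (-5/2)"
      using Laplace_real_axis[OF hG[OF F(1)] r] unfolding G_def by blast
    obtain C where C: "C \<ge> 0" "\<And>lam. lam \<ge> 1 \<Longrightarrow> exp (- (lam * m)) \<le> C * lam powr (-5/2)"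
      using exp_decay_le_powr[OF m] by blast
    have "(deriv ^^ 2) G 0 = a ^ 3 * ((deriv ^^ 2) F t0 - deriv F t0 * (deriv ^^ 3) g t0 / (deriv ^^ 2) g t0)"
      if "F t0 = 0"
    proof -
      have hg: "deriv g holomorphic_on T" using g T by (rule holomorphic_deriv)
      \<comment> \<open>Three derivatives of \<open>g (\<psi> w) = g t0 - w^2\<close> at 0 express
        \<open>\<psi>''\<close> there through \<open>g''\<close> and \<open>g'''\<close>; this
        produces the quotient of the two in \<open>c2\<close>.\<close>
      have "deriv g (\<psi> w) * deriv \<psi> w = - 2 * w" if w: "w \<in> ball 0 \<rho>" for w
      proof -
        have "((\<lambda>w. g (\<psi> w)) has_field_derivative deriv g (\<psi> w) * deriv \<psi> w) (at w)"
          using w \<psi>(2) by (intro DERIV_chain2[OF holomorphic_derivI[OF g T]] holomorphic_derivI[OF \<psi>(1) open_ball]) auto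
        moreover have "((\<lambda>w. g t0 - w\<^sup>2) has_field_derivative - 2 * w) (at w)"
          by (auto intro!: derivative_eq_intros)
        then have "((\<lambda>w. g (\<psi> w)) has_field_derivative - 2 * w) (at w)"
          by (rule has_field_derivative_transform_within_open[OF _ open_ball w]) (simp add: g\<psi>)
        ultimately show ?thesis using DERIV_unique by blast
      qed
      note gg = this
      have "deriv (\<lambda>w. deriv g (\<psi> w) * deriv \<psi> w) w = - 2" if w: "w \<in> ball 0 \<rho>" for w
      proof (rule DERIV_imp_deriv, rule has_field_derivative_transform_within_open[OF _ open_ball w])
        show "((\<lambda>w. - 2 * w) has_field_derivative - 2) (at w)"
          by (auto intro!: derivative_eq_intros)
      qed (simp add: gg)
      note gg2 = this
      have "deriv (deriv (\<lambda>w. deriv g (\<psi> w) * deriv \<psi> w)) 0 = 0"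
      proof (rule DERIV_imp_deriv, rule has_field_derivative_transform_within_open[OF _ open_ball])
        show "((\<lambda>w. - 2 :: complex) has_field_derivative 0) (at 0)" by (rule DERIV_const)
        show "(0::complex) \<in> ball 0 \<rho>" using \<rho> by simp
      qed (simp add: gg2)
      then have z: "(deriv ^^ 3) g t0 * a ^ 3 + 3 * (deriv ^^ 2) g t0 * a * (deriv ^^ 2) \<psi> 0 = 0"
        using second_deriv_pullback[OF T hg \<psi>(1,2) \<rho>] g1 \<psi>(3,4) by (simp add: eval_nat_numeral)
      have "(deriv ^^ 2) G 0 = (deriv ^^ 2) F t0 * a ^ 3 + 3 * deriv F t0 * a * (deriv ^^ 2) \<psi> 0"
        using second_deriv_pullback[OF T F(1) \<psi>(1,2) \<rho>] that \<psi>(3,4) by (simp add: G_def[abs_def])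
      also have "3 * deriv F t0 * a * (deriv ^^ 2) \<psi> 0 = deriv F t0 * (3 * (deriv ^^ 2) g t0 * a * (deriv ^^ 2) \<psi> 0) / (deriv ^^ 2) g t0"
        using g20 by simp
      also have "3 * (deriv ^^ 2) g t0 * a * (deriv ^^ 2) \<psi> 0 = - ((deriv ^^ 3) g t0 * a ^ 3)"
        using z by (simp add: add_eq_0_iff)
      finally show ?thesis by (simp add: algebra_simps)
    qed
    moreover have "norm (contour_integral c (\<lambda>t. F t * exp (of_real lam * g t)) -
             exp (of_real lam * g t0) * of_real (sqrt pi) *
               (F t0 * a * of_real (lam powr (-1/2)) + (deriv ^^ 2) G 0 / 4 * of_real (lam powr (-3/2))))
          \<le> (L * B * C + K) * exp (lam * Re (g t0)) * lam powr (-5/2)" if lam: "lam \<ge> 1" for lam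
    proof -
      define e where "e = exp (of_real lam * g t0)"
      define J where "J = contour_integral (linepath (- of_real r) (of_real r)) (\<lambda>w. G w * exp (- (of_real lam * w\<^sup>2)))"
      define Q where "Q = of_real (sqrt pi) * (F t0 * a * of_real (lam powr (-1/2)) + (deriv ^^ 2) G 0 / 4 * of_real (lam powr (-3/2)))"
      define I where "I = contour_integral c (\<lambda>t. F t * exp (of_real lam * g t))"
      have ne: "norm e = exp (lam * Re (g t0))" by (simp add: e_def)
      have 1: "norm (I - e * J) \<le> L * B * exp (lam * (Re (g t0) - m))"
        using loc[OF F, of lam] lam by (simp add: I_def e_def J_def G_def)
      have "G 0 = F t0 * a" by (simp add: G_def \<psi>)
      then have 2: "norm (J - Q) \<le> K * lam powr (-5/2)"
        using K[of lam] lam by (simp add: J_def Q_def)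
      have "norm (I - e * Q) \<le> norm (I - e * J) + norm (e * (J - Q))"
        using norm_triangle_ineq[of "I - e * J" "e * (J - Q)"] by (simp add: algebra_simps)
      also have "\<dots> \<le> L * B * exp (lam * (Re (g t0) - m)) + exp (lam * Re (g t0)) * (K * lam powr (-5/2))"
        using 1 2 by (intro add_mono) (auto simp: norm_mult ne intro!: mult_left_mono)
      also have "exp (lam * (Re (g t0) - m)) = exp (lam * Re (g t0)) * exp (- (lam * m))"
        by (simp add: algebra_simps flip: exp_add)
      also have "L * B * (exp (lam * Re (g t0)) * exp (- (lam * m))) + exp (lam * Re (g t0)) * (K * lam powr (-5/2))
          \<le> L * B * (exp (lam * Re (g t0)) * (C * lam powr (-5/2))) + exp (lam * Re (g t0)) * (K * lam powr (-5/2))"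
        using C(2)[OF lam] L B by (intro add_right_mono mult_left_mono) auto
      also have "\<dots> = (L * B * C + K) * exp (lam * Re (g t0)) * lam powr (-5/2)" by (simp add: algebra_simps)
      finally show ?thesis by (simp add: I_def e_def Q_def mult.assoc)
    qed
    ultimately show ?thesis by blast
  qed
qed

section \<open>Asymptotics of the boundary integral\<close>

lemma has_derivative_vector_slices:
  fixes f :: "real \<times> real \<Rightarrow> 'a::real_normed_vector"
  assumes "f differentiable (at (a, b))"
  shows "((\<lambda>r. f (r, b)) has_vector_derivative partial_deriv (1, 0) f (a, b)) (at a)"
    and "((\<lambda>r. f (a, r)) has_vector_derivative partial_deriv (0, 1) f (a, b)) (at b)"
proof -
  let ?D = "frechet_derivative f (at (a, b))"
  have D: "(f has_derivative ?D) (at (a, b))" using assms frechet_derivative_works by blast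
  then have lin: "bounded_linear ?D" by (rule has_derivative_bounded_linear)
  have s: "?D (h, 0) = h *\<^sub>R ?D (1, 0)" "?D (0, h) = h *\<^sub>R ?D (0, 1)" for h
    using linear_scale[OF bounded_linear.linear[OF lin], of h "(1, 0)"]
      linear_scale[OF bounded_linear.linear[OF lin], of h "(0, 1)"] by simp_all
  have "((\<lambda>r. (r, b)) has_derivative (\<lambda>h. (h, 0))) (at a)" by (auto intro!: derivative_eq_intros)
  from has_derivative_compose[OF this D]
  show "((\<lambda>r. f (r, b)) has_vector_derivative partial_deriv (1, 0) f (a, b)) (at a)"
    unfolding has_vector_derivative_def by (rule has_derivative_eq_rhs) (rule ext, rule s(1))
  have "((\<lambda>r. (a, r)) has_derivative (\<lambda>h. (0, h))) (at b)" by (auto intro!: derivative_eq_intros)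
  from has_derivative_compose[OF this D]
  show "((\<lambda>r. f (a, r)) has_vector_derivative partial_deriv (0, 1) f (a, b)) (at b)"
    unfolding has_vector_derivative_def by (rule has_derivative_eq_rhs) (rule ext, rule s(2))
qed

text \<open>Stated for an arbitrary pair \<open>F\<close>, \<open>f\<close> so that it applies again
  to the partial derivatives themselves, which yields Helmholtz' equation for \<open>U\<close> at
  real points.\<close>

lemma pd_real:
  fixes f :: "real \<times> real \<Rightarrow> complex"
  assumes F: "holomorphic2_on F W" and W: "open W"
    and eq: "\<And>a b :: real. (of_real a, of_real b) \<in> W \<Longrightarrow> F (of_real a, of_real b) = f (a, b)"
    and p: "(of_real a, of_real b) \<in> W" and f: "f differentiable (at (a, b))"
  shows "pd1 F (of_real a, of_real b) = partial_deriv (1, 0) f (a, b)"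
    and "pd2 F (of_real a, of_real b) = partial_deriv (0, 1) f (a, b)"
proof -
  define A where "A = (\<lambda>r. (complex_of_real r, complex_of_real b)) -` W"
  define B where "B = (\<lambda>r. (complex_of_real a, complex_of_real r)) -` W"
  have o: "open A" "open B" and ab: "a \<in> A" "b \<in> B"
    unfolding A_def B_def using p by (auto intro!: open_vimage W continuous_intros)
  have "((\<lambda>r. F (of_real r, of_real b)) has_vector_derivative pd1 F (of_real a, of_real b)) (at a)"
    by (rule has_vector_derivative_real_field[OF holomorphic2_onD(2)[OF F p]])
  then have "((\<lambda>r. f (r, b)) has_vector_derivative pd1 F (of_real a, of_real b)) (at a)"
    by (rule has_vector_derivative_transform_within_open[OF _ o(1) ab(1)]) (simp add: A_def eq)
  then show "pd1 F (of_real a, of_real b) = partial_deriv (1, 0) f (a, b)"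
    using has_derivative_vector_slices(1)[OF f] vector_derivative_unique_at by blast
  have "((\<lambda>r. F (of_real a, of_real r)) has_vector_derivative pd2 F (of_real a, of_real b)) (at b)"
    by (rule has_vector_derivative_real_field[OF holomorphic2_onD(3)[OF F p]])
  then have "((\<lambda>r. f (a, r)) has_vector_derivative pd2 F (of_real a, of_real b)) (at b)"
    by (rule has_vector_derivative_transform_within_open[OF _ o(2) ab(2)]) (simp add: B_def eq)
  then show "pd2 F (of_real a, of_real b) = partial_deriv (0, 1) f (a, b)"
    using has_derivative_vector_slices(2)[OF f] vector_derivative_unique_at by blast
qed

lemma Basis_real_prod: "(Basis :: (real \<times> real) set) = {(1, 0), (0, 1)}"
  by (auto simp: Basis_prod_def)

lemma C_k_2D:
  fixes f :: "real \<times> real \<Rightarrow> 'a::real_normed_vector"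
  assumes "C_k 2 f"
  shows "f differentiable (at x)" "partial_deriv (1, 0) f differentiable (at x)"
    "partial_deriv (0, 1) f differentiable (at x)"
  using assms by (cases x; simp add: eval_nat_numeral Basis_real_prod differentiable_on_def)+

lemma laplacian_real_prod:
  fixes f :: "real \<times> real \<Rightarrow> 'a::real_normed_vector"
  shows "laplacian f x = partial_deriv (1, 0) (partial_deriv (1, 0) f) x + partial_deriv (0, 1) (partial_deriv (0, 1) f) x"
  by (simp add: laplacian_def Basis_real_prod)

text \<open>The real function is given on the closed interval, so its derivative is taken within the
  interval. Along the reals the extension is real-valued, hence has a real derivative; uniqueness of
  derivatives within the interval, end points included, identifies it with
  \<open>deriv X\<close>.\<close>

lemma holomorphic_restrict_real:
  assumes T: "open T" "complex_of_real ` {a..b} \<subseteq> T" and X: "X holomorphic_on T"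
    and eq: "\<And>t. t \<in> {a..b} \<Longrightarrow> X (of_real t) = of_real (x t)" and t: "t \<in> {a..b}" "a < b"
  shows "(x has_real_derivative Re (deriv X (of_real t))) (at t within {a..b})"
    and "deriv X (of_real t) = of_real (Re (deriv X (of_real t)))"
proof -
  have "(X has_field_derivative deriv X (of_real t)) (at (of_real t))"
    using T t by (intro holomorphic_derivI[OF X T(1)]) auto
  then have "((\<lambda>r. X (of_real r)) has_vector_derivative deriv X (of_real t)) (at t within {a..b})"
    by (rule has_vector_derivative_at_within[OF has_vector_derivative_real_field])
  then have 1: "((\<lambda>r. complex_of_real (x r)) has_vector_derivative deriv X (of_real t)) (at t within {a..b})"
    by (rule has_vector_derivative_transform[rotated 2, OF _ _ eq[symmetric]]) (use t in auto)
  then have "((\<lambda>r. Re (complex_of_real (x r))) has_vector_derivative Re (deriv X (of_real t))) (at t within {a..b})"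
    by (rule bounded_linear.has_vector_derivative[OF bounded_linear_Re])
  then show 2: "(x has_real_derivative Re (deriv X (of_real t))) (at t within {a..b})"
    by (simp add: has_real_derivative_iff_has_vector_derivative)
  then have "((\<lambda>r. complex_of_real (x r)) has_vector_derivative of_real (Re (deriv X (of_real t)))) (at t within {a..b})"
    by (rule has_vector_derivative_of_real)
  with 1 show "deriv X (of_real t) = of_real (Re (deriv X (of_real t)))"
    using vector_derivative_unique_within_closed_interval[of a b t] t by auto
qed

text \<open>The data of the wave and of the closed curve, without contour and saddle point: the
  vanishing of the boundary integral for nonscattering waves takes place on the real curve
  alone.\<close>

locale analytic_boundary =
  fixes k :: real and uin :: "real \<times> real \<Rightarrow> complex"
    and x1 x2 :: "real \<Rightarrow> real" and X1 X2 :: "complex \<Rightarrow> complex" and T :: "complex set"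
    and U :: "complex \<times> complex \<Rightarrow> complex" and W :: "(complex \<times> complex) set"
  assumes wave: "incident_wave k uin"
    and T: "open T" "complex_of_real ` {- pi..pi} \<subseteq> T"
    and ext: "X1 holomorphic_on T" "X2 holomorphic_on T"
      "\<forall>t\<in>{- pi..pi}. X1 (of_real t) = of_real (x1 t) \<and> X2 (of_real t) = of_real (x2 t)"
    and closed: "x1 pi = x1 (- pi)" "x2 pi = x2 (- pi)"
    and uext: "open W" "(\<lambda>t. (X1 t, X2 t)) ` T \<subseteq> W" "holomorphic2_on U W"
      "\<forall>a b :: real. (of_real a, of_real b) \<in> W \<longrightarrow> U (of_real a, of_real b) = uin (a, b)"
begin

abbreviation "v \<equiv> v_ext U X1 X2"
abbreviation "V1 \<equiv> V1_ext U X1 X2"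
abbreviation "V2 \<equiv> V2_ext U X1 X2"
abbreviation "g \<equiv> g_ext X1 X2"

lemma C2: "C_k 2 uin" and Helmholtz: "laplacian uin x + of_real (k\<^sup>2) * uin x = 0"
  using wave unfolding incident_wave_def by blast+

lemma XW: "t \<in> T \<Longrightarrow> (X1 t, X2 t) \<in> W"
  using uext(2) by blast

lemma ext_pd: "V1 t = pd1 U (X1 t, X2 t)" "V2 t = pd2 U (X1 t, X2 t)"
  by (simp_all add: V1_ext_def V2_ext_def pd1_def pd2_def)

lemma dX:
  assumes "t \<in> T"
  shows "(X1 has_field_derivative deriv X1 t) (at t)" "(X2 has_field_derivative deriv X2 t) (at t)"
  using assms ext T(1) by (auto intro: holomorphic_derivI)

lemma compose_deriv:
  assumes "holomorphic2_on F W" "t \<in> T"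
  shows "((\<lambda>t. F (X1 t, X2 t)) has_field_derivative
    pd1 F (X1 t, X2 t) * deriv X1 t + pd2 F (X1 t, X2 t) * deriv X2 t) (at t)"
  using holomorphic2_on_compose[OF assms(1) XW dX] assms(2) by blast

lemma compose_holomorphic: "holomorphic2_on F W \<Longrightarrow> (\<lambda>t. F (X1 t, X2 t)) holomorphic_on T"
  unfolding holomorphic_on_open[OF T(1)] using compose_deriv by blast

lemma v_deriv: "t \<in> T \<Longrightarrow> (v has_field_derivative V1 t * deriv X1 t + V2 t * deriv X2 t) (at t)"
  using compose_deriv[OF uext(3)] by (simp add: ext_pd v_ext_def[abs_def])

lemma holo_v: "v holomorphic_on T"
  and holo_V1: "V1 holomorphic_on T" and holo_V2: "V2 holomorphic_on T" and holo_g: "g holomorphic_on T"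
  using compose_holomorphic[OF uext(3)] compose_holomorphic[OF holomorphic2_on_pd1[OF uext(3,1)]]
    compose_holomorphic[OF holomorphic2_on_pd2[OF uext(3,1)]] ext
  by (auto simp: v_ext_def[abs_def] ext_pd[abs_def] g_ext_def[abs_def] intro!: holomorphic_intros)

lemma g_deriv: "t \<in> T \<Longrightarrow> deriv g t = deriv X1 t + \<i> * deriv X2 t"
  by (rule DERIV_imp_deriv) (auto simp: g_ext_def[abs_def] intro!: derivative_eq_intros dX)

lemma pd_U_real:
  assumes "(of_real a, of_real b) \<in> W"
  shows "pd1 U (of_real a, of_real b) = partial_deriv (1, 0) uin (a, b)"
    and "pd2 U (of_real a, of_real b) = partial_deriv (0, 1) uin (a, b)"
  using pd_real[OF uext(3,1) _ assms C_k_2D(1)[OF C2]] uext(4) by auto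

lemma Helmholtz_real:
  assumes p: "(of_real a, of_real b) \<in> W"
  shows "pd1 (pd1 U) (of_real a, of_real b) + pd2 (pd2 U) (of_real a, of_real b)
    + of_real (k\<^sup>2) * U (of_real a, of_real b) = 0"
proof -
  have "pd1 (pd1 U) (of_real a, of_real b) = partial_deriv (1, 0) (partial_deriv (1, 0) uin) (a, b)"
    by (rule pd_real(1)[OF holomorphic2_on_pd1[OF uext(3,1)] uext(1) pd_U_real(1) p C_k_2D(2)[OF C2]])
  moreover have "pd2 (pd2 U) (of_real a, of_real b) = partial_deriv (0, 1) (partial_deriv (0, 1) uin) (a, b)"
    by (rule pd_real(2)[OF holomorphic2_on_pd2[OF uext(3,1)] uext(1) pd_U_real(2) p C_k_2D(3)[OF C2]])
  ultimately show ?thesis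
    using Helmholtz[of "(a, b)"] uext(4) p by (simp add: laplacian_real_prod)
qed

text \<open>\<open>T\<close> may be disconnected, so the identity theorem is used on the component
  of the interval. There the left side is holomorphic in \<open>t\<close>, and it vanishes on the
  interval, which accumulates at 0.\<close>

lemma Helmholtz_extended:
  assumes t0: "t0 \<in> connected_component_set T (of_real 0)"
  shows "pd1 (pd1 U) (X1 t0, X2 t0) + pd2 (pd2 U) (X1 t0, X2 t0) + of_real (k\<^sup>2) * U (X1 t0, X2 t0) = 0"
proof -
  define h where "h p = pd1 (pd1 U) p + pd2 (pd2 U) p + of_real (k\<^sup>2) * U p" for p
  define S where "S = connected_component_set T (of_real 0 :: complex)"
  have S: "open S" "connected S" "S \<subseteq> T"
    unfolding S_def using T(1) connected_component_subset
    by (blast intro: open_connected_component connected_connected_component)+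
  note h1 = holomorphic2_on_pd1[OF uext(3,1)] and h2 = holomorphic2_on_pd2[OF uext(3,1)]
  have holo: "(\<lambda>t. h (X1 t, X2 t)) holomorphic_on S"
    unfolding h_def
    by (rule holomorphic_on_subset[OF _ S(3)])
       (intro holomorphic_intros compose_holomorphic holomorphic2_on_pd1[OF h1 uext(1)]
         holomorphic2_on_pd2[OF h2 uext(1)] uext(3))
  have sub: "of_real ` {- pi..pi} \<subseteq> S"
    unfolding S_def
  proof (rule connected_component_maximal)
    show "connected (complex_of_real ` {- pi..pi})"
      by (intro connected_continuous_image continuous_intros) auto
  qed (use T in auto)
  have lim: "(of_real 0 :: complex) islimpt of_real ` {- pi..pi}"
  proof -
    have "(0::real) islimpt {- pi..pi}" by (simp add: islimpt_Icc)
    then show ?thesis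
      by (intro islimpt_isCont_image) (auto simp: eventually_at_filter)
  qed
  have "h (X1 t0, X2 t0) = 0"
  proof (rule analytic_continuation[OF holo S(1,2) sub _ lim])
    show "of_real 0 \<in> S" using sub by auto
    fix z assume "z \<in> complex_of_real ` {- pi..pi}"
    then obtain t where t: "z = of_real t" "t \<in> {- pi..pi}" by blast
    then have "X1 z = of_real (x1 t)" "X2 z = of_real (x2 t)" "z \<in> T" using ext(3) T(2) by auto
    then show "h (X1 z, X2 z) = 0"
      using Helmholtz_real[of "x1 t" "x2 t"] XW[of z] by (simp add: h_def)
  qed (use t0 in \<open>simp add: S_def\<close>)
  then show ?thesis by (simp add: h_def)
qed

text \<open>With \<open>X1' = - i X2'\<close> the mixed second derivatives in
  \<open>i V1' + V2'\<close> cancel and the pure ones combine to the Laplacian times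
  \<open>X2'\<close>, that is \<open>- k^2 v X2'\<close>; the first term of \<open>f\<close>
  contributes \<open>k^2 q v X2'\<close>.\<close>

lemma f_at_critical_point:
  assumes t0: "t0 \<in> connected_component_set T (of_real 0)" and crit: "deriv g t0 = 0"
  shows "f_ext k q U X1 X2 t0 = of_real (k\<^sup>2 * (q - 1)) * v t0 * deriv X2 t0"
proof -
  have T0: "t0 \<in> T" using t0 connected_component_subset by blast
  note h1 = holomorphic2_on_pd1[OF uext(3,1)] and h2 = holomorphic2_on_pd2[OF uext(3,1)]
  have d1: "deriv V1 t0 = pd1 (pd1 U) (X1 t0, X2 t0) * deriv X1 t0 + pd1 (pd2 U) (X1 t0, X2 t0) * deriv X2 t0"
    using DERIV_imp_deriv[OF compose_deriv[OF h1 T0]] pd2_pd1[OF uext(3,1) XW[OF T0]]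
    by (simp add: ext_pd[abs_def])
  have d2: "deriv V2 t0 = pd1 (pd2 U) (X1 t0, X2 t0) * deriv X1 t0 + pd2 (pd2 U) (X1 t0, X2 t0) * deriv X2 t0"
    using DERIV_imp_deriv[OF compose_deriv[OF h2 T0]] by (simp add: ext_pd[abs_def])
  have X: "deriv X1 t0 = - \<i> * deriv X2 t0"
    using crit g_deriv[OF T0] by (simp add: add_eq_0_iff)
  have "\<i> * deriv V1 t0 + deriv V2 t0 =
      (pd1 (pd1 U) (X1 t0, X2 t0) + pd2 (pd2 U) (X1 t0, X2 t0)) * deriv X2 t0"
    unfolding d1 d2 X by (simp add: algebra_simps)
  also have "pd1 (pd1 U) (X1 t0, X2 t0) + pd2 (pd2 U) (X1 t0, X2 t0) = - of_real (k\<^sup>2) * U (X1 t0, X2 t0)"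
    using Helmholtz_extended[OF t0] by (simp add: eq_neg_iff_add_eq_0)
  finally show ?thesis by (simp add: f_ext_def X v_ext_def algebra_simps)
qed

end

text \<open>The quadratic equation \<open>(lam + lt)^2 = lam^2 + k^2 q\<close> for
  \<open>lt\<close>, arranged so as to trade the product \<open>lam * lt\<close> for a constant and
  a term of order \<open>lt^2\<close>.\<close>

lemma lambda_tilde_mult:
  assumes "lam\<^sup>2 + k\<^sup>2 * q \<ge> 0"
  shows "2 * lam * lambda_tilde k q lam = k\<^sup>2 * q - (lambda_tilde k q lam)\<^sup>2"
proof -
  have "(sqrt (lam\<^sup>2 + k\<^sup>2 * q))\<^sup>2 = lam\<^sup>2 + k\<^sup>2 * q" using assms by simp
  then show ?thesis by (simp add: lambda_tilde_def power2_eq_square algebra_simps)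
qed

section \<open>Integration by parts along the closed curve\<close>

context analytic_boundary
begin

text \<open>On the curve this is \<open>exp (lam x + i (lam + lt) y)\<close> with \<open>lt\<close>
  the value of \<open>lambda_tilde\<close>. In the plane that function solves the Helmholtz equation
  with index \<open>q\<close>, because \<open>lam^2 - (lam + lt)^2 = - k^2 q\<close>.\<close>

definition plane_wave :: "real \<Rightarrow> real \<Rightarrow> complex \<Rightarrow> complex" where
  "plane_wave q lam t = exp (of_real lam * g t + \<i> * of_real (lambda_tilde k q lam) * X2 t)"

definition boundary_integrand :: "real \<Rightarrow> real \<Rightarrow> complex \<Rightarrow> complex" where
  "boundary_integrand q lam t =
     (deriv X2 t * V1 t - deriv X1 t * V2 t + \<i> * of_real lam * deriv g t * v t
       + \<i> * of_real (lambda_tilde k q lam) * deriv X1 t * v t) * plane_wave q lam t"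

text \<open>What is left of \<open>lam\<close> times the boundary integrand after an exact
  derivative is split off. As \<open>lambda_tilde\<close> is \<open>O(1 / lam)\<close>, the three
  summands of the amplitude have orders 1, \<open>1 / lam\<close> and
  \<open>1 / lam^2\<close>.\<close>

definition reduced_integrand :: "real \<Rightarrow> real \<Rightarrow> complex \<Rightarrow> complex" where
  "reduced_integrand q lam t =
     (f_ext k q U X1 X2 t + \<i> * of_real (lambda_tilde k q lam) * deriv X2 t * (\<i> * V1 t + V2 t)
       - of_real ((lambda_tilde k q lam)\<^sup>2 / 2) * (deriv X2 t + \<i> * deriv X1 t) * v t) * plane_wave q lam t"

lemma holo_deriv_X: "deriv X1 holomorphic_on T" "deriv X2 holomorphic_on T"
  using ext T(1) by (auto intro: holomorphic_deriv)

lemma holo_plane_wave: "plane_wave q lam holomorphic_on T"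
  unfolding plane_wave_def by (intro holomorphic_intros holo_g ext)

lemma holo_f: "f_ext k q U X1 X2 holomorphic_on T"
  unfolding f_ext_def
  by (intro holomorphic_intros holo_deriv_X holo_v holomorphic_deriv holo_V1 holo_V2 T(1))

lemma holo_boundary_integrand: "boundary_integrand q lam holomorphic_on T"
  unfolding boundary_integrand_def
  by (intro holomorphic_intros holo_deriv_X holo_v holo_V1 holo_V2 holo_plane_wave holomorphic_deriv holo_g T(1))

lemma holo_reduced_integrand: "reduced_integrand q lam holomorphic_on T"
  unfolding reduced_integrand_def
  by (intro holomorphic_intros holo_deriv_X holo_v holo_V1 holo_V2 holo_plane_wave holo_f)

lemma x_deriv_within:
  assumes "t \<in> {- pi..pi}"
  shows "(x1 has_real_derivative Re (deriv X1 (of_real t))) (at t within {- pi..pi})"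
    and "(x2 has_real_derivative Re (deriv X2 (of_real t))) (at t within {- pi..pi})"
    and "deriv X1 (of_real t) = of_real (Re (deriv X1 (of_real t)))"
    and "deriv X2 (of_real t) = of_real (Re (deriv X2 (of_real t)))"
proof -
  have pp: "- pi < pi" by simp
  have e1: "\<And>t. t \<in> {- pi..pi} \<Longrightarrow> X1 (of_real t) = of_real (x1 t)"
    and e2: "\<And>t. t \<in> {- pi..pi} \<Longrightarrow> X2 (of_real t) = of_real (x2 t)" using ext(3) by auto
  show "(x1 has_real_derivative Re (deriv X1 (of_real t))) (at t within {- pi..pi})"
    "deriv X1 (of_real t) = of_real (Re (deriv X1 (of_real t)))"
    by (rule holomorphic_restrict_real[OF T ext(1) e1 assms pp]; assumption)+
  show "(x2 has_real_derivative Re (deriv X2 (of_real t))) (at t within {- pi..pi})"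
    "deriv X2 (of_real t) = of_real (Re (deriv X2 (of_real t)))"
    by (rule holomorphic_restrict_real[OF T ext(2) e2 assms pp]; assumption)+
qed

lemma x_deriv:
  assumes "t \<in> {- pi<..<pi}"
  shows "deriv X1 (of_real t) = of_real (deriv x1 t)" "deriv X2 (of_real t) = of_real (deriv x2 t)"
proof -
  have t: "t \<in> {- pi..pi}" and w: "at t within {- pi..pi} = at t"
    using assms by (auto simp: at_within_Icc_at)
  show "deriv X1 (of_real t) = of_real (deriv x1 t)" "deriv X2 (of_real t) = of_real (deriv x2 t)"
    using x_deriv_within[OF t] DERIV_imp_deriv unfolding w by metis+
qed

lemma real_point:
  assumes "t \<in> {- pi..pi}"
  shows "X1 (of_real t) = of_real (x1 t)" "X2 (of_real t) = of_real (x2 t)" "of_real t \<in> T"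
    "(of_real (x1 t), of_real (x2 t)) \<in> W"
    "v (of_real t) = uin (x1 t, x2 t)" "V1 (of_real t) = partial_deriv (1, 0) uin (x1 t, x2 t)"
    "V2 (of_real t) = partial_deriv (0, 1) uin (x1 t, x2 t)"
proof -
  show 1: "X1 (of_real t) = of_real (x1 t)" "X2 (of_real t) = of_real (x2 t)" "of_real t \<in> T"
    using assms ext(3) T(2) by auto
  then show 2: "(of_real (x1 t), of_real (x2 t)) \<in> W" using XW by metis
  show "v (of_real t) = uin (x1 t, x2 t)" using uext(4) 2 by (simp add: v_ext_def 1)
  show "V1 (of_real t) = partial_deriv (1, 0) uin (x1 t, x2 t)"
    "V2 (of_real t) = partial_deriv (0, 1) uin (x1 t, x2 t)"
    using pd_U_real[OF 2] by (simp_all add: ext_pd 1)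
qed

lemma boundary_integral_contour:
  "boundary_integral k q uin x1 x2 lam =
     contour_integral (linepath (- of_real pi) (of_real pi)) (boundary_integrand q lam)"
proof -
  have "contour_integral (linepath (- of_real pi) (of_real pi)) (boundary_integrand q lam)
      = integral {- pi..pi} (\<lambda>t. boundary_integrand q lam (of_real t))"
    by (subst contour_integral_linepath_Reals_eq) auto
  also have "\<dots> = boundary_integral k q uin x1 x2 lam"
    unfolding boundary_integral_def
  proof (rule integral_spike[of "{- pi, pi}"])
    fix t assume "t \<in> {- pi..pi} - {- pi, pi}"
    then have t: "t \<in> {- pi<..<pi}" "t \<in> {- pi..pi}" by auto
    show "(let x = (x1 t, x2 t);
           dx1 = complex_of_real (deriv x1 t); dx2 = complex_of_real (deriv x2 t);
           g = of_real (x1 t) + \<i> * of_real (x2 t); dg = dx1 + \<i> * dx2;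
           v = uin x; V1 = partial_deriv (1, 0) uin x; V2 = partial_deriv (0, 1) uin x;
           lt = complex_of_real (lambda_tilde k q lam)
       in (dx2 * V1 - dx1 * V2 + \<i> * of_real lam * dg * v + \<i> * lt * dx1 * v)
          * exp (of_real lam * g + \<i> * lt * of_real (x2 t))) = boundary_integrand q lam (of_real t)"
      unfolding Let_def boundary_integrand_def plane_wave_def g_deriv[OF real_point(3)[OF t(2)]]
        g_ext_def x_deriv[OF t(1)] real_point[OF t(2)] ..
  qed simp
  finally show ?thesis ..
qed

text \<open>The primitive is built from the terms containing \<open>g'\<close>:
  \<open>i lam v\<close> absorbs the part of order \<open>lam^2\<close>, and subtracting its own
  derivative turns \<open>(x2', - x1') . V\<close> into \<open>- i g' (V1 - i V2)\<close>, which the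
  second summand absorbs. The remaining product \<open>lam * lt\<close> is rewritten by
  \<open>lambda_tilde_mult\<close>.\<close>

lemma reduced_primitive:
  assumes q: "lam\<^sup>2 + k\<^sup>2 * q \<ge> 0" and t: "t \<in> T"
  shows "((\<lambda>t. (\<i> * of_real lam * v t - \<i> * (V1 t - \<i> * V2 t)) * plane_wave q lam t) has_field_derivative
    of_real lam * boundary_integrand q lam t - reduced_integrand q lam t) (at t)"
proof -
  define lt where "lt = complex_of_real (lambda_tilde k q lam)"
  define L where "L = complex_of_real lam"
  define E where "E = plane_wave q lam"
  have lt: "of_real (k\<^sup>2 * q) = lt * lt + 2 * L * lt"
    using arg_cong[OF lambda_tilde_mult[OF q], of complex_of_real]
    unfolding lt_def L_def by (simp add: power2_eq_square algebra_simps)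
  have dE: "(E has_field_derivative (L * (deriv X1 t + \<i> * deriv X2 t) + \<i> * lt * deriv X2 t) * E t) (at t)"
    unfolding E_def plane_wave_def[abs_def] g_ext_def[abs_def] lt_def L_def
    by (auto intro!: derivative_eq_intros dX t simp: algebra_simps)
  have dV: "(V1 has_field_derivative deriv V1 t) (at t)" "(V2 has_field_derivative deriv V2 t) (at t)"
    using holo_V1 holo_V2 T(1) t by (auto intro: holomorphic_derivI)
  have "((\<lambda>t. (\<i> * L * v t - \<i> * (V1 t - \<i> * V2 t)) * E t) has_field_derivative
      (\<i> * L * (V1 t * deriv X1 t + V2 t * deriv X2 t) - \<i> * (deriv V1 t - \<i> * deriv V2 t)) * E t +
      ((L * (deriv X1 t + \<i> * deriv X2 t) + \<i> * lt * deriv X2 t) * E t) * (\<i> * L * v t - \<i> * (V1 t - \<i> * V2 t))) (at t)"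
    by (intro DERIV_mult DERIV_diff DERIV_cmult v_deriv t dV dE)
  also have "(\<i> * L * (V1 t * deriv X1 t + V2 t * deriv X2 t) - \<i> * (deriv V1 t - \<i> * deriv V2 t)) * E t +
      ((L * (deriv X1 t + \<i> * deriv X2 t) + \<i> * lt * deriv X2 t) * E t) * (\<i> * L * v t - \<i> * (V1 t - \<i> * V2 t))
    = L * ((deriv X2 t * V1 t - deriv X1 t * V2 t + \<i> * L * (deriv X1 t + \<i> * deriv X2 t) * v t
       + \<i> * lt * deriv X1 t * v t) * E t) -
      ((lt * lt + 2 * L * lt) / 2 * (deriv X2 t + \<i> * deriv X1 t) * v t + (\<i> * deriv V1 t + deriv V2 t)
       + \<i> * lt * deriv X2 t * (\<i> * V1 t + V2 t) - lt * lt / 2 * (deriv X2 t + \<i> * deriv X1 t) * v t) * E t"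
    by (simp add: algebra_simps add_divide_distrib)
  also have "\<dots> = of_real lam * boundary_integrand q lam t - reduced_integrand q lam t"
    unfolding boundary_integrand_def reduced_integrand_def f_ext_def g_deriv[OF t] E_def[symmetric]
      lt[symmetric] L_def[symmetric] lt_def[symmetric]
    by (simp add: lt_def power2_eq_square)
  finally show ?thesis by (simp add: L_def E_def)
qed

text \<open>The primitive contains no derivative of the parametrization, so it takes equal values at
  both ends as soon as the curve closes up.\<close>

lemma boundary_integral_reduced:
  assumes q: "lam\<^sup>2 + k\<^sup>2 * q \<ge> 0"
  shows "of_real lam * boundary_integral k q uin x1 x2 lam =
    contour_integral (linepath (- of_real pi) (of_real pi)) (reduced_integrand q lam)"
proof -
  define P where "P t = (\<i> * of_real lam * v t - \<i> * (V1 t - \<i> * V2 t)) * plane_wave q lam t" for t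
  let ?L = "linepath (- complex_of_real pi) (of_real pi)"
  have "closed_segment (- complex_of_real pi) (of_real pi) = of_real ` {- pi..pi}"
    using closed_segment_of_real[of "- pi" pi] by (simp add: closed_segment_eq_real_ivl)
  then have im: "path_image ?L \<subseteq> T" using T(2) by simp
  have D: "(P has_field_derivative of_real lam * boundary_integrand q lam t - reduced_integrand q lam t)
      (at t within T)" if "t \<in> T" for t
    unfolding P_def by (rule has_field_derivative_at_within[OF reduced_primitive[OF q that]])
  have main: "((\<lambda>t. of_real lam * boundary_integrand q lam t - reduced_integrand q lam t)
      has_contour_integral P (of_real pi) - P (- of_real pi)) ?L"
    using contour_integral_primitive[OF D valid_path_linepath im] by simp
  have ends: "P (of_real pi) = P (- of_real pi)"
    using real_point[of pi] real_point[of "- pi"] closed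
    by (simp add: P_def plane_wave_def g_ext_def)
  have int: "boundary_integrand q lam contour_integrable_on ?L" "reduced_integrand q lam contour_integrable_on ?L"
    using contour_integrable_holomorphic_simple[OF _ T(1) valid_path_linepath im]
      holo_boundary_integrand holo_reduced_integrand by blast+
  have "((\<lambda>t. of_real lam * boundary_integrand q lam t - reduced_integrand q lam t) has_contour_integral
      of_real lam * contour_integral ?L (boundary_integrand q lam) - contour_integral ?L (reduced_integrand q lam)) ?L"
    by (intro has_contour_integral_diff has_contour_integral_lmul has_contour_integral_integral int)
  then have "of_real lam * contour_integral ?L (boundary_integrand q lam)
      - contour_integral ?L (reduced_integrand q lam) = 0"
    using main ends has_contour_integral_unique by force
  then show ?thesis by (simp add: boundary_integral_contour)
qed

end

text \<open>Functions holomorphic on \<open>T\<close> can be unbounded there; on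
  \<open>\<Omega>\<close> they are all bounded, as the saddle estimates require.\<close>

lemma compact_neighbourhood:
  fixes T :: "complex set"
  assumes "compact K" "open T" "K \<subseteq> T"
  obtains \<Omega> where "open \<Omega>" "K \<subseteq> \<Omega>" "compact (closure \<Omega>)" "closure \<Omega> \<subseteq> T"
proof -
  obtain e where e: "e > 0" "(\<Union>x\<in>K. cball x e) \<subseteq> T"
    using compact_subset_open_imp_cball_epsilon_subset[OF assms] by blast
  define S where "S = {x + y | x y. x \<in> K \<and> y \<in> cball 0 e}"
  have S: "compact S" unfolding S_def by (intro compact_sums assms compact_cball)
  have ST: "S \<subseteq> T"
  proof
    fix z assume "z \<in> S"
    then obtain x y where "z = x + y" "x \<in> K" "norm y \<le> e" by (auto simp: S_def)
    then have "z \<in> (\<Union>x\<in>K. cball x e)" by (auto simp: dist_norm intro!: bexI[of _ x])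
    then show "z \<in> T" using e(2) by blast
  qed
  define \<Omega> where "\<Omega> = (\<Union>x\<in>K. ball x e)"
  have "\<Omega> \<subseteq> S"
  proof
    fix z assume "z \<in> \<Omega>"
    then obtain x where "x \<in> K" "dist x z < e" by (auto simp: \<Omega>_def)
    then show "z \<in> S"
      unfolding S_def by (intro CollectI exI[of _ x] exI[of _ "z - x"]) (auto simp: dist_norm norm_minus_commute)
  qed
  then have c: "closure \<Omega> \<subseteq> S" using S by (simp add: closure_minimal compact_imp_closed)
  show thesis
  proof (rule that[of \<Omega>])
    show "compact (closure \<Omega>)"
      using S c by (metis closed_closure compact_Int_closed inf.absorb_iff2)
    show "K \<subseteq> \<Omega>" using e(1) by (force simp: \<Omega>_def)
  qed (use c ST in \<open>auto simp: \<Omega>_def\<close>)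
qed

lemma norm_exp_remainders:
  fixes z :: complex
  shows "norm (exp z - 1) \<le> exp (norm z) * norm z"
    and "norm (exp z - 1 - z) \<le> exp (norm z) * (norm z)\<^sup>2"
proof -
  have e: "exp \<bar>Re z\<bar> \<le> exp (norm z)" by (simp add: abs_Re_le_cmod)
  have "norm (exp z - 1) \<le> exp \<bar>Re z\<bar> * norm z" using Taylor_exp[of z 0] by simp
  also have "\<dots> \<le> exp (norm z) * norm z" using e by (intro mult_right_mono) auto
  finally show "norm (exp z - 1) \<le> exp (norm z) * norm z" .
  have "norm (exp z - 1 - z) \<le> exp \<bar>Re z\<bar> * (norm z)\<^sup>2"
    using Taylor_exp[of z 1] by (simp add: power2_eq_square diff_diff_eq)
  also have "\<dots> \<le> exp (norm z) * (norm z)\<^sup>2" using e by (intro mult_right_mono) auto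
  finally show "norm (exp z - 1 - z) \<le> exp (norm z) * (norm z)\<^sup>2" .
qed

lemma lambda_tilde_bounds:
  assumes "lam > 0" "k\<^sup>2 * q \<ge> 0"
  shows "lambda_tilde k q lam \<ge> 0" "lambda_tilde k q lam \<le> k\<^sup>2 * q / (2 * lam)"
proof -
  have "sqrt (lam\<^sup>2) \<le> sqrt (lam\<^sup>2 + k\<^sup>2 * q)" using assms by (intro real_sqrt_le_mono) auto
  then show "lambda_tilde k q lam \<ge> 0" using assms(1) by (simp add: lambda_tilde_def)
  have "lam\<^sup>2 + k\<^sup>2 * q \<ge> 0" using assms by (intro add_nonneg_nonneg) auto
  from lambda_tilde_mult[OF this] have "2 * lam * lambda_tilde k q lam \<le> k\<^sup>2 * q" by simp
  then show "lambda_tilde k q lam \<le> k\<^sup>2 * q / (2 * lam)" using assms(1) by (simp add: field_simps)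
qed

text \<open>Multiplication by \<open>y\<close>, of size \<open>s / norm e\<close>, removes the
  exponential factor common to the expansion and its error.\<close>

lemma norm_scaled_le:
  fixes A e Q y :: complex
  assumes "norm (A - e * Q) \<le> K * norm e * p" and "e \<noteq> 0" "norm y = 1 / norm e * s"
  shows "norm (y * A - y * e * Q) \<le> K * (p * s)"
proof -
  have s: "s \<ge> 0" using assms(2,3) by (metis divide_pos_pos linorder_not_le mult_pos_neg norm_ge_zero zero_less_norm_iff zero_less_one)
  have "norm (y * A - y * e * Q) = norm y * norm (A - e * Q)"
    by (simp add: norm_mult[symmetric] algebra_simps)
  also have "\<dots> \<le> (1 / norm e * s) * (K * norm e * p)"
    using assms s by (intro mult_mono) auto
  also have "\<dots> = K * (p * s)" using assms(2) by (simp add: field_simps)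
  finally show ?thesis .
qed

section \<open>Expansion of the boundary integral\<close>

context analytic_boundary
begin

text \<open>With \<open>\<mu>\<close> the value of \<open>lambda_tilde\<close>, the amplitude is
  \<open>f + \<mu> F1 + Rm\<close> where \<open>Rm = O(\<mu>^2)\<close>. As \<open>f t0 = 0\<close>,
  the first part starts at \<open>lam powr (-3/2)\<close>; the second starts at
  \<open>\<mu> lam powr (-1/2)\<close>, which is the same order; the uniform bound makes the third
  \<open>O(lam powr (-5/2))\<close>. All this concerns \<open>lam\<close> times the integral, whence
  the scale \<open>lam powr (5/2)\<close>.\<close>

lemma boundary_integral_asymptotics:
  assumes q: "q > 0"
    and c: "valid_path c" "path_image c \<subseteq> T" "homotopic_paths T (linepath (- of_real pi) (of_real pi)) c"
    and s0: "s0 \<in> {0<..<1}" "c s0 = t0" and crit: "deriv g t0 = 0"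
    and a: "a\<^sup>2 * (deriv ^^ 2) g t0 = - 2"
    and val: "\<forall>s\<in>{0..1} - {s0}. Re (g (c s)) < Re (g t0)"
    and right: "\<forall>\<^sub>F s in at_right s0. Re ((c s - t0) / a) > 0"
    and left: "\<forall>\<^sub>F s in at_left s0. Re ((c s - t0) / a) < 0"
    and f0: "f_ext k q U X1 X2 t0 = 0"
  defines "f \<equiv> f_ext k q U X1 X2"
  shows "\<exists>K. \<forall>lam\<ge>1. norm (of_real (lam powr (5/2)) / exp (of_real lam * g t0) * boundary_integral k q uin x1 x2 lam
     - of_real (sqrt pi) * (a ^ 3 * ((deriv ^^ 2) f t0 - deriv f t0 * (deriv ^^ 3) g t0 / (deriv ^^ 2) g t0) / 4
         + of_real (k\<^sup>2 * q / 2) * \<i> * (deriv X2 t0 * (\<i> * V1 t0 + V2 t0)) * a)) \<le> K / lam"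
proof -
  obtain \<Omega> where \<Omega>: "open \<Omega>" "path_image c \<subseteq> \<Omega>" "compact (closure \<Omega>)" "closure \<Omega> \<subseteq> T"
    by (rule compact_neighbourhood[OF compact_path_image[OF valid_path_imp_path[OF c(1)]] T(1) c(2)])
  have \<Omega>T: "\<Omega> \<subseteq> T" using \<Omega>(4) closure_subset by blast
  have bdd: "\<exists>B\<ge>0. \<forall>z\<in>\<Omega>. norm (F z) \<le> B" if "F holomorphic_on T" for F
  proof -
    have "compact (F ` closure \<Omega>)"
      by (intro compact_continuous_image \<Omega>(3) holomorphic_on_imp_continuous_on holomorphic_on_subset[OF that \<Omega>(4)])
    then obtain B where "B > 0" "\<forall>z\<in>F ` closure \<Omega>. norm z \<le> B"
      using compact_imp_bounded bounded_pos by blast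
    then show ?thesis using closure_subset by (intro exI[of _ B]) auto
  qed
  have sub: "F holomorphic_on \<Omega>" if "F holomorphic_on T" for F
    using that \<Omega>T holomorphic_on_subset by blast
  define kk where "kk = k\<^sup>2 * q"
  have kk: "kk \<ge> 0" using q by (simp add: kk_def)
  define B1 where "B1 t = deriv X2 t * (\<i> * V1 t + V2 t)" for t
  define B2 where "B2 t = (deriv X2 t + \<i> * deriv X1 t) * v t" for t
  \<comment> \<open>The coefficient of \<open>\<mu>\<close> in the amplitude multiplied by
    \<open>exp (i \<mu> X2)\<close>. At \<open>t0\<close> the summand with \<open>f\<close> drops
    out.\<close>
  define F1 where "F1 t = \<i> * (B1 t + X2 t * f t)" for t
  have hf: "f holomorphic_on T" unfolding f_def by (rule holo_f)
  have hB1: "B1 holomorphic_on T" unfolding B1_def by (intro holomorphic_intros holo_deriv_X holo_V1 holo_V2)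
  have hB2: "B2 holomorphic_on T" unfolding B2_def by (intro holomorphic_intros holo_deriv_X holo_v)
  have hF1: "F1 holomorphic_on T" unfolding F1_def by (intro holomorphic_intros hB1 hf ext)
  obtain bf where bf: "bf \<ge> 0" "\<forall>z\<in>\<Omega>. norm (f z) \<le> bf" using bdd[OF hf] by blast
  obtain b1 where b1: "b1 \<ge> 0" "\<forall>z\<in>\<Omega>. norm (B1 z) \<le> b1" using bdd[OF hB1] by blast
  obtain b2 where b2: "b2 \<ge> 0" "\<forall>z\<in>\<Omega>. norm (B2 z) \<le> b2" using bdd[OF hB2] by blast
  obtain b where b: "b \<ge> 0" "\<forall>z\<in>\<Omega>. norm (X2 z) \<le> b" using bdd[OF ext(2)] by blast
  obtain bF where bF: "\<forall>z\<in>\<Omega>. norm (F1 z) \<le> bF" using bdd[OF hF1] by blast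
  note sad = saddle_expansion[OF \<Omega>(1) sub[OF holo_g] crit a c(1) \<Omega>(2) s0 val right left]
  obtain K2 where "\<forall>F B lam. F holomorphic_on \<Omega> \<longrightarrow> (\<forall>z\<in>\<Omega>. norm (F z) \<le> B) \<longrightarrow> lam \<ge> 1 \<longrightarrow>
      norm (contour_integral c (\<lambda>t. F t * exp (of_real lam * g t)))
        \<le> K2 * B * exp (lam * Re (g t0)) * lam powr (-1/2)"
    using sad(1) by (rule exE)
  then have K2: "norm (contour_integral c (\<lambda>t. F t * exp (of_real lam * g t)))
        \<le> K2 * B * exp (lam * Re (g t0)) * lam powr (-1/2)"
    if "F holomorphic_on \<Omega>" "\<forall>z\<in>\<Omega>. norm (F z) \<le> B" "lam \<ge> 1" for F B lam
    using that by simp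
  have f00: "f t0 = 0" using f0 by (simp add: f_def)
  obtain K0 c2 where c2: "c2 = a ^ 3 * ((deriv ^^ 2) f t0 - deriv f t0 * (deriv ^^ 3) g t0 / (deriv ^^ 2) g t0)"
    and K0: "\<forall>lam\<ge>1. norm (contour_integral c (\<lambda>t. f t * exp (of_real lam * g t)) -
             exp (of_real lam * g t0) * of_real (sqrt pi) *
               (f t0 * a * of_real (lam powr (-1/2)) + c2 / 4 * of_real (lam powr (-3/2))))
          \<le> K0 * exp (lam * Re (g t0)) * lam powr (-5/2)"
    using sad(2)[OF sub[OF hf] bf(2)] f00 by (elim exE conjE) (rule that, simp, assumption)
  obtain K1 d where K1: "\<forall>lam\<ge>1. norm (contour_integral c (\<lambda>t. F1 t * exp (of_real lam * g t)) -
             exp (of_real lam * g t0) * of_real (sqrt pi) *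
               (F1 t0 * a * of_real (lam powr (-1/2)) + d / 4 * of_real (lam powr (-3/2))))
          \<le> K1 * exp (lam * Re (g t0)) * lam powr (-5/2)"
    using sad(2)[OF sub[OF hF1] bF] by (elim exE conjE) (rule that, assumption)
  define e0 where "e0 = exp (kk / 2 * b)"
  define C where "C = bf * (e0 * b\<^sup>2) + b1 * (e0 * b) + b2 * e0"
  have pos: "K \<ge> 0" if "norm (z :: complex) \<le> K * exp x * 1 powr (-5/2)" for K z x
    using order_trans[OF norm_ge_zero that] by (simp add: zero_le_mult_iff)
  \<comment> \<open>The zero amplitude with bound 1 shows that the constant is nonnegative.\<close>
  have K2p: "K2 \<ge> 0" using K2[of "\<lambda>_. 0" 1 1] by (simp add: zero_le_mult_iff)
  have Cp: "C \<ge> 0" using bf b1 b2 b by (simp add: C_def e0_def)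
  show ?thesis
  proof (intro exI allI impI)
    fix lam :: real assume lam: "lam \<ge> 1"
    define \<mu> where "\<mu> = lambda_tilde k q lam"
    have kq: "lam\<^sup>2 + k\<^sup>2 * q \<ge> 0" using kk by (simp add: kk_def)
    have \<mu>: "\<mu> \<ge> 0" "\<mu> \<le> kk / (2 * lam)"
      using lambda_tilde_bounds[of lam k q] lam kk by (auto simp: \<mu>_def kk_def)
    have "kk / (2 * lam) \<le> kk / 2" using lam kk by (intro divide_left_mono) auto
    then have \<mu>2: "\<mu> \<le> kk / 2" using \<mu> by simp
    define S where "S t = (f t + \<i> * of_real \<mu> * B1 t - of_real (\<mu>\<^sup>2 / 2) * B2 t) * exp (\<i> * of_real \<mu> * X2 t)" for t
    define Rm where "Rm t = S t - f t - of_real \<mu> * F1 t" for t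
    have hR: "Rm holomorphic_on T" unfolding Rm_def S_def
      by (intro holomorphic_intros hf hB1 hB2 hF1 ext)
    have Rb: "norm (Rm z) \<le> C * \<mu>\<^sup>2" if z: "z \<in> \<Omega>" for z
    proof -
      define w where "w = \<i> * of_real \<mu> * X2 z"
      have nw: "norm w = \<mu> * norm (X2 z)" using \<mu> by (simp add: w_def norm_mult)
      have nw2: "norm w \<le> \<mu> * b" using b z \<mu> by (simp add: nw mult_left_mono)
      also have "\<dots> \<le> kk / 2 * b" using \<mu>2 b by (intro mult_right_mono) auto
      finally have ew: "exp (norm w) \<le> e0" by (simp add: e0_def)
      have r1: "norm (exp w - 1) \<le> e0 * (\<mu> * b)"
        by (rule order_trans[OF norm_exp_remainders(1)]) (use ew nw2 in \<open>auto intro!: mult_mono simp: e0_def\<close>)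
      have r2: "norm (exp w - 1 - w) \<le> e0 * (\<mu> * b)\<^sup>2"
        by (rule order_trans[OF norm_exp_remainders(2)]) (use ew nw2 in \<open>auto intro!: mult_mono power_mono simp: e0_def\<close>)
      have r0: "norm (exp w) \<le> e0" using norm_exp[of w] ew by linarith
      have "Rm z = f z * (exp w - 1 - w) + \<i> * of_real \<mu> * B1 z * (exp w - 1) - of_real (\<mu>\<^sup>2 / 2) * B2 z * exp w"
        by (simp add: Rm_def S_def F1_def w_def algebra_simps)
      also have "norm \<dots> \<le> norm (f z * (exp w - 1 - w)) + norm (\<i> * of_real \<mu> * B1 z * (exp w - 1))
          + norm (of_real (\<mu>\<^sup>2 / 2) * B2 z * exp w)"
        by (rule order_trans[OF norm_triangle_ineq4]) (intro add_right_mono norm_triangle_ineq)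
      also have "\<dots> = norm (f z) * norm (exp w - 1 - w) + \<mu> * norm (B1 z) * norm (exp w - 1)
          + \<mu>\<^sup>2 / 2 * norm (B2 z) * norm (exp w)"
        using \<mu> by (simp add: norm_mult norm_divide norm_power)
      also have "\<dots> \<le> bf * (e0 * (\<mu> * b)\<^sup>2) + \<mu> * b1 * (e0 * (\<mu> * b)) + \<mu>\<^sup>2 * b2 * e0"
        using r0 r1 r2 bf b1 b2 z \<mu> b by (intro add_mono mult_mono) (auto simp: e0_def)
      also have "\<dots> = C * \<mu>\<^sup>2" by (simp add: C_def algebra_simps power2_eq_square)
      finally show ?thesis .
    qed
    define e where "e = exp (of_real lam * g t0)"
    have ne: "norm e = exp (lam * Re (g t0))" and e0: "e \<noteq> 0" by (simp_all add: e_def)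
    define A0 where "A0 = contour_integral c (\<lambda>t. f t * exp (of_real lam * g t))"
    define A1 where "A1 = contour_integral c (\<lambda>t. F1 t * exp (of_real lam * g t))"
    define A2 where "A2 = contour_integral c (\<lambda>t. Rm t * exp (of_real lam * g t))"
    have ci: "(\<lambda>t. F t * exp (of_real lam * g t)) contour_integrable_on c" if "F holomorphic_on T" for F
      by (rule contour_integrable_holomorphic_simple[OF _ T(1) c(1,2)]) (intro holomorphic_intros that holo_g)
    have "of_real lam * boundary_integral k q uin x1 x2 lam = contour_integral c (reduced_integrand q lam)"
      unfolding boundary_integral_reduced[OF kq]
      by (rule Cauchy_theorem_homotopic_paths[OF c(3) T(1) holo_reduced_integrand]) (use c in auto)
    also have "reduced_integrand q lam = (\<lambda>t. f t * exp (of_real lam * g t) + of_real \<mu> * (F1 t * exp (of_real lam * g t))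
        + Rm t * exp (of_real lam * g t))"
      by (auto simp: fun_eq_iff reduced_integrand_def plane_wave_def Rm_def S_def B1_def B2_def
          exp_add algebra_simps f_def[symmetric] \<mu>_def[symmetric])
    also have "contour_integral c \<dots> = A0 + of_real \<mu> * A1 + A2"
      unfolding A0_def A1_def A2_def
      by (rule contour_integral_unique) (intro has_contour_integral_add has_contour_integral_lmul
          has_contour_integral_integral ci hf hF1 hR)
    finally have I: "of_real lam * boundary_integral k q uin x1 x2 lam = A0 + of_real \<mu> * A1 + A2" .
    define y where "y = of_real (lam powr (3/2)) / e"
    have ny: "norm y = 1 / norm e * lam powr (3/2)" by (simp add: y_def norm_divide)
    have s: "-5/2 + 3/2 = (-1::real)" "-1/2 + 3/2 = (1::real)" "-3/2 + 3/2 = (0::real)" "1 + 3/2 = (5/2::real)"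
      by simp_all
    have p1: "lam powr (-1) = 1 / lam" "lam powr 1 = lam" "lam powr 0 = 1"
      using lam by (simp_all add: powr_minus_divide)
    have p: "lam powr (-5/2) * lam powr (3/2) = 1 / lam" "lam powr (-1/2) * lam powr (3/2) = lam"
      "lam powr (-3/2) * lam powr (3/2) = 1"
      using p1 unfolding powr_add[symmetric] s by simp_all
    have p4: "lam * lam powr (3/2) = lam powr (5/2)"
      using powr_add[of lam 1 "3/2", unfolded s] p1(2) by simp
    have cp: "complex_of_real (lam powr (-1/2)) * of_real (lam powr (3/2)) = of_real lam"
      "complex_of_real (lam powr (-3/2)) * of_real (lam powr (3/2)) = 1"
      using p by (metis of_real_mult of_real_1)+
    have ye: "y * e = of_real (lam powr (3/2))" using e0 by (simp add: y_def)
    have yq: "y * e * (of_real (sqrt pi) * (u * of_real (lam powr (-1/2)) + w / 4 * of_real (lam powr (-3/2))))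
       = of_real (sqrt pi) * (u * of_real lam + w / 4)" for u w
    proof -
      have "y * e * (of_real (sqrt pi) * (u * of_real (lam powr (-1/2)) + w / 4 * of_real (lam powr (-3/2))))
        = of_real (sqrt pi) * (u * (complex_of_real (lam powr (-1/2)) * of_real (lam powr (3/2)))
           + w / 4 * (complex_of_real (lam powr (-3/2)) * of_real (lam powr (3/2))))"
        unfolding ye by (simp add: algebra_simps)
      then show ?thesis unfolding cp by simp
    qed
    have E0: "norm (y * A0 - of_real (sqrt pi) * (c2 / 4)) \<le> K0 * (1 / lam)"
      using norm_scaled_le[OF K0[rule_format, OF lam, folded A0_def e_def, folded ne, unfolded mult.assoc[of e]] e0 ny]
      unfolding yq p by (simp add: f00)
    have E1: "norm (y * A1 - of_real (sqrt pi) * (F1 t0 * a * of_real lam + d / 4)) \<le> K1 * (1 / lam)"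
      using norm_scaled_le[OF K1[rule_format, OF lam, folded A1_def e_def, folded ne, unfolded mult.assoc[of e]] e0 ny]
      unfolding yq p .
    have "norm (A2 - e * 0) \<le> (K2 * (C * \<mu>\<^sup>2)) * norm e * lam powr (-1/2)"
      using K2[OF sub[OF hR] _ lam, of "C * \<mu>\<^sup>2"] Rb by (simp add: A2_def ne)
    from norm_scaled_le[OF this e0 ny] have E2: "norm (y * A2) \<le> K2 * (C * \<mu>\<^sup>2) * lam"
      unfolding p by simp
    have m2: "\<mu>\<^sup>2 * lam \<le> kk\<^sup>2 / 4 * (1 / lam)"
    proof -
      have "\<mu>\<^sup>2 * lam \<le> (kk / (2 * lam))\<^sup>2 * lam" using \<mu> lam by (intro mult_right_mono power_mono) auto
      also have "\<dots> = kk\<^sup>2 / 4 * (1 / lam)" using lam by (simp add: power2_eq_square)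
      finally show ?thesis .
    qed
    have "\<mu>\<^sup>2 * 1 \<le> \<mu>\<^sup>2 * lam" using lam by (intro mult_left_mono) auto
    then have m3: "\<mu>\<^sup>2 \<le> kk\<^sup>2 / 4 * (1 / lam)" using m2 by simp
    have m1: "\<mu> \<le> kk / 2 * (1 / lam)" using \<mu> by simp
    \<comment> \<open>\<open>\<mu> * lam\<close> tends to \<open>k^2 q / 2\<close> with an error of
      order \<open>1 / lam^2\<close>; this limit is the origin of the last summand of
      \<open>C2\<close>.\<close>
    have mm: "\<mu> * lam - kk / 2 = - (\<mu>\<^sup>2 / 2)"
      using lambda_tilde_mult[OF kq] by (simp add: \<mu>_def kk_def field_simps)
    have "\<bar>\<mu> * lam - kk / 2\<bar> = \<mu>\<^sup>2 / 2" by (simp add: mm)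
    also have "\<dots> \<le> \<mu>\<^sup>2" by simp
    also note m3
    finally have m4: "\<bar>\<mu> * lam - kk / 2\<bar> \<le> kk\<^sup>2 / 4 * (1 / lam)" .
    have F1t0: "F1 t0 = \<i> * (deriv X2 t0 * (\<i> * V1 t0 + V2 t0))" by (simp add: F1_def f00 B1_def)
    define Q where "Q = of_real (sqrt pi) * (c2 / 4 + of_real (kk / 2) * F1 t0 * a)"
    have "of_real (lam powr (5/2)) / e * boundary_integral k q uin x1 x2 lam = y * (A0 + of_real \<mu> * A1 + A2)"
      unfolding I[symmetric] y_def using p4 by (simp add: mult_ac flip: of_real_mult)
    also have "\<dots> - Q = (y * A0 - of_real (sqrt pi) * (c2 / 4))
        + of_real \<mu> * (y * A1 - of_real (sqrt pi) * (F1 t0 * a * of_real lam + d / 4))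
        + y * A2 + of_real (sqrt pi) * (of_real (\<mu> * lam - kk / 2) * (F1 t0 * a)) + of_real \<mu> * (of_real (sqrt pi) * (d / 4))"
      by (simp add: Q_def algebra_simps)
    also have "norm \<dots> \<le> norm (y * A0 - of_real (sqrt pi) * (c2 / 4))
        + norm (of_real \<mu> * (y * A1 - of_real (sqrt pi) * (F1 t0 * a * of_real lam + d / 4)))
        + norm (y * A2) + norm (of_real (sqrt pi) * (of_real (\<mu> * lam - kk / 2) * (F1 t0 * a))) + norm (of_real \<mu> * (of_real (sqrt pi) * (d / 4)))"
      by (intro order_trans[OF norm_triangle_ineq] add_right_mono norm_triangle_ineq)
    also have "\<dots> \<le> K0 * (1 / lam) + kk / 2 * (K1 * (1 / lam)) + K2 * C * (kk\<^sup>2 / 4 * (1 / lam))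
        + sqrt pi * (kk\<^sup>2 / 4 * (1 / lam) * norm (F1 t0 * a)) + kk / 2 * (1 / lam) * (sqrt pi * norm (d / 4))"
    proof (intro add_mono)
      show "norm (of_real \<mu> * (y * A1 - of_real (sqrt pi) * (F1 t0 * a * of_real lam + d / 4))) \<le> kk / 2 * (K1 * (1 / lam))"
        unfolding norm_mult[of "of_real \<mu>"] using E1 \<mu> \<mu>2 by (intro mult_mono) auto
      have "norm (y * A2) \<le> K2 * C * (\<mu>\<^sup>2 * lam)" using E2 by (simp add: mult_ac)
      also have "\<dots> \<le> K2 * C * (kk\<^sup>2 / 4 * (1 / lam))" using m2 K2p Cp by (intro mult_left_mono) auto
      finally show "norm (y * A2) \<le> K2 * C * (kk\<^sup>2 / 4 * (1 / lam))" .
      have "norm (of_real (sqrt pi) * (of_real (\<mu> * lam - kk / 2) * (F1 t0 * a))) = sqrt pi * (\<bar>\<mu> * lam - kk / 2\<bar> * norm (F1 t0 * a))"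
        by (simp only: norm_mult norm_of_real) simp
      also have "\<dots> \<le> sqrt pi * (kk\<^sup>2 / 4 * (1 / lam) * norm (F1 t0 * a))"
        using m4 by (intro mult_left_mono mult_right_mono) auto
      finally show "norm (of_real (sqrt pi) * (of_real (\<mu> * lam - kk / 2) * (F1 t0 * a))) \<le> sqrt pi * (kk\<^sup>2 / 4 * (1 / lam) * norm (F1 t0 * a))" .
      have "norm (of_real \<mu> * (of_real (sqrt pi) * (d / 4))) = \<mu> * (sqrt pi * norm (d / 4))"
        using \<mu>(1) by (simp add: norm_mult norm_divide)
      also have "\<dots> \<le> kk / 2 * (1 / lam) * (sqrt pi * norm (d / 4))"
        using m1 by (intro mult_right_mono) auto
      finally show "norm (of_real \<mu> * (of_real (sqrt pi) * (d / 4))) \<le> kk / 2 * (1 / lam) * (sqrt pi * norm (d / 4))" .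
    qed (rule E0)
    also have "\<dots> = (K0 + kk / 2 * K1 + K2 * C * kk\<^sup>2 / 4 + sqrt pi * kk\<^sup>2 / 4 * norm (F1 t0 * a) + kk / 2 * (sqrt pi * norm (d / 4))) / lam"
      by (simp add: add_divide_distrib mult_ac)
    finally show "norm (of_real (lam powr (5/2)) / exp (of_real lam * g t0) * boundary_integral k q uin x1 x2 lam
     - of_real (sqrt pi) * (a ^ 3 * ((deriv ^^ 2) f t0 - deriv f t0 * (deriv ^^ 3) g t0 / (deriv ^^ 2) g t0) / 4
         + of_real (k\<^sup>2 * q / 2) * \<i> * (deriv X2 t0 * (\<i> * V1 t0 + V2 t0)) * a))
      \<le> (K0 + kk / 2 * K1 + K2 * C * kk\<^sup>2 / 4 + sqrt pi * kk\<^sup>2 / 4 * norm (F1 t0 * a) + kk / 2 * (sqrt pi * norm (d / 4))) / lam"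
      unfolding Q_def c2 F1t0 kk_def e_def by (simp only: mult.assoc)
  qed
qed

end

section \<open>Green's formula via the Cauchy-Pompeiu formula\<close>

definition cplx :: "real \<times> real \<Rightarrow> complex" where
  "cplx p = of_real (fst p) + \<i> * of_real (snd p)"

lemma cplx_diff: "cplx (p - q) = cplx p - cplx q"
  by (simp add: cplx_def algebra_simps)

lemma cplx_eq_0_iff [simp]: "cplx p = 0 \<longleftrightarrow> p = 0"
  by (auto simp: cplx_def complex_eq_iff prod_eq_iff)

lemma cplx_0 [simp]: "cplx 0 = 0"
  by (simp add: cplx_def)

lemma norm_cplx_sq: "(norm (cplx p))\<^sup>2 = (fst p)\<^sup>2 + (snd p)\<^sup>2"
  by (simp add: cplx_def cmod_power2)

lemma continuous_on_cplx [continuous_intros]: "continuous_on A f \<Longrightarrow> continuous_on A (\<lambda>x. cplx (f x))"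
  unfolding cplx_def by (intro continuous_intros)

lemma measurable_cplx [measurable]: "cplx \<in> borel_measurable borel"
  by (intro borel_measurable_continuous_onI continuous_intros)

section \<open>Local integrability of the Cauchy kernel\<close>

lemma integrable_lborel_mult_prod:
  fixes f g :: "real \<Rightarrow> real"
  assumes f: "integrable lborel f" and g: "integrable lborel g"
  shows "integrable lborel (\<lambda>p. f (fst p) * g (snd p))"
  unfolding lborel_prod[symmetric]
proof (rule lborel_pair.Fubini_integrable)
  show "(\<lambda>p. f (fst p) * g (snd p)) \<in> borel_measurable (lborel \<Otimes>\<^sub>M lborel)"
    using borel_measurable_integrable[OF f] borel_measurable_integrable[OF g] by measurable
  show "integrable lborel (\<lambda>x. LINT y|lborel. norm (f (fst (x, y)) * g (snd (x, y))))"
    using f by (simp add: abs_mult)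
  show "AE x in lborel. integrable lborel (\<lambda>y. f (fst (x, y)) * g (snd (x, y)))"
    using g by simp
qed

lemma integrable_lborel_shift:
  fixes f :: "'a::euclidean_space \<Rightarrow> 'b::{banach, second_countable_topology}"
  assumes "integrable lborel f"
  shows "integrable lborel (\<lambda>p. f (p - c))" "(LINT p|lborel. f (p - c)) = (LINT p|lborel. f p)"
proof -
  have m: "f \<in> borel_measurable borel" using borel_measurable_integrable[OF assms] by simp
  have e: "f (p - c) = f ((+) (- c) p)" for p by simp
  show "integrable lborel (\<lambda>p. f (p - c))"
    unfolding e using assms m
    by (subst integrable_distr_eq[symmetric, where N = borel]) (simp_all add: lborel_distr_plus)
  show "(LINT p|lborel. f (p - c)) = (LINT p|lborel. f p)"
    unfolding e using m
    by (subst integral_distr[symmetric, where N = borel]) (simp_all add: lborel_distr_plus)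
qed

lemma integrable_inverse_sqrt: "integrable lborel (\<lambda>a::real. indicator {-1..1} a * \<bar>a\<bar> powr (-1/2) :: real)"
proof -
  have "((\<lambda>x. x powr (-1/2)) has_integral (1 powr (-1/2 + 1) / (-1/2 + 1))) {0..1::real}"
    by (rule has_integral_powr_from_0) auto
  from nn_integral_has_integral_lebesgue'[OF _ this]
  have "(\<integral>\<^sup>+x. ennreal (x powr (-1/2)) * indicator {0..1} x \<partial>lborel) < \<infinity>" by simp
  then have "integrable lborel (\<lambda>x. x powr (-1/2) * indicator {0..1::real} x)"
    by (intro integrableI_bounded) (auto simp: ennreal_mult' ennreal_indicator abs_mult)
  also have "(\<lambda>x. x powr (-1/2) * indicator {0..1::real} x)
      = (\<lambda>x. indicator {0..} x *\<^sub>R (indicator {-1..1} x * \<bar>x\<bar> powr (-1/2)))"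
    by (auto simp: indicator_def fun_eq_iff)
  finally have "has_bochner_integral lborel (\<lambda>x. indicator {0..} x *\<^sub>R ((indicator {-1..1} x :: real) * \<bar>x\<bar> powr (-1/2)))
      (LINT x|lborel. indicator {0..} x *\<^sub>R ((indicator {-1..1} x :: real) * \<bar>x\<bar> powr (-1/2)))"
    by (rule has_bochner_integral_integrable)
  from has_bochner_integral_even_function[OF this] show ?thesis
    by (rule integrable.intros) (auto simp: indicator_def)
qed

text \<open>Since \<open>\<bar>a b\<bar> \<le> a^2 + b^2\<close>, the planar singularity is
  dominated by a product of one-dimensional ones with exponent -1/2, each locally
  integrable.\<close>

lemma inverse_norm_cplx_le:
  assumes "fst p \<noteq> 0" "snd p \<noteq> 0"
  shows "inverse (norm (cplx p)) \<le> \<bar>fst p\<bar> powr (-1/2) * \<bar>snd p\<bar> powr (-1/2)"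
proof -
  have "\<bar>fst p\<bar> * \<bar>snd p\<bar> \<le> (norm (cplx p))\<^sup>2"
  proof -
    have "0 \<le> (\<bar>fst p\<bar> - \<bar>snd p\<bar>)\<^sup>2" by simp
    also have "\<dots> = (fst p)\<^sup>2 + (snd p)\<^sup>2 - 2 * (\<bar>fst p\<bar> * \<bar>snd p\<bar>)" by (simp add: power2_diff)
    finally show ?thesis unfolding norm_cplx_sq using mult_nonneg_nonneg[of "\<bar>fst p\<bar>" "\<bar>snd p\<bar>"] by linarith
  qed
  then have "sqrt (\<bar>fst p\<bar> * \<bar>snd p\<bar>) \<le> norm (cplx p)" by (rule real_le_lsqrt[rotated -1]) auto
  moreover have "sqrt (\<bar>fst p\<bar> * \<bar>snd p\<bar>) > 0" using assms by simp
  ultimately have "inverse (norm (cplx p)) \<le> inverse (sqrt (\<bar>fst p\<bar> * \<bar>snd p\<bar>))"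
    by (intro le_imp_inverse_le) auto
  also have "\<dots> = \<bar>fst p\<bar> powr (-1/2) * \<bar>snd p\<bar> powr (-1/2)"
    using assms by (simp add: powr_minus powr_half_sqrt real_sqrt_mult)
  finally show ?thesis .
qed

lemma integrable_inverse_cplx_unit_square:
  "integrable lborel (\<lambda>p. indicator ({-1..1} \<times> {-1..1}) p * inverse (norm (cplx p)))"
proof (rule Bochner_Integration.integrable_bound[OF integrable_lborel_mult_prod[OF integrable_inverse_sqrt integrable_inverse_sqrt]])
  show "(\<lambda>p. indicator ({-1..1} \<times> {-1..1}) p * inverse (norm (cplx p))) \<in> borel_measurable lborel"
  proof -
    have "{-1..1} \<times> {-1..1} \<in> sets (borel :: (real \<times> real) measure)"
      by (intro borel_closed closed_Times) auto
    then have "(\<lambda>p. indicator ({-1..1} \<times> {-1..1}) p * inverse (norm (cplx p))) \<in> borel_measurable borel"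
      by measurable
    then show ?thesis by simp
  qed
  have "AE p in (lborel \<Otimes>\<^sub>M lborel :: (real \<times> real) measure). fst p \<noteq> 0 \<and> snd p \<noteq> 0"
  proof (rule lborel_pair.AE_pair_measure)
    show "{x \<in> space (lborel \<Otimes>\<^sub>M lborel). fst x \<noteq> (0::real) \<and> snd x \<noteq> (0::real)} \<in> sets (lborel \<Otimes>\<^sub>M lborel)"
      by measurable
    show "AE x in lborel. AE y in lborel. fst (x, y) \<noteq> (0::real) \<and> snd (x, y) \<noteq> (0::real)"
    proof -
      have z: "AE x in lborel. x \<noteq> (0::real)" by (rule AE_lborel_singleton)
      then show ?thesis
      proof eventually_elim
        case (elim x)
        from z show ?case by eventually_elim (use elim in simp)
      qed
    qed
  qed
  then show "AE p in lborel. norm (indicator ({-1..1} \<times> {-1..1}) p * inverse (norm (cplx p)))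
      \<le> norm (indicator {-1..1} (fst p) * \<bar>fst p\<bar> powr (-1/2) * (indicator {-1..1} (snd p) * \<bar>snd p\<bar> powr (-1/2)))"
    unfolding lborel_prod
  proof eventually_elim
    case (elim p)
    then show ?case using inverse_norm_cplx_le[of p] by (auto simp: indicator_def mem_Times_iff)
  qed
qed

text \<open>\<open>C\<close> is the same for every pole \<open>c\<close>, as Fubini's theorem along
  the curve demands. Near the pole the kernel is a translate of one fixed integrable function,
  elsewhere it is at most 1.\<close>

lemma integrable_inverse_cplx:
  assumes B: "bounded (B :: (real \<times> real) set)" "B \<in> sets borel"
  obtains C where "C \<ge> 0" "\<And>c. integrable lborel (\<lambda>p. indicator B p * inverse (norm (cplx (p - c))))"
    "\<And>c. (LINT p|lborel. indicator B p * inverse (norm (cplx (p - c)))) \<le> C"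
proof -
  define k0 where "k0 p = indicator ({-1..1} \<times> {-1..1}) p * inverse (norm (cplx p))" for p
  have k0: "integrable lborel k0" unfolding k0_def[abs_def] by (rule integrable_inverse_cplx_unit_square)
  have iB: "integrable lborel (indicator B :: _ \<Rightarrow> real)"
    using B by (intro integrable_real_indicator emeasure_bounded_finite) auto
  have le: "indicator B p * inverse (norm (cplx q)) \<le> k0 q + indicator B p" for p q
  proof (cases "q \<in> {-1..1} \<times> {-1..1}")
    case True
    then show ?thesis by (auto simp: k0_def indicator_def)
  next
    case False
    then have "1 \<le> \<bar>fst q\<bar> \<or> 1 \<le> \<bar>snd q\<bar>" by (cases q) auto
    then have "1 \<le> norm (cplx q)"
      using abs_Re_le_cmod[of "cplx q"] abs_Im_le_cmod[of "cplx q"] by (auto simp: cplx_def)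
    then have "inverse (norm (cplx q)) \<le> 1" using inverse_le_1_iff by blast
    then show ?thesis by (auto simp: k0_def indicator_def)
  qed
  have dom: "integrable lborel (\<lambda>p. k0 (p - c) + indicator B p)" for c
    by (intro Bochner_Integration.integrable_add integrable_lborel_shift(1) k0 iB)
  have i: "integrable lborel (\<lambda>p. indicator B p * inverse (norm (cplx (p - c))))" for c
  proof (rule Bochner_Integration.integrable_bound[OF dom[of c]])
    show "(\<lambda>p. indicator B p * inverse (norm (cplx (p - c)))) \<in> borel_measurable lborel"
      using B(2) by measurable
    show "AE p in lborel. norm (indicator B p * inverse (norm (cplx (p - c)))) \<le> norm (k0 (p - c) + indicator B p)"
      using le by (intro AE_I2) (auto simp: abs_mult intro: order_trans[OF le abs_ge_self])
  qed
  show thesis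
  proof (rule that[of "\<bar>(LINT p|lborel. k0 p) + (LINT p|lborel. indicator B p)\<bar>"])
    fix c
    have "(LINT p|lborel. indicator B p * inverse (norm (cplx (p - c)))) \<le> (LINT p|lborel. k0 (p - c) + indicator B p)"
      by (rule integral_mono[OF i dom le])
    also have "\<dots> = (LINT p|lborel. k0 p) + (LINT p|lborel. indicator B p)"
      by (subst Bochner_Integration.integral_add) (use integrable_lborel_shift[OF k0] iB in auto)
    finally show "(LINT p|lborel. indicator B p * inverse (norm (cplx (p - c))))
        \<le> \<bar>(LINT p|lborel. k0 p) + (LINT p|lborel. indicator B p)\<bar>" by simp
  qed (use i in auto)
qed

section \<open>The Cauchy-Pompeiu formula by regularization\<close>

lemma integrable_continuous_compact_support:
  fixes h :: "real \<times> real \<Rightarrow> 'b::{banach, second_countable_topology}"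
  assumes "continuous_on UNIV h" "\<And>p. p \<notin> cbox u v \<Longrightarrow> h p = 0"
  shows "integrable lborel h"
proof -
  have "integrable lborel (\<lambda>p. indicator (cbox u v) p *\<^sub>R h p)"
    using assms(1) continuous_on_subset by (intro borel_integrable_compact) auto
  also have "(\<lambda>p. indicator (cbox u v) p *\<^sub>R h p) = h" using assms(2) by (auto simp: indicator_def)
  finally show ?thesis .
qed

lemma integral_derivative_zero:
  fixes h h' :: "real \<Rightarrow> complex"
  assumes "\<And>a. (h has_vector_derivative h' a) (at a)" "continuous_on UNIV h'"
    and "\<And>a. \<bar>a\<bar> > R \<Longrightarrow> h a = 0 \<and> h' a = 0"
  shows "(LINT a|lborel. h' a) = 0"
proof -
  define S where "S = \<bar>R\<bar> + 1"
  have S: "S > \<bar>R\<bar>" "S \<ge> 0" by (auto simp: S_def)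
  have "(LINT a|lborel. h' a) = (LINT a|lborel. indicator {- S..S} a *\<^sub>R h' a)"
    using assms(3) S by (intro Bochner_Integration.integral_cong) (auto simp: indicator_def)
  also have "\<dots> = h S - h (- S)"
    using S by (intro integral_FTC_atLeastAtMost has_vector_derivative_at_within[OF assms(1)]
        continuous_on_subset[OF assms(2)]) auto
  also have "\<dots> = 0" using assms(3)[of S] assms(3)[of "- S"] S by auto
  finally show ?thesis .
qed

lemma integral_partial_zero:
  fixes h h' :: "real \<times> real \<Rightarrow> complex"
  assumes c: "continuous_on UNIV h'" and z: "\<And>p. p \<notin> cbox (- R, - R) (R, R) \<Longrightarrow> h p = 0 \<and> h' p = 0"
  shows "(\<And>a b. ((\<lambda>r. h (r, b)) has_vector_derivative h' (a, b)) (at a)) \<Longrightarrow> (LINT p|lborel. h' p) = 0"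
    and "(\<And>a b. ((\<lambda>r. h (a, r)) has_vector_derivative h' (a, b)) (at b)) \<Longrightarrow> (LINT p|lborel. h' p) = 0"
proof -
  have i: "integrable (lborel \<Otimes>\<^sub>M lborel) h'"
    unfolding lborel_prod using c z by (intro integrable_continuous_compact_support) auto
  have ca: "continuous_on UNIV (\<lambda>a. h' (a, b))" "continuous_on UNIV (\<lambda>a. h' (b, a))" for b
    by (rule continuous_on_compose2[OF c]; auto intro!: continuous_intros)+
  have za: "h (a, b) = 0 \<and> h' (a, b) = 0" if "\<bar>a\<bar> > R \<or> \<bar>b\<bar> > R" for a b
    by (rule z) (use that in auto)
  {
    assume d: "\<And>a b. ((\<lambda>r. h (r, b)) has_vector_derivative h' (a, b)) (at a)"
    have "(LINT a|lborel. h' (a, b)) = 0" for b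
      by (rule integral_derivative_zero[of "\<lambda>a. h (a, b)" _ R]) (use d ca za in auto)
    moreover have "(LINT p|(lborel \<Otimes>\<^sub>M lborel). h' p) = (LINT b|lborel. LINT a|lborel. h' (a, b))"
      using lborel_pair.integral_snd[of "\<lambda>a b. h' (a, b)"] i by simp
    ultimately show "(LINT p|lborel. h' p) = 0" by (simp add: lborel_prod)
  next
    assume d: "\<And>a b. ((\<lambda>r. h (a, r)) has_vector_derivative h' (a, b)) (at b)"
    have "(LINT b|lborel. h' (a, b)) = 0" for a
      by (rule integral_derivative_zero[of "\<lambda>b. h (a, b)" _ R]) (use d ca za in auto)
    moreover have "(LINT p|(lborel \<Otimes>\<^sub>M lborel). h' p) = (LINT a|lborel. LINT b|lborel. h' (a, b))"
      using lborel_pair.integral_fst'[OF i] by simp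
    ultimately show "(LINT p|lborel. h' p) = 0" by (simp add: lborel_prod)
  }
qed

text \<open>The value is \<open>pi\<close>, but only positivity matters.\<close>

definition bump_mass :: real where
  "bump_mass = (LINT p|lborel. 1 / (1 + (norm (cplx p))\<^sup>2)\<^sup>2)"

lemma integrable_inverse_1_plus_sq: "integrable lborel (\<lambda>x::real. inverse (1 + x\<^sup>2))"
  using integrable_inverse_1_plus_square by (simp add: set_integrable_def)

lemma integrable_bump: "integrable lborel (\<lambda>p. 1 / (1 + (norm (cplx p))\<^sup>2)\<^sup>2)"
proof (rule Bochner_Integration.integrable_bound[OF integrable_lborel_mult_prod[OF integrable_inverse_1_plus_sq integrable_inverse_1_plus_sq]])
  show "(\<lambda>p. 1 / (1 + (norm (cplx p))\<^sup>2)\<^sup>2) \<in> borel_measurable lborel" by measurable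
  show "AE p in lborel. norm (1 / (1 + (norm (cplx p))\<^sup>2)\<^sup>2) \<le> norm (inverse (1 + (fst p)\<^sup>2) * inverse (1 + (snd p)\<^sup>2))"
  proof (rule AE_I2)
    fix p :: "real \<times> real"
    have "(1 + (fst p)\<^sup>2) * (1 + (snd p)\<^sup>2) \<le> (1 + (norm (cplx p))\<^sup>2) * (1 + (norm (cplx p))\<^sup>2)"
      unfolding norm_cplx_sq by (intro mult_mono) auto
    then have "1 / (1 + (norm (cplx p))\<^sup>2)\<^sup>2 \<le> 1 / ((1 + (fst p)\<^sup>2) * (1 + (snd p)\<^sup>2))"
      by (intro divide_left_mono) (auto simp: power2_eq_square intro!: mult_pos_pos add_pos_nonneg)
    then show "norm (1 / (1 + (norm (cplx p))\<^sup>2)\<^sup>2) \<le> norm (inverse (1 + (fst p)\<^sup>2) * inverse (1 + (snd p)\<^sup>2))"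
      by (simp add: abs_mult divide_inverse)
  qed
qed

lemma bump_mass_pos: "bump_mass > 0"
proof -
  have nn: "0 \<le> 1 / (1 + (norm (cplx p))\<^sup>2)\<^sup>2" for p by simp
  have pos: "0 < 1 / (1 + (norm (cplx p))\<^sup>2)\<^sup>2" for p
  proof -
    have "1 + (norm (cplx p))\<^sup>2 > 0" by (intro add_pos_nonneg) auto
    then show ?thesis by simp
  qed
  have "bump_mass \<noteq> 0"
  proof
    assume "bump_mass = 0"
    then have "AE p in lborel. 1 / (1 + (norm (cplx p))\<^sup>2)\<^sup>2 = 0"
      using integral_nonneg_eq_0_iff_AE[OF integrable_bump] nn unfolding bump_mass_def by auto
    then have "AE p in (lborel :: (real \<times> real) measure). False"
      by (rule AE_mp) (use pos in \<open>auto intro!: AE_I2 simp: less_le\<close>)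
    then show False by (simp add: AE_iff_null null_sets_def)
  qed
  moreover have "bump_mass \<ge> 0" unfolding bump_mass_def by (intro integral_nonneg_AE AE_I2 nn)
  ultimately show ?thesis by simp
qed

text \<open>A smoothing of \<open>1 / z\<close> at its pole. It is dominated by the Cauchy kernel,
  and \<open>d/dx + i d/dy\<close> maps it to \<open>2 e^2 / (|z|^2 + e^2)^2\<close>, an approximate
  identity up to a constant factor.\<close>

definition reg_kernel :: "real \<Rightarrow> real \<times> real \<Rightarrow> complex" where
  "reg_kernel e p = cnj (cplx p) / of_real ((norm (cplx p))\<^sup>2 + e\<^sup>2)"

lemma norm_reg_kernel_le: "norm (reg_kernel e p) \<le> inverse (norm (cplx p))"
proof (cases "p = 0")
  case False
  then have n: "norm (cplx p) > 0" by simp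
  have "norm (reg_kernel e p) = norm (cplx p) / ((norm (cplx p))\<^sup>2 + e\<^sup>2)"
    by (simp add: reg_kernel_def norm_divide del: of_real_add of_real_power)
  also have "\<dots> \<le> norm (cplx p) / (norm (cplx p))\<^sup>2"
    using n by (intro divide_left_mono) (auto intro!: mult_pos_pos add_pos_nonneg)
  also have "\<dots> = inverse (norm (cplx p))" using n by (simp add: power2_eq_square divide_inverse)
  finally show ?thesis .
qed (simp add: reg_kernel_def)

text \<open>At \<open>p = 0\<close> both sides are 0 by the convention \<open>inverse 0 = 0\<close>,
  so the convergence holds at every point.\<close>

lemma reg_kernel_tendsto: "(\<lambda>n. reg_kernel (1 / real (Suc n)) p) \<longlonglongrightarrow> inverse (cplx p)"
proof (cases "p = 0")
  case False
  have "(\<lambda>n. of_real ((norm (cplx p))\<^sup>2 + (1 / real (Suc n))\<^sup>2) :: complex) \<longlonglongrightarrow> of_real ((norm (cplx p))\<^sup>2 + 0\<^sup>2)"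
    by (intro tendsto_intros LIMSEQ_Suc[OF lim_1_over_n] LIMSEQ_inverse_real_of_nat[unfolded inverse_eq_divide])
  then have "(\<lambda>n. reg_kernel (1 / real (Suc n)) p) \<longlonglongrightarrow> cnj (cplx p) / of_real ((norm (cplx p))\<^sup>2 + 0\<^sup>2)"
    unfolding reg_kernel_def using False by (intro tendsto_divide tendsto_const) auto
  also have "cnj (cplx p) / of_real ((norm (cplx p))\<^sup>2 + 0\<^sup>2) = inverse (cplx p)"
    using False by (simp add: complex_norm_square[symmetric] field_simps)
  finally show ?thesis .
qed (simp add: reg_kernel_def)

lemma reg_kernel_derivs:
  assumes "e \<noteq> 0"
  obtains Kx Ky where
    "\<And>a b. ((\<lambda>r. reg_kernel e (r, b)) has_vector_derivative Kx (a, b)) (at a)"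
    "\<And>a b. ((\<lambda>r. reg_kernel e (a, r)) has_vector_derivative Ky (a, b)) (at b)"
    "continuous_on UNIV Kx" "continuous_on UNIV Ky"
    "\<And>p. Kx p + \<i> * Ky p = of_real (2 * e\<^sup>2 / ((norm (cplx p))\<^sup>2 + e\<^sup>2)\<^sup>2)"
proof -
  define D where "D p = (fst p)\<^sup>2 + (snd p)\<^sup>2 + e\<^sup>2" for p :: "real \<times> real"
  have D: "D p > 0" for p using assms by (simp add: D_def add_nonneg_pos)
  have K: "reg_kernel e p = Complex (fst p / D p) (- snd p / D p)" for p
    unfolding reg_kernel_def norm_cplx_sq D_def[symmetric] by (simp add: cplx_def complex_eq_iff)
  define Kx where "Kx p = Complex ((D p - fst p * (2 * fst p)) / (D p)\<^sup>2) (snd p * (2 * fst p) / (D p)\<^sup>2)" for p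
  define Ky where "Ky p = Complex (- fst p * (2 * snd p) / (D p)\<^sup>2) (- (D p - snd p * (2 * snd p)) / (D p)\<^sup>2)" for p
  have cD: "continuous_on UNIV D" unfolding D_def by (intro continuous_intros)
  have D0: "D (a, b) \<noteq> 0" "a\<^sup>2 + b\<^sup>2 + e\<^sup>2 \<noteq> 0" for a b using D[of "(a, b)"] by (auto simp: D_def)
  show thesis
  proof (rule that[of Kx Ky])
    fix a b :: real
    have dD: "((\<lambda>r. D (r, b)) has_real_derivative 2 * a) (at a)" "((\<lambda>r. D (a, r)) has_real_derivative 2 * b) (at b)"
      unfolding D_def by (auto intro!: derivative_eq_intros)
    have "((\<lambda>r. r / D (r, b)) has_real_derivative (D (a, b) - a * (2 * a)) / (D (a, b))\<^sup>2) (at a)"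
      "((\<lambda>r. - b / D (r, b)) has_real_derivative b * (2 * a) / (D (a, b))\<^sup>2) (at a)"
      "((\<lambda>r. a / D (a, r)) has_real_derivative - a * (2 * b) / (D (a, b))\<^sup>2) (at b)"
      "((\<lambda>r. - r / D (a, r)) has_real_derivative - (D (a, b) - b * (2 * b)) / (D (a, b))\<^sup>2) (at b)"
      using DERIV_divide[OF DERIV_ident dD(1) D0(1)] DERIV_divide[OF DERIV_const[of "- b"] dD(1) D0(1)]
        DERIV_divide[OF DERIV_const[of a] dD(2) D0(1)]
        DERIV_divide[OF DERIV_minus[OF DERIV_ident] dD(2) D0(1)]
      by (simp_all add: power2_eq_square)
    then show "((\<lambda>r. reg_kernel e (r, b)) has_vector_derivative Kx (a, b)) (at a)"
      "((\<lambda>r. reg_kernel e (a, r)) has_vector_derivative Ky (a, b)) (at b)"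
      unfolding K Kx_def Ky_def has_vector_derivative_complex_iff
      by (simp_all add: has_real_derivative_iff_has_vector_derivative)
  next
    show "continuous_on UNIV Kx" "continuous_on UNIV Ky"
      unfolding Kx_def Ky_def Complex_eq using D
      by (intro continuous_intros cD; simp add: less_imp_neq[symmetric])+
    fix p
    have "Kx p + \<i> * Ky p = of_real ((2 * D p - 2 * ((fst p)\<^sup>2 + (snd p)\<^sup>2)) / (D p)\<^sup>2)"
      by (simp add: Kx_def Ky_def complex_eq_iff power2_eq_square diff_divide_distrib add_divide_distrib)
        (simp add: algebra_simps)
    also have "2 * D p - 2 * ((fst p)\<^sup>2 + (snd p)\<^sup>2) = 2 * e\<^sup>2" by (simp add: D_def)
    finally show "Kx p + \<i> * Ky p = of_real (2 * e\<^sup>2 / ((norm (cplx p))\<^sup>2 + e\<^sup>2)\<^sup>2)"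
      by (simp add: D_def norm_cplx_sq)
  qed
qed

text \<open>Derivatives are recorded along the axes, which suits Fubini's theorem combined with the
  fundamental theorem of calculus on lines. \<open>fx\<close> and \<open>fy\<close> are parameters
  so that a cut-off product can be supplied with its product-rule derivatives.\<close>

locale C1_compact_support =
  fixes f fx fy :: "real \<times> real \<Rightarrow> complex" and R :: real
  assumes dx: "\<And>a b. ((\<lambda>r. f (r, b)) has_vector_derivative fx (a, b)) (at a)"
    and dy: "\<And>a b. ((\<lambda>r. f (a, r)) has_vector_derivative fy (a, b)) (at b)"
    and cont: "continuous_on UNIV f" "continuous_on UNIV fx" "continuous_on UNIV fy"
    and supp: "\<And>p. p \<notin> cbox (- R, - R) (R, R) \<Longrightarrow> f p = 0 \<and> fx p = 0 \<and> fy p = 0"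
begin

text \<open>Twice the Wirtinger derivative with respect to the conjugate variable.\<close>

definition "dbar p = fx p + \<i> * fy p"

lemma cont_dbar: "continuous_on UNIV dbar"
  unfolding dbar_def by (intro continuous_intros cont)

lemma bounded_of_cont:
  fixes h :: "real \<times> real \<Rightarrow> complex"
  assumes "continuous_on UNIV h" "\<And>p. p \<notin> cbox (- R, - R) (R, R) \<Longrightarrow> h p = 0"
  obtains B where "B \<ge> 0" "\<And>p. norm (h p) \<le> B"
proof -
  have "compact (h ` cbox (- R, - R) (R, R))"
    by (intro compact_continuous_image compact_cbox continuous_on_subset[OF assms(1)]) auto
  then obtain B where B: "B > 0" "\<forall>z\<in>h ` cbox (- R, - R) (R, R). norm z \<le> B"
    using compact_imp_bounded bounded_pos by blast
  show thesis
  proof (rule that[of B])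
    show "norm (h p) \<le> B" for p
      using B assms(2)[of p] by (cases "p \<in> cbox (- R, - R) (R, R)") auto
  qed (use B in simp)
qed

lemma dbar_dominated:
  obtains C where "C \<ge> 0" "\<And>c. integrable lborel (\<lambda>p. norm (dbar p) * inverse (norm (cplx (p - c))))"
    "\<And>c. (LINT p|lborel. norm (dbar p) * inverse (norm (cplx (p - c)))) \<le> C"
proof -
  let ?B = "cbox (- R, - R) (R, R)"
  obtain C where C: "C \<ge> 0" "\<And>c. integrable lborel (\<lambda>p. indicator ?B p * inverse (norm (cplx (p - c))))"
    "\<And>c. (LINT p|lborel. indicator ?B p * inverse (norm (cplx (p - c)))) \<le> C"
    by (rule integrable_inverse_cplx[of ?B]) (auto intro: that)
  obtain B where B: "B \<ge> 0" "\<And>p. norm (dbar p) \<le> B"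
    by (rule bounded_of_cont[OF cont_dbar]) (use supp in \<open>auto simp: dbar_def intro: that\<close>)
  have le: "norm (dbar p) * inverse (norm (cplx (p - c))) \<le> B * (indicator ?B p * inverse (norm (cplx (p - c))))" for p c
    using supp[of p] B(2)[of p] by (auto simp: indicator_def dbar_def intro!: mult_right_mono)
  have i: "integrable lborel (\<lambda>p. norm (dbar p) * inverse (norm (cplx (p - c))))" for c
  proof (rule Bochner_Integration.integrable_bound)
    show "integrable lborel (\<lambda>p. B * (indicator ?B p * inverse (norm (cplx (p - c)))))"
      by (intro integrable_mult_right C)
    have "dbar \<in> borel_measurable borel" by (rule borel_measurable_continuous_onI[OF cont_dbar])
    then show "(\<lambda>p. norm (dbar p) * inverse (norm (cplx (p - c)))) \<in> borel_measurable lborel" by measurable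
    show "AE p in lborel. norm (norm (dbar p) * inverse (norm (cplx (p - c)))) \<le> norm (B * (indicator ?B p * inverse (norm (cplx (p - c)))))"
      using le[of _ c] B(1) by (intro AE_I2) (simp add: abs_mult)
  qed
  show thesis
  proof (rule that[OF _ i])
    show "B * C \<ge> 0" using B C by simp
    fix c
    have "(LINT p|lborel. norm (dbar p) * inverse (norm (cplx (p - c)))) \<le> (LINT p|lborel. B * (indicator ?B p * inverse (norm (cplx (p - c)))))"
      by (intro integral_mono i integrable_mult_right C le)
    also have "\<dots> \<le> B * C" using C(3)[of c] B by (simp add: mult_left_mono)
    finally show "(LINT p|lborel. norm (dbar p) * inverse (norm (cplx (p - c)))) \<le> B * C" .
  qed
qed

text \<open>\<open>hx\<close> and \<open>hy\<close> are partial derivatives of the compactly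
  supported product of \<open>f\<close> with the shifted kernel, so their integrals vanish. In
  \<open>hx + i hy\<close> one term carries \<open>dbar\<close>, the other the explicit derivative
  of the kernel; the substitution \<open>c + e p\<close> turns the latter into a bump of unit
  width.\<close>

lemma Pompeiu_regularized:
  assumes e: "e > 0"
  shows "(LINT p|lborel. dbar p * reg_kernel e (p - c))
     = - 2 * (LINT p|lborel. f (c + e *\<^sub>R p) / of_real ((1 + (norm (cplx p))\<^sup>2)\<^sup>2))"
proof -
  have "e \<noteq> 0" using e by simp
  from reg_kernel_derivs[OF this] obtain Kx Ky where
    K: "\<And>a b. ((\<lambda>r. reg_kernel e (r, b)) has_vector_derivative Kx (a, b)) (at a)"
    "\<And>a b. ((\<lambda>r. reg_kernel e (a, r)) has_vector_derivative Ky (a, b)) (at b)"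
    "continuous_on UNIV Kx" "continuous_on UNIV Ky"
    "\<And>p. Kx p + \<i> * Ky p = of_real (2 * e\<^sup>2 / ((norm (cplx p))\<^sup>2 + e\<^sup>2)\<^sup>2)" by blast
  have cK: "continuous_on UNIV (reg_kernel e)"
    unfolding reg_kernel_def using e
    by (intro continuous_intros) (auto simp: add_nonneg_eq_0_iff simp flip: of_real_power of_real_add)
  have sh: "continuous_on UNIV (\<lambda>p. h (p - c))" if "continuous_on UNIV h" for h :: "real \<times> real \<Rightarrow> complex"
    by (rule continuous_on_compose2[OF that]) (auto intro!: continuous_intros)
  define h where "h p = f p * reg_kernel e (p - c)" for p
  define hx where "hx p = f p * Kx (p - c) + fx p * reg_kernel e (p - c)" for p
  define hy where "hy p = f p * Ky (p - c) + fy p * reg_kernel e (p - c)" for p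
  obtain c1 c2 where c: "c = (c1, c2)" by fastforce
  have Kc: "((\<lambda>r. reg_kernel e (r - c1, b - c2)) has_vector_derivative Kx (a - c1, b - c2)) (at a)"
    "((\<lambda>r. reg_kernel e (a - c1, r - c2)) has_vector_derivative Ky (a - c1, b - c2)) (at b)" for a b
  proof -
    have s: "((\<lambda>r::real. r - d) has_vector_derivative 1) (at x)" for d x
      by (auto intro!: derivative_eq_intros simp flip: has_real_derivative_iff_has_vector_derivative)
    show "((\<lambda>r. reg_kernel e (r - c1, b - c2)) has_vector_derivative Kx (a - c1, b - c2)) (at a)"
      "((\<lambda>r. reg_kernel e (a - c1, r - c2)) has_vector_derivative Ky (a - c1, b - c2)) (at b)"
      using vector_diff_chain_at[OF s K(1)] vector_diff_chain_at[OF s K(2)] by (simp_all add: o_def)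
  qed
  have chx: "continuous_on UNIV hx" and chy: "continuous_on UNIV hy"
    unfolding hx_def hy_def by (intro continuous_intros cont sh K cK)+
  have z: "h p = 0 \<and> hx p = 0" "h p = 0 \<and> hy p = 0" if "p \<notin> cbox (- R, - R) (R, R)" for p
    using supp[OF that] by (auto simp: h_def hx_def hy_def)
  have "(LINT p|lborel. hx p) = 0"
    by (rule integral_partial_zero(1)[OF chx z(1)])
      (auto simp: h_def hx_def c intro!: has_vector_derivative_mult dx Kc)
  moreover have "(LINT p|lborel. hy p) = 0"
    by (rule integral_partial_zero(2)[OF chy z(2)])
      (auto simp: h_def hy_def c intro!: has_vector_derivative_mult dy Kc)
  moreover have "integrable lborel hx" "integrable lborel hy"
    by (rule integrable_continuous_compact_support[OF chx] integrable_continuous_compact_support[OF chy]; use z in blast)+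
  ultimately have "0 = (LINT p|lborel. hx p + \<i> * hy p)"
    by simp
  also have "(\<lambda>p. hx p + \<i> * hy p) = (\<lambda>p. dbar p * reg_kernel e (p - c)
      + f p * of_real (2 * e\<^sup>2 / ((norm (cplx (p - c)))\<^sup>2 + e\<^sup>2)\<^sup>2))"
    unfolding K(5)[symmetric] by (auto simp: hx_def hy_def dbar_def algebra_simps)
  also have "(LINT p|lborel. dbar p * reg_kernel e (p - c)
      + f p * of_real (2 * e\<^sup>2 / ((norm (cplx (p - c)))\<^sup>2 + e\<^sup>2)\<^sup>2)) =
      (LINT p|lborel. dbar p * reg_kernel e (p - c)) +
      (LINT p|lborel. f p * of_real (2 * e\<^sup>2 / ((norm (cplx (p - c)))\<^sup>2 + e\<^sup>2)\<^sup>2))"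
  proof (rule Bochner_Integration.integral_add)
    show "integrable lborel (\<lambda>p. dbar p * reg_kernel e (p - c))"
    proof (rule integrable_continuous_compact_support[of _ "(- R, - R)" "(R, R)"])
      show "continuous_on UNIV (\<lambda>p. dbar p * reg_kernel e (p - c))"
        by (intro continuous_intros cont_dbar sh cK)
    qed (simp add: dbar_def supp)
    show "integrable lborel (\<lambda>p. f p * of_real (2 * e\<^sup>2 / ((norm (cplx (p - c)))\<^sup>2 + e\<^sup>2)\<^sup>2))"
      unfolding K(5)[symmetric]
    proof (rule integrable_continuous_compact_support[of _ "(- R, - R)" "(R, R)"])
      show "continuous_on UNIV (\<lambda>p. f p * (Kx (p - c) + \<i> * Ky (p - c)))"
        by (intro continuous_intros cont sh K)
    qed (simp add: supp)
  qed
  \<comment> \<open>\<open>\<bar>e\<bar> ^ 2\<close> is the Jacobian of the planar dilation.\<close>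
  also have "(LINT p|lborel. f p * of_real (2 * e\<^sup>2 / ((norm (cplx (p - c)))\<^sup>2 + e\<^sup>2)\<^sup>2))
     = (LINT p|lborel. \<bar>e\<bar> ^ 2 *\<^sub>R (f (c + e *\<^sub>R p) * of_real (2 * e\<^sup>2 / ((norm (cplx (e *\<^sub>R p)))\<^sup>2 + e\<^sup>2)\<^sup>2)))"
  proof -
    have m: "(\<lambda>p. f p * of_real (2 * e\<^sup>2 / ((norm (cplx (p - c)))\<^sup>2 + e\<^sup>2)\<^sup>2)) \<in> borel_measurable borel"
      unfolding K(5)[symmetric] by (intro borel_measurable_continuous_onI continuous_intros cont sh K)
    show ?thesis
      by (subst lborel_affine[OF \<open>e \<noteq> 0\<close>, of c])
        (use m in \<open>simp add: integral_density integral_distr flip: power2_eq_square\<close>)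
  qed
  also have "\<dots> = (LINT p|lborel. 2 * (f (c + e *\<^sub>R p) / of_real ((1 + (norm (cplx p))\<^sup>2)\<^sup>2)))"
  proof (rule Bochner_Integration.integral_cong[OF refl])
    fix p
    have eq: "(norm (cplx (e *\<^sub>R p)))\<^sup>2 + e\<^sup>2 = e\<^sup>2 * (1 + (norm (cplx p))\<^sup>2)"
      unfolding norm_cplx_sq by (simp add: power_mult_distrib algebra_simps)
    have sc: "e\<^sup>2 * (2 * e\<^sup>2 / ((norm (cplx (e *\<^sub>R p)))\<^sup>2 + e\<^sup>2)\<^sup>2) = 2 / (1 + (norm (cplx p))\<^sup>2)\<^sup>2"
    proof -
      have sc: "e\<^sup>2 * (2 * e\<^sup>2 / (e\<^sup>2 * N)\<^sup>2) = 2 / N\<^sup>2" for N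
        using e by (simp add: power_mult_distrib power2_eq_square)
      then show ?thesis unfolding eq .
    qed
    have gen: "\<bar>e\<bar> ^ 2 *\<^sub>R (F * of_real X) = F * of_real (e\<^sup>2 * X)" for F :: complex and X
      by (simp add: scaleR_conv_of_real)
    show "\<bar>e\<bar> ^ 2 *\<^sub>R (f (c + e *\<^sub>R p) * of_real (2 * e\<^sup>2 / ((norm (cplx (e *\<^sub>R p)))\<^sup>2 + e\<^sup>2)\<^sup>2))
       = 2 * (f (c + e *\<^sub>R p) / of_real ((1 + (norm (cplx p))\<^sup>2)\<^sup>2))"
      unfolding gen sc by simp
  qed
  also have "(LINT p|lborel. 2 * (f (c + e *\<^sub>R p) / of_real ((1 + (norm (cplx p))\<^sup>2)\<^sup>2)))
      = 2 * (LINT p|lborel. f (c + e *\<^sub>R p) / of_real ((1 + (norm (cplx p))\<^sup>2)\<^sup>2))"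
    by (rule integral_mult_right_zero)
  finally have "(LINT p|lborel. dbar p * reg_kernel e (p - c)) +
      2 * (LINT p|lborel. f (c + e *\<^sub>R p) / of_real ((1 + (norm (cplx p))\<^sup>2)\<^sup>2)) = 0" by (rule sym)
  then show ?thesis unfolding add_eq_0_iff2 by simp
qed

text \<open>The limit of the regularized identity by dominated convergence: on the left the Cauchy
  kernel dominates, on the right a multiple of the bump.\<close>

lemma Pompeiu: "(LINT p|lborel. dbar p * inverse (cplx (p - c))) = - 2 * of_real bump_mass * f c"
proof -
  obtain C where C: "\<And>c. integrable lborel (\<lambda>p. norm (dbar p) * inverse (norm (cplx (p - c))))"
    by (rule dbar_dominated) (rule that)
  have m: "dbar \<in> borel_measurable borel" "f \<in> borel_measurable borel"
    by (intro borel_measurable_continuous_onI cont_dbar cont)+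
  have mk: "reg_kernel e \<in> borel_measurable borel" for e
    unfolding reg_kernel_def
    by (intro borel_measurable_divide borel_measurable_continuous_onI continuous_intros)
  have 1: "(\<lambda>n. LINT p|lborel. dbar p * reg_kernel (1 / real (Suc n)) (p - c))
      \<longlonglongrightarrow> (LINT p|lborel. dbar p * inverse (cplx (p - c)))"
  proof (rule integral_dominated_convergence)
    show "integrable lborel (\<lambda>p. norm (dbar p) * inverse (norm (cplx (p - c))))" by (rule C)
    show "(\<lambda>p. dbar p * inverse (cplx (p - c))) \<in> borel_measurable lborel" using m by measurable
    show "(\<lambda>p. dbar p * reg_kernel (1 / real (Suc n)) (p - c)) \<in> borel_measurable lborel" for n
      using m mk by measurable
    show "AE p in lborel. (\<lambda>n. dbar p * reg_kernel (1 / real (Suc n)) (p - c)) \<longlonglongrightarrow> dbar p * inverse (cplx (p - c))"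
      by (intro AE_I2 tendsto_mult tendsto_const reg_kernel_tendsto)
    show "AE p in lborel. norm (dbar p * reg_kernel (1 / real (Suc n)) (p - c)) \<le> norm (dbar p) * inverse (norm (cplx (p - c)))" for n
      by (intro AE_I2) (simp only: norm_mult, intro mult_left_mono norm_reg_kernel_le norm_ge_zero)
  qed
  obtain B where B: "B \<ge> 0" "\<And>p. norm (f p) \<le> B"
    by (rule bounded_of_cont[OF cont(1)]) (use supp in \<open>auto intro: that\<close>)
  have 2: "(\<lambda>n. LINT p|lborel. f (c + (1 / real (Suc n)) *\<^sub>R p) / of_real ((1 + (norm (cplx p))\<^sup>2)\<^sup>2))
      \<longlonglongrightarrow> (LINT p|lborel. f c / of_real ((1 + (norm (cplx p))\<^sup>2)\<^sup>2))"
  proof (rule integral_dominated_convergence)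
    show "integrable lborel (\<lambda>p. B * (1 / (1 + (norm (cplx p))\<^sup>2)\<^sup>2))"
      by (intro integrable_mult_right integrable_bump)
    show "(\<lambda>p. f c / of_real ((1 + (norm (cplx p))\<^sup>2)\<^sup>2)) \<in> borel_measurable lborel" by measurable
    show "(\<lambda>p. f (c + (1 / real (Suc n)) *\<^sub>R p) / of_real ((1 + (norm (cplx p))\<^sup>2)\<^sup>2)) \<in> borel_measurable lborel" for n
      using m by measurable
    show "AE p in lborel. norm (f (c + (1 / real (Suc n)) *\<^sub>R p) / of_real ((1 + (norm (cplx p))\<^sup>2)\<^sup>2)) \<le> B * (1 / (1 + (norm (cplx p))\<^sup>2)\<^sup>2)" for n
      using B by (intro AE_I2) (simp add: norm_divide divide_right_mono del: of_real_add of_real_power of_real_1)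
    show "AE p in lborel. (\<lambda>n. f (c + (1 / real (Suc n)) *\<^sub>R p) / of_real ((1 + (norm (cplx p))\<^sup>2)\<^sup>2)) \<longlonglongrightarrow> f c / of_real ((1 + (norm (cplx p))\<^sup>2)\<^sup>2)"
    proof (rule AE_I2)
      fix p :: "real \<times> real"
      have fc: "isCont f c" using cont(1) unfolding continuous_on_eq_continuous_at[OF open_UNIV] by blast
      have "(\<lambda>n. c + (1 / real (Suc n)) *\<^sub>R p) \<longlonglongrightarrow> c + 0 *\<^sub>R p"
        by (intro tendsto_intros LIMSEQ_inverse_real_of_nat[unfolded inverse_eq_divide])
      then have "(\<lambda>n. f (c + (1 / real (Suc n)) *\<^sub>R p)) \<longlonglongrightarrow> f c"
        using isCont_tendsto_compose[OF fc, of "\<lambda>n. c + (1 / real (Suc n)) *\<^sub>R p" sequentially] by simp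
      then show "(\<lambda>n. f (c + (1 / real (Suc n)) *\<^sub>R p) / of_real ((1 + (norm (cplx p))\<^sup>2)\<^sup>2)) \<longlonglongrightarrow> f c / of_real ((1 + (norm (cplx p))\<^sup>2)\<^sup>2)"
        by (intro tendsto_divide tendsto_const) (auto simp: add_nonneg_eq_0_iff simp flip: of_real_power of_real_add)
    qed
  qed
  have "(\<lambda>n. LINT p|lborel. dbar p * reg_kernel (1 / real (Suc n)) (p - c))
      \<longlonglongrightarrow> - 2 * (LINT p|lborel. f c / of_real ((1 + (norm (cplx p))\<^sup>2)\<^sup>2))"
    using tendsto_mult_left[OF 2, of "- 2"] by (simp add: Pompeiu_regularized)
  then have "(LINT p|lborel. dbar p * inverse (cplx (p - c))) = - 2 * (LINT p|lborel. f c / of_real ((1 + (norm (cplx p))\<^sup>2)\<^sup>2))"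
    using 1 LIMSEQ_unique by blast
  also have "(LINT p|lborel. f c / of_real ((1 + (norm (cplx p))\<^sup>2)\<^sup>2)) = f c * (LINT p|lborel. complex_of_real (1 / (1 + (norm (cplx p))\<^sup>2)\<^sup>2))"
    by (subst integral_mult_right_zero[symmetric]) simp
  also have "(LINT p|lborel. complex_of_real (1 / (1 + (norm (cplx p))\<^sup>2)\<^sup>2)) = of_real bump_mass"
    unfolding bump_mass_def by (rule integral_of_real[OF integrable_bump])
  finally show ?thesis by simp
qed

end

section \<open>From curve integrals to area integrals\<close>

context C1_compact_support
begin

text \<open>The Pompeiu formula at each point \<open>P t\<close>, integrated against
  \<open>Q\<close>, with the order of integration exchanged. Joint integrability comes from the
  kernel bound that is uniform in the pole. The reversed difference
  \<open>cplx (P t) - cplx p\<close> accounts for the change of sign.\<close>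

lemma curve_integral_eq_area_integral:
  fixes P :: "real \<Rightarrow> real \<times> real" and Q :: "real \<Rightarrow> complex"
  assumes P: "continuous_on {\<alpha>..\<beta>} P" and Q: "continuous_on {\<alpha>..\<beta>} Q"
  shows "2 * of_real bump_mass * integral {\<alpha>..\<beta>} (\<lambda>t. f (P t) * Q t)
     = (LINT p|lborel. dbar p * (LINT t:{\<alpha>..\<beta>}|lborel. Q t / (cplx (P t) - cplx p)))"
    and "integrable lborel (\<lambda>p. dbar p * (LINT t:{\<alpha>..\<beta>}|lborel. Q t / (cplx (P t) - cplx p)))"
proof -
  \<comment> \<open>Extension by zero makes the curve data Borel functions on the whole line, as
    measurability on the product space requires.\<close>
  define P0 where "P0 t = indicator {\<alpha>..\<beta>} t *\<^sub>R P t" for t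
  define Q0 where "Q0 t = indicator {\<alpha>..\<beta>} t *\<^sub>R Q t" for t
  have m [measurable]: "P0 \<in> borel_measurable borel" "Q0 \<in> borel_measurable borel"
    unfolding P0_def Q0_def by (intro borel_measurable_continuous_on_indicator P Q; simp)+
  have d [measurable]: "dbar \<in> borel_measurable borel"
    by (rule borel_measurable_continuous_onI[OF cont_dbar])
  define F where "F t p = dbar p * (Q0 t * inverse (cplx (p - P0 t)))" for t p
  have mF: "case_prod F \<in> borel_measurable (lborel \<Otimes>\<^sub>M lborel)"
    unfolding F_def by measurable
  obtain C where C: "C \<ge> 0" "\<And>c. integrable lborel (\<lambda>p. norm (dbar p) * inverse (norm (cplx (p - c))))"
    "\<And>c. (LINT p|lborel. norm (dbar p) * inverse (norm (cplx (p - c)))) \<le> C"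
    by (rule dbar_dominated) (rule that)
  have nF: "norm (F t p) = norm (Q0 t) * (norm (dbar p) * inverse (norm (cplx (p - P0 t))))" for t p
    by (simp add: F_def norm_mult norm_inverse)
  have i2: "integrable lborel (F t)" for t
  proof (rule Bochner_Integration.integrable_bound)
    show "integrable lborel (\<lambda>p. norm (Q0 t) * (norm (dbar p) * inverse (norm (cplx (p - P0 t)))))"
      by (intro integrable_mult_right C)
    show "F t \<in> borel_measurable lborel" unfolding F_def by measurable
  qed (simp add: nF)
  have iQ: "integrable lborel (\<lambda>t. norm (Q0 t))"
    unfolding Q0_def using borel_integrable_atLeastAtMost'[OF Q]
    by (intro integrable_norm) (simp add: set_integrable_def)
  have i1: "integrable lborel (\<lambda>t. LINT p|lborel. norm (F t p))"
  proof (rule Bochner_Integration.integrable_bound)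
    show "integrable lborel (\<lambda>t. norm (Q0 t) * C)" by (intro integrable_mult_left iQ)
    have "(\<lambda>(t, p). norm (F t p)) \<in> borel_measurable (lborel \<Otimes>\<^sub>M lborel)"
      using mF by measurable
    then show "(\<lambda>t. LINT p|lborel. norm (F t p)) \<in> borel_measurable lborel"
      by (rule lborel.borel_measurable_lebesgue_integral)
    show "AE t in lborel. norm (LINT p|lborel. norm (F t p)) \<le> norm (norm (Q0 t) * C)"
    proof (rule AE_I2)
      fix t
      have "(LINT p|lborel. norm (F t p)) = norm (Q0 t) * (LINT p|lborel. norm (dbar p) * inverse (norm (cplx (p - P0 t))))"
        unfolding nF by (rule integral_mult_right_zero)
      also have "\<dots> \<le> norm (Q0 t) * C" by (intro mult_left_mono C) auto
      finally show "norm (LINT p|lborel. norm (F t p)) \<le> norm (norm (Q0 t) * C)"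
        using C(1) by (simp add: integral_nonneg_AE)
    qed
  qed
  have iF: "integrable (lborel \<Otimes>\<^sub>M lborel) (case_prod F)"
    by (rule lborel_pair.Fubini_integrable[OF mF]) (use i1 i2 in auto)
  have J: "(LINT t|lborel. F t p) = - (dbar p * (LINT t:{\<alpha>..\<beta>}|lborel. Q t / (cplx (P t) - cplx p)))" for p
  proof -
    have "F t p = - dbar p * (indicator {\<alpha>..\<beta>} t *\<^sub>R (Q t / (cplx (P t) - cplx p)))" for t
    proof (cases "t \<in> {\<alpha>..\<beta>}")
      case True
      have "inverse (cplx p - cplx (P t)) = - inverse (cplx (P t) - cplx p)"
        by (metis inverse_minus_eq minus_diff_eq)
      then show ?thesis using True by (simp add: F_def P0_def Q0_def cplx_diff divide_inverse)
    qed (simp add: F_def Q0_def)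
    then have "(LINT t|lborel. F t p) = (LINT t|lborel. - dbar p * (indicator {\<alpha>..\<beta>} t *\<^sub>R (Q t / (cplx (P t) - cplx p))))"
      by simp
    also have "\<dots> = - dbar p * (LINT t:{\<alpha>..\<beta>}|lborel. Q t / (cplx (P t) - cplx p))"
      unfolding set_lebesgue_integral_def by (rule integral_mult_right_zero)
    finally show ?thesis by simp
  qed
  have I: "(LINT p|lborel. F t p) = (- 2 * of_real bump_mass) * (indicator {\<alpha>..\<beta>} t *\<^sub>R (f (P t) * Q t))" for t
  proof -
    have "(LINT p|lborel. F t p) = (LINT p|lborel. Q0 t * (dbar p * inverse (cplx (p - P0 t))))"
      by (simp add: F_def mult_ac)
    also have "\<dots> = Q0 t * (- 2 * of_real bump_mass * f (P0 t))"
      unfolding Pompeiu[symmetric] by (rule integral_mult_right_zero)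
    finally show ?thesis by (cases "t \<in> {\<alpha>..\<beta>}") (auto simp: Q0_def P0_def)
  qed
  have fP: "continuous_on {\<alpha>..\<beta>} (\<lambda>t. f (P t) * Q t)"
    by (intro continuous_on_mult continuous_on_compose2[OF cont(1) P] Q) auto
  have "(LINT t|lborel. LINT p|lborel. F t p) =
      (- 2 * of_real bump_mass) * (LINT t:{\<alpha>..\<beta>}|lborel. f (P t) * Q t)"
    unfolding I set_lebesgue_integral_def by (rule integral_mult_right_zero)
  also have "(LINT t:{\<alpha>..\<beta>}|lborel. f (P t) * Q t) = integral {\<alpha>..\<beta>} (\<lambda>t. f (P t) * Q t)"
    by (rule set_borel_integral_eq_integral(2)[OF borel_integrable_atLeastAtMost'[OF fP]])
  also have "(LINT t|lborel. LINT p|lborel. F t p) = (LINT p|lborel. LINT t|lborel. F t p)"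
    by (rule lborel_pair.Fubini_integral[OF iF, symmetric])
  finally show "2 * of_real bump_mass * integral {\<alpha>..\<beta>} (\<lambda>t. f (P t) * Q t)
     = (LINT p|lborel. dbar p * (LINT t:{\<alpha>..\<beta>}|lborel. Q t / (cplx (P t) - cplx p)))"
    unfolding J by (simp add: minus_equation_iff)
  have "integrable lborel (\<lambda>p. LINT t|lborel. F t p)" by (rule lborel_pair.integrable_snd[OF iF])
  then show "integrable lborel (\<lambda>p. dbar p * (LINT t:{\<alpha>..\<beta>}|lborel. Q t / (cplx (P t) - cplx p)))"
    unfolding J by simp
qed

text \<open>When \<open>Q\<close> is the velocity of \<open>P\<close>, the inner integral is the
  winding integral, and its values off the negligible curve determine the area integral. With
  \<open>bump_mass\<close> equal to pi this is the complex Green formula: the integral of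
  \<open>f dz\<close> over the curve is \<open>i\<close> times that of \<open>dbar\<close> over
  \<open>D\<close>.\<close>

lemma Green_dbar:
  fixes P :: "real \<Rightarrow> real \<times> real" and Q :: "real \<Rightarrow> complex"
  assumes P: "continuous_on {\<alpha>..\<beta>} P" and Q: "continuous_on {\<alpha>..\<beta>} Q"
    and null: "negligible (P ` {\<alpha>..\<beta>})" and D: "open D"
    and w: "\<And>p. p \<notin> P ` {\<alpha>..\<beta>} \<Longrightarrow>
      integral {\<alpha>..\<beta>} (\<lambda>t. Q t / (cplx (P t) - cplx p)) = 2 * of_real pi * \<i> * indicator D p"
  shows "of_real bump_mass * integral {\<alpha>..\<beta>} (\<lambda>t. f (P t) * Q t)
     = of_real pi * \<i> * (LINT p:D|lborel. dbar p)"
proof -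
  have "closed (P ` {\<alpha>..\<beta>})" using P by (intro compact_imp_closed compact_continuous_image) auto
  then have mi: "P ` {\<alpha>..\<beta>} \<in> sets borel" by (rule borel_closed)
  have "P ` {\<alpha>..\<beta>} \<in> null_sets lebesgue" using null negligible_iff_null_sets by blast
  then have "P ` {\<alpha>..\<beta>} \<in> null_sets lborel" using mi by (auto simp: null_sets_def)
  then have ae: "AE p in lborel. p \<notin> P ` {\<alpha>..\<beta>}" by (rule AE_not_in)
  have "2 * of_real bump_mass * integral {\<alpha>..\<beta>} (\<lambda>t. f (P t) * Q t)
     = (LINT p|lborel. dbar p * (LINT t:{\<alpha>..\<beta>}|lborel. Q t / (cplx (P t) - cplx p)))"
    by (rule curve_integral_eq_area_integral(1)[OF P Q])
  also have "\<dots> = (LINT p|lborel. (2 * of_real pi * \<i>) * (indicator D p *\<^sub>R dbar p))"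
  proof (rule integral_cong_AE)
    show "(\<lambda>p. dbar p * (LINT t:{\<alpha>..\<beta>}|lborel. Q t / (cplx (P t) - cplx p))) \<in> borel_measurable lborel"
      using curve_integral_eq_area_integral(2)[OF P Q] by (rule borel_measurable_integrable)
    have "dbar \<in> borel_measurable lborel"
      using borel_measurable_continuous_onI[OF cont_dbar] by simp
    then show "(\<lambda>p. (2 * of_real pi * \<i>) * (indicator D p *\<^sub>R dbar p)) \<in> borel_measurable lborel"
      using D by (intro borel_measurable_times borel_measurable_const borel_measurable_scaleR
          borel_measurable_indicator) auto
    show "AE p in lborel. dbar p * (LINT t:{\<alpha>..\<beta>}|lborel. Q t / (cplx (P t) - cplx p)) = (2 * of_real pi * \<i>) * (indicator D p *\<^sub>R dbar p)"
      using ae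
    proof eventually_elim
      case (elim p)
      have "continuous_on {\<alpha>..\<beta>} (\<lambda>t. Q t / (cplx (P t) - cplx p))"
        using elim by (intro continuous_intros P Q) (auto simp flip: cplx_diff)
      from set_borel_integral_eq_integral(2)[OF borel_integrable_atLeastAtMost'[OF this]]
      show ?case using w[OF elim] by (simp add: indicator_def)
    qed
  qed
  also have "\<dots> = (2 * of_real pi * \<i>) * (LINT p:D|lborel. dbar p)"
    unfolding set_lebesgue_integral_def by (rule integral_mult_right_zero)
  finally show ?thesis by simp
qed

end

text \<open>The complex formula for \<open>f\<close> and, conjugated back, for its conjugate give
  the two combinations \<open>A1 + i A2\<close> and \<open>A1 - i A2\<close>; the weights
  \<open>d1\<close> and \<open>d2\<close> being real, sum and difference separate the
  coordinates.\<close>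

lemma Green_rectilinear:
  fixes P :: "real \<Rightarrow> real \<times> real" and d1 d2 :: "real \<Rightarrow> real"
  assumes f: "C1_compact_support f fx fy R"
    and P: "continuous_on {\<alpha>..\<beta>} P" and Q: "continuous_on {\<alpha>..\<beta>} d1" "continuous_on {\<alpha>..\<beta>} d2"
    and null: "negligible (P ` {\<alpha>..\<beta>})" and D: "open D"
    and w: "\<And>p. p \<notin> P ` {\<alpha>..\<beta>} \<Longrightarrow>
      integral {\<alpha>..\<beta>} (\<lambda>t. (of_real (d1 t) + \<i> * of_real (d2 t)) / (cplx (P t) - cplx p)) = 2 * of_real pi * \<i> * indicator D p"
  shows "of_real bump_mass * integral {\<alpha>..\<beta>} (\<lambda>t. f (P t) * of_real (d1 t)) = - of_real pi * (LINT p:D|lborel. fy p)"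
    and "of_real bump_mass * integral {\<alpha>..\<beta>} (\<lambda>t. f (P t) * of_real (d2 t)) = of_real pi * (LINT p:D|lborel. fx p)"
proof -
  interpret f: C1_compact_support f fx fy R by (rule f)
  interpret c: C1_compact_support "\<lambda>p. cnj (f p)" "\<lambda>p. cnj (fx p)" "\<lambda>p. cnj (fy p)" R
  proof
    show "((\<lambda>r. cnj (f (r, b))) has_vector_derivative cnj (fx (a, b))) (at a)" for a b
      using bounded_linear.has_vector_derivative[OF bounded_linear_cnj f.dx] .
    show "((\<lambda>r. cnj (f (a, r))) has_vector_derivative cnj (fy (a, b))) (at b)" for a b
      using bounded_linear.has_vector_derivative[OF bounded_linear_cnj f.dy] .
  qed (use f.supp in \<open>auto intro!: continuous_intros f.cont\<close>)
  define Q where "Q t = complex_of_real (d1 t) + \<i> * of_real (d2 t)" for t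
  have cQ: "continuous_on {\<alpha>..\<beta>} Q" unfolding Q_def by (intro continuous_intros assms)
  note G1 = f.Green_dbar[OF P cQ null D w[folded Q_def]]
  note G2 = c.Green_dbar[OF P cQ null D w[folded Q_def]]
  have cf: "continuous_on {\<alpha>..\<beta>} (\<lambda>t. f (P t))"
    by (rule continuous_on_compose2[OF f.cont(1) P]) auto
  define A1 where "A1 = integral {\<alpha>..\<beta>} (\<lambda>t. f (P t) * of_real (d1 t))"
  define A2 where "A2 = integral {\<alpha>..\<beta>} (\<lambda>t. f (P t) * of_real (d2 t))"
  define Bx where "Bx = (LINT p:D|lborel. fx p)"
  define By where "By = (LINT p:D|lborel. fy p)"
  have A1: "((\<lambda>t. f (P t) * of_real (d1 t)) has_integral A1) {\<alpha>..\<beta>}"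
    and A2: "((\<lambda>t. f (P t) * of_real (d2 t)) has_integral A2) {\<alpha>..\<beta>}"
    unfolding A1_def A2_def
    by (intro integrable_integral integrable_continuous_interval continuous_intros cf assms)+
  have "((\<lambda>t. f (P t) * Q t) has_integral (A1 + \<i> * A2)) {\<alpha>..\<beta>}"
    using has_integral_add[OF A1 has_integral_mult_right[OF A2, of \<i>]] by (simp add: Q_def algebra_simps)
  then have I1: "integral {\<alpha>..\<beta>} (\<lambda>t. f (P t) * Q t) = A1 + \<i> * A2" by (rule integral_unique)
  have "((\<lambda>t. cnj (f (P t)) * Q t) has_integral (cnj A1 + \<i> * cnj A2)) {\<alpha>..\<beta>}"
    using has_integral_add[OF has_integral_linear[OF A1 bounded_linear_cnj]
        has_integral_mult_right[OF has_integral_linear[OF A2 bounded_linear_cnj], of \<i>]]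
    by (simp add: Q_def algebra_simps o_def)
  then have I2: "integral {\<alpha>..\<beta>} (\<lambda>t. cnj (f (P t)) * Q t) = cnj A1 + \<i> * cnj A2" by (rule integral_unique)
  have int: "set_integrable lborel D h" if "continuous_on UNIV h" "\<And>p. p \<notin> cbox (- R, - R) (R, R) \<Longrightarrow> h p = 0"
    for h :: "real \<times> real \<Rightarrow> complex"
    unfolding set_integrable_def
    by (rule integrable_mult_indicator) (use D integrable_continuous_compact_support[OF that] in auto)
  have ix: "set_integrable lborel D fx" "set_integrable lborel D fy"
    by (rule int; use f.cont f.supp in simp)+
  have ic: "set_integrable lborel D (\<lambda>p. \<i> * fy p)" "set_integrable lborel D (\<lambda>p. cnj (fx p))"
    "set_integrable lborel D (\<lambda>p. \<i> * cnj (fy p))"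
    by (rule int; use f.supp in \<open>simp add: continuous_intros f.cont\<close>)+
  have D1: "(LINT p:D|lborel. f.dbar p) = Bx + \<i> * By"
    unfolding f.dbar_def Bx_def By_def using set_integral_add(2)[OF ix(1) ic(1)] by simp
  have lc: "(LINT p:D|lborel. cnj (h p)) = cnj (LINT p:D|lborel. h p)" for h
  proof -
    have "(\<lambda>p. indicator D p *\<^sub>R cnj (h p)) = (\<lambda>p. cnj (indicator D p *\<^sub>R h p))" by simp
    then show ?thesis unfolding set_lebesgue_integral_def by (simp only: Bochner_Integration.integral_cnj)
  qed
  have D2: "(LINT p:D|lborel. c.dbar p) = cnj Bx + \<i> * cnj By"
    unfolding c.dbar_def Bx_def By_def using set_integral_add(2)[OF ic(2,3)] by (simp add: lc)
  have e1: "of_real bump_mass * (A1 + \<i> * A2) = of_real pi * \<i> * (Bx + \<i> * By)"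
    using G1 by (simp add: I1 D1)
  have "of_real bump_mass * (cnj A1 + \<i> * cnj A2) = of_real pi * \<i> * (cnj Bx + \<i> * cnj By)"
    using G2 by (simp add: I2 D2)
  from arg_cong[OF this, of cnj] have e2: "of_real bump_mass * (A1 - \<i> * A2) = - of_real pi * \<i> * (Bx - \<i> * By)"
    by simp
  have "2 * (of_real bump_mass * A1) = of_real bump_mass * (A1 + \<i> * A2) + of_real bump_mass * (A1 - \<i> * A2)"
    by (simp add: algebra_simps)
  also have "\<dots> = 2 * (- of_real pi * By)" unfolding e1 e2 by (simp add: algebra_simps)
  finally show "of_real bump_mass * A1 = - of_real pi * By"
    by (rule iffD1[OF mult_left_cancel, rotated]) simp
  have "2 * \<i> * (of_real bump_mass * A2) = of_real bump_mass * (A1 + \<i> * A2) - of_real bump_mass * (A1 - \<i> * A2)"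
    by (simp add: algebra_simps)
  also have "\<dots> = 2 * \<i> * (of_real pi * Bx)" unfolding e1 e2 by (simp add: algebra_simps)
  finally show "of_real bump_mass * A2 = of_real pi * Bx"
    by (rule iffD1[OF mult_left_cancel, rotated]) simp
qed

section \<open>Test functions and nonscattering waves\<close>

text \<open>The test functions used are products \<open>a(x) b(y)\<close>, so smoothness is
  developed in one variable. With a witness for each derivative instead of \<open>deriv\<close>,
  closure under sums and products is a plain induction.\<close>

fun Cn :: "nat \<Rightarrow> (real \<Rightarrow> real) \<Rightarrow> bool" where
  "Cn 0 h \<longleftrightarrow> continuous_on UNIV h"
| "Cn (Suc n) h \<longleftrightarrow> (\<exists>h'. (\<forall>x. (h has_real_derivative h' x) (at x)) \<and> Cn n h')"

declare Cn.simps(2) [simp del]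

lemma Cn_SucI: "(\<And>x. (h has_real_derivative h' x) (at x)) \<Longrightarrow> Cn n h' \<Longrightarrow> Cn (Suc n) h"
  unfolding Cn.simps by blast

lemma Cn_SucE:
  assumes "Cn (Suc n) h"
  obtains h' where "\<And>x. (h has_real_derivative h' x) (at x)" "Cn n h'"
  using assms unfolding Cn.simps by blast

lemma Cn_continuous: "Cn n h \<Longrightarrow> continuous_on UNIV h"
proof (cases n)
  case (Suc m)
  assume "Cn n h"
  then show ?thesis unfolding Suc
    by (rule Cn_SucE) (blast intro: DERIV_isCont continuous_at_imp_continuous_on)
qed simp

lemma Cn_Suc_imp: "Cn (Suc n) h \<Longrightarrow> Cn n h"
proof (induction n arbitrary: h)
  case 0
  then show ?case using Cn_continuous[of "Suc 0" h] by simp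
next
  case (Suc n)
  obtain h' where h: "\<And>x. (h has_real_derivative h' x) (at x)" "Cn (Suc n) h'"
    using Suc.prems by (rule Cn_SucE) (rule that)
  show ?case by (rule Cn_SucI[OF h(1) Suc.IH[OF h(2)]])
qed

lemma Cn_add: "Cn n h \<Longrightarrow> Cn n k \<Longrightarrow> Cn n (\<lambda>x. h x + k x)"
proof (induction n arbitrary: h k)
  case 0
  then show ?case by (auto intro: continuous_intros)
next
  case (Suc n)
  obtain h' where h: "\<And>x. (h has_real_derivative h' x) (at x)" "Cn n h'"
    using Suc.prems(1) by (rule Cn_SucE) (rule that)
  obtain k' where k: "\<And>x. (k has_real_derivative k' x) (at x)" "Cn n k'"
    using Suc.prems(2) by (rule Cn_SucE) (rule that)
  show ?case by (rule Cn_SucI[OF DERIV_add[OF h(1) k(1)] Suc.IH[OF h(2) k(2)]])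
qed

lemma Cn_mult: "Cn n h \<Longrightarrow> Cn n k \<Longrightarrow> Cn n (\<lambda>x. h x * k x)"
proof (induction n arbitrary: h k)
  case 0
  then show ?case by (auto intro: continuous_intros)
next
  case (Suc n)
  obtain h' where h: "\<And>x. (h has_real_derivative h' x) (at x)" "Cn n h'"
    using Suc.prems(1) by (rule Cn_SucE) (rule that)
  obtain k' where k: "\<And>x. (k has_real_derivative k' x) (at x)" "Cn n k'"
    using Suc.prems(2) by (rule Cn_SucE) (rule that)
  have "Cn n (\<lambda>x. h' x * k x + k' x * h x)"
    by (rule Cn_add[OF Suc.IH[OF h(2) Cn_Suc_imp[OF Suc.prems(2)]] Suc.IH[OF k(2) Cn_Suc_imp[OF Suc.prems(1)]]])
  then show ?case by (rule Cn_SucI[OF DERIV_mult[OF h(1) k(1)]])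
qed

lemma Cn_const: "Cn n (\<lambda>x. c)"
proof (induction n arbitrary: c)
  case (Suc n)
  show ?case by (rule Cn_SucI[OF DERIV_const Suc])
qed (auto intro!: continuous_intros)

lemma Cn_affine: "Cn n h \<Longrightarrow> Cn n (\<lambda>x. h (a + b * x))"
proof (induction n arbitrary: h)
  case 0
  then show ?case by (auto intro!: continuous_on_compose2[of UNIV h] continuous_intros)
next
  case (Suc n)
  obtain h' where h: "\<And>x. (h has_real_derivative h' x) (at x)" "Cn n h'"
    using Suc.prems by (rule Cn_SucE) (rule that)
  have d: "((\<lambda>x. h (a + b * x)) has_real_derivative h' (a + b * x) * b) (at x)" for x
    by (rule DERIV_chain2[where g = "\<lambda>x. a + b * x"]) (use h in \<open>auto intro!: derivative_eq_intros\<close>)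
  have "Cn n (\<lambda>x. h' (a + b * x) * b)" by (rule Cn_mult[OF Suc.IH[OF h(2)] Cn_const])
  with d show ?case by (rule Cn_SucI)
qed

lemma Cn_exp: "Cn n (\<lambda>x. c * exp (l * x))"
proof (induction n arbitrary: c)
  case (Suc n)
  have "((\<lambda>x. c * exp (l * x)) has_real_derivative (c * l) * exp (l * x)) (at x)" for x
    by (auto intro!: derivative_eq_intros)
  then show ?case by (rule Cn_SucI) (rule Suc)
qed (auto intro!: continuous_intros)

text \<open>The free phase \<open>d\<close> keeps the family closed under differentiation, each
  derivative shifting it by \<open>pi / 2\<close>; it also supplies cosine and sine at once.\<close>

lemma Cn_cos: "Cn n (\<lambda>x. c * cos (d + l * x))"
proof (induction n arbitrary: c d)
  case (Suc n)
  have "((\<lambda>x. c * cos (d + l * x)) has_real_derivative (c * l) * cos (d + pi / 2 + l * x)) (at x)" for x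
  proof -
    have "cos (d + pi / 2 + l * x) = - sin (d + l * x)"
      using cos_add[of "d + l * x" "pi / 2"] by (simp add: add_ac)
    then show ?thesis by (auto intro!: derivative_eq_intros)
  qed
  then show ?case by (rule Cn_SucI) (rule Suc)
qed (auto intro!: continuous_intros)

text \<open>The functions \<open>p(1/x) exp(-1/x)\<close>, extended by zero, form a family closed
  under differentiation: in \<open>y = 1/x\<close> the polynomial \<open>p\<close> becomes
  \<open>y^2 (p - p')\<close>. Smoothness at 0 follows by induction over all \<open>p\<close> at
  once.\<close>

definition flat :: "real poly \<Rightarrow> real \<Rightarrow> real" where
  "flat p x = (if x > 0 then poly p (inverse x) * exp (- inverse x) else 0)"

lemma poly_exp_decay: "((\<lambda>y::real. poly p y * exp (- y)) \<longlongrightarrow> 0) at_top"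
proof -
  have 1: "((\<lambda>y::real. y ^ n * exp (- y)) \<longlongrightarrow> 0) at_top" for n
    using tendsto_power_div_exp_0[of n] by (simp add: exp_minus divide_inverse)
  have "((\<lambda>y. \<Sum>i\<le>degree p. coeff p i * (y ^ i * exp (- y))) \<longlongrightarrow> (\<Sum>i\<le>degree p. coeff p i * 0)) at_top"
    by (intro tendsto_intros 1)
  then show ?thesis by (simp add: poly_altdef sum_distrib_right mult.assoc)
qed

lemma flat_deriv: "(flat p has_real_derivative flat ([:0, 0, 1:] * (p - pderiv p)) x) (at x)"
proof (cases "x > 0" "x < 0" rule: bool.exhaust[case_product bool.exhaust])
  case True_True
  then show ?thesis by simp
next
  case True_False
  have "((\<lambda>x. poly p (inverse x) * exp (- inverse x)) has_real_derivative flat ([:0, 0, 1:] * (p - pderiv p)) x) (at x)"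
    using True_False
    by (auto intro!: derivative_eq_intros simp: flat_def algebra_simps power2_eq_square)
  then show ?thesis
    by (rule has_field_derivative_transform_within_open[of _ _ _ "{0<..}"]) (use True_False in \<open>auto simp: flat_def\<close>)
next
  case False_True
  have "((\<lambda>x. 0) has_real_derivative flat ([:0, 0, 1:] * (p - pderiv p)) x) (at x)"
    using False_True by (simp add: flat_def)
  then show ?thesis
    by (rule has_field_derivative_transform_within_open[of _ _ _ "{..<0}"]) (use False_True in \<open>auto simp: flat_def\<close>)
next
  case False_False
  then have x: "x = 0" by simp
  have "((\<lambda>y. flat p y / y) \<longlongrightarrow> 0) (at_right 0)"
  proof -
    have "((\<lambda>y. poly (pCons 0 p) (inverse y) * exp (- inverse y)) \<longlongrightarrow> 0) (at_right (0::real))"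
      by (rule filterlim_compose[OF poly_exp_decay filterlim_inverse_at_top_right])
    then show ?thesis
      by (rule Lim_transform_eventually)
         (auto simp: eventually_at_filter flat_def divide_inverse mult_ac)
  qed
  moreover have "((\<lambda>y. flat p y / y) \<longlongrightarrow> 0) (at_left 0)"
    by (rule Lim_transform_eventually[OF tendsto_const]) (auto simp: eventually_at_filter flat_def)
  ultimately have "((\<lambda>y. flat p y / y) \<longlongrightarrow> 0) (at 0)" by (intro filterlim_split_at)
  then show ?thesis by (simp add: x has_field_derivative_iff flat_def)
qed

lemma Cn_flat: "Cn n (flat p)"
proof (induction n arbitrary: p)
  case 0
  show ?case by (auto intro!: continuous_at_imp_continuous_on DERIV_isCont[OF flat_deriv])
next
  case (Suc n)
  show ?case by (rule Cn_SucI[OF flat_deriv Suc])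
qed

text \<open>The normalized antiderivative of the bump \<open>b\<close>, which is positive on (0, 1)
  and zero elsewhere.\<close>

lemma smooth_step:
  obtains S :: "real \<Rightarrow> real" where "\<And>n. Cn n S" "\<And>x. x \<le> 0 \<Longrightarrow> S x = 0" "\<And>x. x \<ge> 1 \<Longrightarrow> S x = 1"
proof -
  define b where "b x = flat 1 x * flat 1 (1 + (-1) * x)" for x
  have bn: "Cn n b" for n unfolding b_def by (rule Cn_mult[OF Cn_flat Cn_affine[OF Cn_flat]])
  have bc: "continuous_on UNIV b" by (rule Cn_continuous[OF bn])
  have b0: "b x = 0" if "x \<le> 0 \<or> x \<ge> 1" for x using that by (auto simp: b_def flat_def)
  have bp: "b x > 0" if "0 < x" "x < 1" for x using that by (simp add: b_def flat_def)
  obtain B where B: "\<And>x. (B has_real_derivative b x) (at x)"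
  proof -
    have "\<exists>F. \<forall>x::real. - \<infinity> < x \<longrightarrow> x < \<infinity> \<longrightarrow> (F has_vector_derivative b x) (at x)"
      by (rule einterval_antiderivative)
         (use bc continuous_on_eq_continuous_at[OF open_UNIV, of b] in auto)
    then show thesis using that by (auto simp: has_real_derivative_iff_has_vector_derivative)
  qed
  have Bc: "B x = B y" if "(x < y \<and> y \<le> 0) \<or> (x \<ge> 1 \<and> x < y)" for x y
  proof -
    have "x < y" using that by auto
    from MVT2[OF this, of B b] B obtain z where "x < z" "z < y" "B y - B x = (y - x) * b z"
      by blast
    then show ?thesis using b0[of z] that by auto
  qed
  have "B 0 < B 1"
  proof -
    have "continuous_on {0..1} B" using B DERIV_isCont continuous_at_imp_continuous_on by blast
    then show ?thesis using B bp by (intro DERIV_pos_imp_increasing_open[of 0 1 B]) auto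
  qed
  have Bn: "Cn n B" for n
    by (rule Cn_Suc_imp[OF Cn_SucI[OF B bn]])
  show thesis
  proof (rule that[of "\<lambda>x. (B x + - B 0) * (1 / (B 1 - B 0))"])
    show "Cn n (\<lambda>x. (B x + - B 0) * (1 / (B 1 - B 0)))" for n
      by (rule Cn_mult[OF Cn_add[OF Bn Cn_const] Cn_const])
    show "(B x + - B 0) * (1 / (B 1 - B 0)) = 0" if "x \<le> 0" for x
      using Bc[of x 0] that by (cases "x = 0") auto
    show "(B x + - B 0) * (1 / (B 1 - B 0)) = 1" if "x \<ge> 1" for x
      using Bc[of 1 x] that \<open>B 0 < B 1\<close> by (cases "x = 1") auto
  qed
qed

section \<open>Product test functions and the weak equation\<close>

lemma has_derivative_prod_fun:
  fixes a b :: "real \<Rightarrow> real"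
  assumes "(a has_real_derivative a') (at (fst p))" "(b has_real_derivative b') (at (snd p))"
  shows "((\<lambda>p. a (fst p) * b (snd p)) has_derivative (\<lambda>h. a' * fst h * b (snd p) + a (fst p) * (b' * snd h))) (at p)"
proof -
  have "((\<lambda>p. a (fst p)) has_derivative (\<lambda>h. a' * fst h)) (at p)"
    using has_derivative_compose[OF has_derivative_fst[OF has_derivative_ident] assms(1)[unfolded has_field_derivative_def]] by simp
  moreover have "((\<lambda>p. b (snd p)) has_derivative (\<lambda>h. b' * snd h)) (at p)"
    using has_derivative_compose[OF has_derivative_snd[OF has_derivative_ident] assms(2)[unfolded has_field_derivative_def]] by simp
  ultimately show ?thesis
    by (auto intro!: derivative_eq_intros)
qed

lemma partial_deriv_prod_fun:
  fixes a b :: "real \<Rightarrow> real"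
  assumes "\<And>x. (a has_real_derivative a' x) (at x)" "\<And>x. (b has_real_derivative b' x) (at x)"
  shows "partial_deriv (1, 0) (\<lambda>p. a (fst p) * b (snd p)) = (\<lambda>p. a' (fst p) * b (snd p))"
    and "partial_deriv (0, 1) (\<lambda>p. a (fst p) * b (snd p)) = (\<lambda>p. a (fst p) * b' (snd p))"
  unfolding frechet_derivative_at[OF has_derivative_prod_fun[OF assms], symmetric] by auto

lemma C_k_prod_fun: "Cn n a \<Longrightarrow> Cn n b \<Longrightarrow> C_k n (\<lambda>p. a (fst p) * b (snd p))"
proof (induction n arbitrary: a b)
  case 0
  then have "continuous_on UNIV a" "continuous_on UNIV b" by auto
  then show ?case
    by (auto intro!: continuous_intros continuous_on_compose2[of UNIV a] continuous_on_compose2[of UNIV b])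
next
  case (Suc n)
  obtain a' where a: "\<And>x. (a has_real_derivative a' x) (at x)" "Cn n a'"
    using Suc.prems(1) by (rule Cn_SucE) (rule that)
  obtain b' where b: "\<And>x. (b has_real_derivative b' x) (at x)" "Cn n b'"
    using Suc.prems(2) by (rule Cn_SucE) (rule that)
  have "(\<lambda>p. a (fst p) * b (snd p)) differentiable_on UNIV"
    unfolding differentiable_on_def differentiable_def using has_derivative_prod_fun[OF a(1) b(1)] by blast
  moreover have "C_k n (partial_deriv (1, 0) (\<lambda>p. a (fst p) * b (snd p)))"
    unfolding partial_deriv_prod_fun(1)[OF a(1) b(1)] by (rule Suc.IH[OF a(2) Cn_Suc_imp[OF Suc.prems(2)]])
  moreover have "C_k n (partial_deriv (0, 1) (\<lambda>p. a (fst p) * b (snd p)))"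
    unfolding partial_deriv_prod_fun(2)[OF a(1) b(1)] by (rule Suc.IH[OF Cn_Suc_imp[OF Suc.prems(1)] b(2)])
  ultimately show ?case by (auto simp: Basis_prod_def)
qed

lemma test_function_prod_fun:
  assumes "\<And>n. Cn n a" "\<And>n. Cn n b" "\<And>x. \<bar>x\<bar> > M \<Longrightarrow> a x = 0" "\<And>x. \<bar>x\<bar> > M \<Longrightarrow> b x = 0"
  shows "test_function (\<lambda>p. a (fst p) * b (snd p))"
  unfolding test_function_def
proof
  show "\<forall>n. C_k n (\<lambda>p. a (fst p) * b (snd p))" using C_k_prod_fun assms(1,2) by blast
  have "{p. a (fst p) * b (snd p) \<noteq> 0} \<subseteq> cbox (- M, - M) (M, M)"
  proof
    fix p assume "p \<in> {p. a (fst p) * b (snd p) \<noteq> 0}"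
    then have "\<not> \<bar>fst p\<bar> > M" "\<not> \<bar>snd p\<bar> > M" using assms(3,4) by auto
    then show "p \<in> cbox (- M, - M) (M, M)" by (cases p) auto
  qed
  then show "compact (closure {p. a (fst p) * b (snd p) \<noteq> 0})"
    using bounded_subset[OF bounded_cbox] by (simp add: compact_closure)
qed

lemma test_function_continuous: "test_function \<phi> \<Longrightarrow> continuous_on UNIV \<phi>"
  unfolding test_function_def by (metis C_k.simps(1))

lemma test_function_partial:
  assumes "test_function \<phi>" "b \<in> Basis"
  shows "test_function (partial_deriv b \<phi>)"
  unfolding test_function_def
proof
  show "\<forall>n. C_k n (partial_deriv b \<phi>)"
    using assms unfolding test_function_def by (metis C_k.simps(2))
  let ?S = "closure {x. \<phi> x \<noteq> 0}"
  have "partial_deriv b \<phi> x = 0" if "x \<notin> ?S" for x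
  proof -
    have o: "open (- ?S)" by auto
    have "((\<lambda>x. 0) has_derivative (\<lambda>h. 0)) (at x)" by (rule has_derivative_const)
    then have "(\<phi> has_derivative (\<lambda>h. 0)) (at x)"
    proof (rule has_derivative_transform_within_open[OF _ o])
      show "x \<in> - ?S" using that by simp
      show "0 = \<phi> y" if "y \<in> - ?S" for y using that closure_subset[of "{x. \<phi> x \<noteq> 0}"] by auto
    qed
    from frechet_derivative_at[OF this] show ?thesis by (simp add: fun_eq_iff)
  qed
  then have "{x. partial_deriv b \<phi> x \<noteq> 0} \<subseteq> ?S" by blast
  then have "closure {x. partial_deriv b \<phi> x \<noteq> 0} \<subseteq> ?S" by (simp add: closure_minimal)
  moreover have "compact ?S" using assms(1) by (simp add: test_function_def)
  ultimately show "compact (closure {x. partial_deriv b \<phi> x \<noteq> 0})"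
    by (metis closed_closure compact_Int_closed inf.absorb_iff2)
qed

lemma integrable_test_function_L1_loc:
  fixes \<phi> :: "'a::euclidean_space \<Rightarrow> real" and u :: "'a \<Rightarrow> complex"
  assumes \<phi>: "test_function \<phi>" and u: "L1_loc u"
  shows "integrable lebesgue (\<lambda>x. \<phi> x *\<^sub>R u x)"
proof -
  let ?K = "closure {x. \<phi> x \<noteq> 0}"
  have K: "compact ?K" using \<phi> by (simp add: test_function_def)
  have c: "continuous_on UNIV \<phi>" by (rule test_function_continuous[OF \<phi>])
  have i: "integrable lebesgue (\<lambda>x. indicator ?K x *\<^sub>R u x)"
    using u K unfolding L1_loc_def set_integrable_def by blast
  have "compact (\<phi> ` ?K)" using c K by (intro compact_continuous_image) (auto intro: continuous_on_subset)
  then obtain B where B: "B > 0" "\<And>x. x \<in> ?K \<Longrightarrow> \<bar>\<phi> x\<bar> \<le> B"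
    using compact_imp_bounded bounded_pos by (metis imageI real_norm_def)
  have um: "u \<in> borel_measurable lebesgue" using u by (simp add: L1_loc_def)
  have "\<phi> \<in> borel_measurable lebesgue"
    using borel_measurable_continuous_onI[OF c] by (simp add: measurable_completion)
  with um have m: "(\<lambda>x. \<phi> x *\<^sub>R u x) \<in> borel_measurable lebesgue" by measurable
  show ?thesis
  proof (rule Bochner_Integration.integrable_bound[OF integrable_scaleR_right[OF i, of B] m])
    show "AE x in lebesgue. norm (\<phi> x *\<^sub>R u x) \<le> norm (B *\<^sub>R indicator ?K x *\<^sub>R u x)"
    proof (rule AE_I2)
      fix x
      show "norm (\<phi> x *\<^sub>R u x) \<le> norm (B *\<^sub>R indicator ?K x *\<^sub>R u x)"
      proof (cases "x \<in> ?K")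
        case True
        then show ?thesis using B by (auto intro!: mult_right_mono)
      next
        case False
        then have "\<phi> x = 0" using closure_subset[of "{x. \<phi> x \<noteq> 0}"] by auto
        then show ?thesis by simp
      qed
    qed
  qed
qed

lemma weak_laplacian_test_function:
  fixes u w :: "'a::euclidean_space \<Rightarrow> complex"
  assumes lap: "weak_laplacian u w" and \<phi>: "test_function \<phi>"
  shows "(LINT x|lebesgue. \<phi> x *\<^sub>R w x) = (LINT x|lebesgue. laplacian \<phi> x *\<^sub>R u x)"
    and "integrable lebesgue (\<lambda>x. \<phi> x *\<^sub>R w x)" "integrable lebesgue (\<lambda>x. laplacian \<phi> x *\<^sub>R u x)"
    and "integrable lebesgue (\<lambda>x. \<phi> x *\<^sub>R u x)"
proof -
  obtain d dd where d: "\<And>b. b \<in> Basis \<Longrightarrow> weak_partial b u (d b)"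
    and dd: "\<And>b. b \<in> Basis \<Longrightarrow> weak_partial b (d b) (dd b)" and w: "w = (\<lambda>x. \<Sum>b\<in>Basis. dd b x)"
    using lap unfolding weak_laplacian_def by blast
  have L1: "L1_loc u" "L1_loc (dd b)" if "b \<in> Basis" for b
    using d[OF that] dd[OF that] unfolding weak_partial_def by blast+
  have id: "integrable lebesgue (\<lambda>x. \<phi> x *\<^sub>R dd b x)" if "b \<in> Basis" for b
    by (rule integrable_test_function_L1_loc[OF \<phi> L1(2)[OF that]])
  have iu: "integrable lebesgue (\<lambda>x. partial_deriv b (partial_deriv b \<phi>) x *\<^sub>R u x)" if "b \<in> Basis" for b
    by (rule integrable_test_function_L1_loc[OF test_function_partial[OF test_function_partial[OF \<phi> that] that] L1(1)[OF that]])
  show "integrable lebesgue (\<lambda>x. \<phi> x *\<^sub>R u x)"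
    using integrable_test_function_L1_loc[OF \<phi> L1(1)] nonempty_Basis by blast
  show "integrable lebesgue (\<lambda>x. \<phi> x *\<^sub>R w x)"
    unfolding w scaleR_sum_right by (rule Bochner_Integration.integrable_sum[OF id])
  show "integrable lebesgue (\<lambda>x. laplacian \<phi> x *\<^sub>R u x)"
    unfolding laplacian_def scaleR_sum_left by (rule Bochner_Integration.integrable_sum[OF iu])
  have "(LINT x|lebesgue. \<phi> x *\<^sub>R w x) = (\<Sum>b\<in>Basis. LINT x|lebesgue. \<phi> x *\<^sub>R dd b x)"
    unfolding w scaleR_sum_right by (rule Bochner_Integration.integral_sum[OF id])
  also have "\<dots> = (\<Sum>b\<in>Basis. LINT x|lebesgue. partial_deriv b (partial_deriv b \<phi>) x *\<^sub>R u x)"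
  proof (rule sum.cong[OF refl])
    fix b :: 'a assume b: "b \<in> Basis"
    have "(LINT x|lebesgue. partial_deriv b \<phi> x *\<^sub>R d b x) = - (LINT x|lebesgue. \<phi> x *\<^sub>R dd b x)"
      using dd[OF b] \<phi> unfolding weak_partial_def by blast
    moreover have "(LINT x|lebesgue. partial_deriv b (partial_deriv b \<phi>) x *\<^sub>R u x) = - (LINT x|lebesgue. partial_deriv b \<phi> x *\<^sub>R d b x)"
      using d[OF b] test_function_partial[OF \<phi> b] unfolding weak_partial_def by blast
    ultimately show "(LINT x|lebesgue. \<phi> x *\<^sub>R dd b x) = (LINT x|lebesgue. partial_deriv b (partial_deriv b \<phi>) x *\<^sub>R u x)"
      by simp
  qed
  also have "\<dots> = (LINT x|lebesgue. laplacian \<phi> x *\<^sub>R u x)"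
    unfolding laplacian_def scaleR_sum_left by (rule Bochner_Integration.integral_sum[OF iu, symmetric])
  finally show "(LINT x|lebesgue. \<phi> x *\<^sub>R w x) = (LINT x|lebesgue. laplacian \<phi> x *\<^sub>R u x)" .
qed

text \<open>Moving both derivatives to \<open>\<phi>\<close> turns the tested equation into the
  integral of \<open>(\<Delta>\<phi> + k^2 q \<phi>) u\<close>. This integrand vanishes on
  \<open>D\<close> by the equation for \<open>\<phi>\<close> and elsewhere because \<open>u\<close>
  does. That \<open>u\<close> solves the equation weakly on the whole plane and is zero outside
  \<open>D\<close> encodes both boundary conditions, so no boundary term arises.\<close>

lemma nonscattering_orthogonal:
  assumes ns: "nonscattering k q D uin" and D: "open D" and kq: "k \<noteq> 0" "q \<noteq> 1"
    and uin: "continuous_on UNIV uin" and \<phi>: "test_function \<phi>"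
    and eq: "\<And>x. x \<in> D \<Longrightarrow> laplacian \<phi> x + k\<^sup>2 * q * \<phi> x = 0"
  shows "(LINT x:D|lborel. \<phi> x *\<^sub>R uin x) = 0"
proof -
  obtain u w where lap: "weak_laplacian u w" and out: "AE x in lebesgue. x \<notin> D \<longrightarrow> u x = 0"
    and pde: "AE x in lebesgue. w x + of_real (k\<^sup>2 * q) * u x = of_real (k\<^sup>2 * (1 - q)) * uin x * indicator D x"
    using ns unfolding nonscattering_def by blast
  note W = weak_laplacian_test_function[OF lap \<phi>]
  define s where "s = k\<^sup>2 * q"
  define r where "r = k\<^sup>2 * (1 - q)"
  have r: "r \<noteq> 0" using kq by (simp add: r_def)
  have m: "(\<lambda>x. indicator D x *\<^sub>R (\<phi> x *\<^sub>R uin x)) \<in> borel_measurable borel"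
    using D by (intro borel_measurable_scaleR borel_measurable_indicator borel_measurable_continuous_onI
        uin test_function_continuous[OF \<phi>]) auto
  then have ml: "(\<lambda>x. indicator D x *\<^sub>R (\<phi> x *\<^sub>R uin x)) \<in> borel_measurable lebesgue"
    by (simp add: measurable_completion)
  have iw: "integrable lebesgue (\<lambda>x. \<phi> x *\<^sub>R w x + s *\<^sub>R (\<phi> x *\<^sub>R u x))"
    by (intro Bochner_Integration.integrable_add integrable_scaleR_right W)
  have sp: "(LINT x|lebesgue. h x + s *\<^sub>R (\<phi> x *\<^sub>R u x)) =
      (LINT x|lebesgue. h x) + s *\<^sub>R (LINT x|lebesgue. \<phi> x *\<^sub>R u x)"
    if "integrable lebesgue h" for h
    by (simp only: Bochner_Integration.integral_add[OF that integrable_scaleR_right[OF W(4)]]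
        Bochner_Integration.integral_scaleR_right)
  have "r *\<^sub>R (LINT x|lebesgue. indicator D x *\<^sub>R (\<phi> x *\<^sub>R uin x))
      = (LINT x|lebesgue. r *\<^sub>R (indicator D x *\<^sub>R (\<phi> x *\<^sub>R uin x)))"
    by (rule Bochner_Integration.integral_scaleR_right[symmetric])
  also have "\<dots> = (LINT x|lebesgue. \<phi> x *\<^sub>R w x + s *\<^sub>R (\<phi> x *\<^sub>R u x))"
  proof (rule integral_cong_AE)
    show "(\<lambda>x. r *\<^sub>R (indicator D x *\<^sub>R (\<phi> x *\<^sub>R uin x))) \<in> borel_measurable lebesgue"
      by (intro borel_measurable_scaleR borel_measurable_const ml)
    show "(\<lambda>x. \<phi> x *\<^sub>R w x + s *\<^sub>R (\<phi> x *\<^sub>R u x)) \<in> borel_measurable lebesgue"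
      by (rule borel_measurable_integrable[OF iw])
    show "AE x in lebesgue. r *\<^sub>R (indicator D x *\<^sub>R (\<phi> x *\<^sub>R uin x)) = \<phi> x *\<^sub>R w x + s *\<^sub>R (\<phi> x *\<^sub>R u x)"
      using pde
    proof eventually_elim
      case (elim x)
      have "\<phi> x *\<^sub>R w x + s *\<^sub>R (\<phi> x *\<^sub>R u x) = of_real (\<phi> x) * (w x + of_real (k\<^sup>2 * q) * u x)"
        by (simp add: s_def scaleR_conv_of_real algebra_simps)
      also have "\<dots> = of_real (\<phi> x) * (of_real r * uin x * indicator D x)" unfolding elim r_def ..
      also have "\<dots> = r *\<^sub>R (indicator D x *\<^sub>R (\<phi> x *\<^sub>R uin x))"
        by (cases "x \<in> D") (simp_all add: scaleR_conv_of_real)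
      finally show ?case by simp
    qed
  qed
  also have "\<dots> = (LINT x|lebesgue. laplacian \<phi> x *\<^sub>R u x) + s *\<^sub>R (LINT x|lebesgue. \<phi> x *\<^sub>R u x)"
    by (simp only: sp[OF W(2)] W(1))
  also have "\<dots> = (LINT x|lebesgue. laplacian \<phi> x *\<^sub>R u x + s *\<^sub>R (\<phi> x *\<^sub>R u x))"
    by (simp only: sp[OF W(3)])
  also have "\<dots> = 0"
  proof (rule integral_eq_zero_AE)
    show "AE x in lebesgue. laplacian \<phi> x *\<^sub>R u x + s *\<^sub>R (\<phi> x *\<^sub>R u x) = 0"
      using out
    proof eventually_elim
      case (elim x)
      show ?case
      proof (cases "x \<in> D")
        case True
        have "laplacian \<phi> x *\<^sub>R u x + s *\<^sub>R (\<phi> x *\<^sub>R u x) = (laplacian \<phi> x + s * \<phi> x) *\<^sub>R u x"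
          by (simp add: scaleR_left_distrib)
        then show ?thesis using eq[OF True] by (simp add: s_def)
      qed (use elim in simp)
    qed
  qed
  finally have "(LINT x|lebesgue. indicator D x *\<^sub>R (\<phi> x *\<^sub>R uin x)) = 0" using r by simp
  then show ?thesis unfolding set_lebesgue_integral_def using m by (simp add: integral_completion)
qed

text \<open>The derivatives of the cut-off function are obtained abstractly and then identified,
  inside \<open>(-M, M)\<close> and outside \<open>[-M-1, M+1]\<close>, by uniqueness of derivatives
  on open sets; between the two no formula has to be carried along.\<close>

lemma smooth_cutoff:
  assumes h: "\<And>n. Cn n h" "\<And>x. (h has_real_derivative h1 x) (at x)" "\<And>x. (h1 has_real_derivative h2 x) (at x)"
    and M: "M > 0"
  obtains k k1 k2 where "\<And>n. Cn n k" "\<And>x. (k has_real_derivative k1 x) (at x)"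
    "\<And>x. (k1 has_real_derivative k2 x) (at x)" "continuous_on UNIV k1" "continuous_on UNIV k2"
    "\<And>x. \<bar>x\<bar> > M + 1 \<Longrightarrow> k x = 0 \<and> k1 x = 0 \<and> k2 x = 0"
    "\<And>x. \<bar>x\<bar> < M \<Longrightarrow> k x = h x \<and> k1 x = h1 x \<and> k2 x = h2 x"
proof -
  obtain S :: "real \<Rightarrow> real" where S: "\<And>n. Cn n S" "\<And>x. x \<le> 0 \<Longrightarrow> S x = 0" "\<And>x. x \<ge> 1 \<Longrightarrow> S x = 1"
    by (rule smooth_step) (rule that)
  \<comment> \<open>The first step factor is 1 for \<open>x \<le> M\<close> and 0 for
    \<open>x \<ge> M + 1\<close>; the second is its mirror image.\<close>
  define k where "k x = h x * (S ((M + 1) + (-1) * x) * S ((M + 1) + 1 * x))" for x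
  have kn: "Cn n k" for n
    unfolding k_def by (rule Cn_mult[OF h(1) Cn_mult[OF Cn_affine[OF S(1)] Cn_affine[OF S(1)]]])
  obtain k1 where k1: "\<And>x. (k has_real_derivative k1 x) (at x)" "Cn (Suc 0) k1"
    using kn[of "Suc (Suc 0)"] by (rule Cn_SucE) (rule that)
  obtain k2 where k2: "\<And>x. (k1 has_real_derivative k2 x) (at x)" "Cn 0 k2"
    using k1(2) by (rule Cn_SucE) (rule that)
  have tr: "f' x = g' x" if "open A" "x \<in> A" "\<And>y. y \<in> A \<Longrightarrow> f y = g y"
    "\<And>x. (f has_real_derivative f' x) (at x)" "\<And>x. (g has_real_derivative g' x) (at x)"
    for f g f' g' :: "real \<Rightarrow> real" and A x
  proof -
    have "(g has_real_derivative f' x) (at x)"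
      by (rule has_field_derivative_transform_within_open[OF that(4) that(1,2)]) (rule that(3))
    then show ?thesis using that(5) DERIV_unique by blast
  qed
  have in0: "k x = h x" if "x \<in> {-M<..<M}" for x using that S(3) by (auto simp: k_def)
  have in1: "k1 x = h1 x" if "x \<in> {-M<..<M}" for x
    by (rule tr[OF open_greaterThanLessThan that in0 k1(1) h(2)])
  have in2: "k2 x = h2 x" if "x \<in> {-M<..<M}" for x
    by (rule tr[OF open_greaterThanLessThan that in1 k2(1) h(3)])
  have o: "open (- {- (M + 1)..M + 1})" by (simp add: open_Compl)
  have out0: "k x = 0" if "x \<in> - {- (M + 1)..M + 1}" for x using that S(2) by (auto simp: k_def not_le)
  have out1: "k1 x = 0" if "x \<in> - {- (M + 1)..M + 1}" for x
    using tr[OF o that out0 k1(1) DERIV_const] .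
  have out2: "k2 x = 0" if "x \<in> - {- (M + 1)..M + 1}" for x
    using tr[OF o that out1 k2(1) DERIV_const] .
  show thesis
  proof (rule that[of k k1 k2])
    show "k x = 0 \<and> k1 x = 0 \<and> k2 x = 0" if "\<bar>x\<bar> > M + 1" for x
    proof -
      have "x \<in> - {- (M + 1)..M + 1}" using that by auto
      then show ?thesis using out0 out1 out2 by simp
    qed
    show "k x = h x \<and> k1 x = h1 x \<and> k2 x = h2 x" if "\<bar>x\<bar> < M" for x
    proof -
      have "x \<in> {- M<..<M}" using that by auto
      then show ?thesis using in0 in1 in2 by simp
    qed
  qed (use kn k1 k2 Cn_continuous[OF k1(2)] in auto)
qed

lemma C1_compact_support_product:
  fixes v vx vy :: "real \<times> real \<Rightarrow> complex"
  assumes v: "\<And>a b. ((\<lambda>r. v (r, b)) has_vector_derivative vx (a, b)) (at a)"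
    "\<And>a b. ((\<lambda>r. v (a, r)) has_vector_derivative vy (a, b)) (at b)"
    "continuous_on UNIV v" "continuous_on UNIV vx" "continuous_on UNIV vy"
    and \<alpha>: "\<And>x. (\<alpha> has_real_derivative \<alpha>' x) (at x)" "continuous_on UNIV \<alpha>'"
    and \<beta>: "\<And>x. (\<beta> has_real_derivative \<beta>' x) (at x)" "continuous_on UNIV \<beta>'"
    and z: "\<And>x. \<bar>x\<bar> > R \<Longrightarrow> \<alpha> x = 0 \<and> \<alpha>' x = 0" "\<And>x. \<bar>x\<bar> > R \<Longrightarrow> \<beta> x = 0 \<and> \<beta>' x = 0"
  shows "C1_compact_support (\<lambda>p. of_real (\<alpha> (fst p) * \<beta> (snd p)) * v p)
    (\<lambda>p. of_real (\<alpha> (fst p) * \<beta> (snd p)) * vx p + of_real (\<alpha>' (fst p) * \<beta> (snd p)) * v p)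
    (\<lambda>p. of_real (\<alpha> (fst p) * \<beta> (snd p)) * vy p + of_real (\<alpha> (fst p) * \<beta>' (snd p)) * v p) R"
proof
  have c: "continuous_on UNIV \<alpha>" "continuous_on UNIV \<beta>"
    using \<alpha>(1) \<beta>(1) DERIV_isCont continuous_at_imp_continuous_on by blast+
  have cc: "continuous_on UNIV (\<lambda>p :: real \<times> real. h (fst p))" "continuous_on UNIV (\<lambda>p :: real \<times> real. h (snd p))"
    if "continuous_on UNIV h" for h :: "real \<Rightarrow> real"
    by (auto intro!: continuous_on_compose2[OF that] continuous_intros)
  show "((\<lambda>r. of_real (\<alpha> (fst (r, b)) * \<beta> (snd (r, b))) * v (r, b)) has_vector_derivative
     of_real (\<alpha> (fst (a, b)) * \<beta> (snd (a, b))) * vx (a, b) + of_real (\<alpha>' (fst (a, b)) * \<beta> (snd (a, b))) * v (a, b)) (at a)" for a b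
  proof -
    have "((\<lambda>r. \<alpha> r * \<beta> b) has_real_derivative \<alpha>' a * \<beta> b) (at a)" by (intro DERIV_cmult_right \<alpha>)
    then have "((\<lambda>r. complex_of_real (\<alpha> r * \<beta> b)) has_vector_derivative of_real (\<alpha>' a * \<beta> b)) (at a)"
      by (rule has_vector_derivative_of_real)
    from has_vector_derivative_mult[OF this v(1)] show ?thesis by simp
  qed
  show "((\<lambda>r. of_real (\<alpha> (fst (a, r)) * \<beta> (snd (a, r))) * v (a, r)) has_vector_derivative
     of_real (\<alpha> (fst (a, b)) * \<beta> (snd (a, b))) * vy (a, b) + of_real (\<alpha> (fst (a, b)) * \<beta>' (snd (a, b))) * v (a, b)) (at b)" for a b
  proof -
    have "((\<lambda>r. \<alpha> a * \<beta> r) has_real_derivative \<alpha> a * \<beta>' b) (at b)" by (intro DERIV_cmult \<beta>)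
    then have "((\<lambda>r. complex_of_real (\<alpha> a * \<beta> r)) has_vector_derivative of_real (\<alpha> a * \<beta>' b)) (at b)"
      by (rule has_vector_derivative_of_real)
    from has_vector_derivative_mult[OF this v(2)] show ?thesis by simp
  qed
  show "continuous_on UNIV (\<lambda>p. of_real (\<alpha> (fst p) * \<beta> (snd p)) * v p)"
    "continuous_on UNIV (\<lambda>p. of_real (\<alpha> (fst p) * \<beta> (snd p)) * vx p + of_real (\<alpha>' (fst p) * \<beta> (snd p)) * v p)"
    "continuous_on UNIV (\<lambda>p. of_real (\<alpha> (fst p) * \<beta> (snd p)) * vy p + of_real (\<alpha> (fst p) * \<beta>' (snd p)) * v p)"
    by (intro continuous_intros cc c \<alpha>(2) \<beta>(2) v)+
  fix p assume "p \<notin> cbox (- R, - R) (R, R)"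
  then have "\<bar>fst p\<bar> > R \<or> \<bar>snd p\<bar> > R" by (cases p) auto
  then have "(\<alpha> (fst p) = 0 \<and> \<alpha>' (fst p) = 0) \<or> (\<beta> (snd p) = 0 \<and> \<beta>' (snd p) = 0)"
    using z by blast
  then show "of_real (\<alpha> (fst p) * \<beta> (snd p)) * v p = 0 \<and>
    of_real (\<alpha> (fst p) * \<beta> (snd p)) * vx p + of_real (\<alpha>' (fst p) * \<beta> (snd p)) * v p = 0 \<and>
    of_real (\<alpha> (fst p) * \<beta> (snd p)) * vy p + of_real (\<alpha> (fst p) * \<beta>' (snd p)) * v p = 0"
    by (elim disjE conjE) simp_all
qed

lemma C1_compact_support_diff:
  assumes "C1_compact_support f fx fy R" "C1_compact_support h hx hy R"
  shows "C1_compact_support (\<lambda>p. f p - h p) (\<lambda>p. fx p - hx p) (\<lambda>p. fy p - hy p) R"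
proof -
  interpret f: C1_compact_support f fx fy R by fact
  interpret h: C1_compact_support h hx hy R by fact
  show ?thesis
    by standard (use f.supp h.supp in \<open>auto intro!: has_vector_derivative_diff f.dx h.dx f.dy h.dy
      continuous_intros f.cont h.cont\<close>)
qed

text \<open>Inside, the value 1 is the definition of the orientation. Outside, the component of the
  complement that contains \<open>p\<close> is unbounded; the winding number is constant on it and
  zero far away.\<close>

lemma winding_number_inside_real_prod:
  fixes \<gamma> :: "real \<Rightarrow> real \<times> real"
  assumes \<gamma>: "path \<gamma>" "pathfinish \<gamma> = pathstart \<gamma>" and ccw: "counterclockwise \<gamma>" and p: "p \<notin> path_image \<gamma>"
  shows "winding_number (\<lambda>s. cplx (\<gamma> s)) (cplx p) = indicator (inside (path_image \<gamma>)) p"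
proof (cases "p \<in> inside (path_image \<gamma>)")
  case True
  obtain a b where ab: "p = (a, b)" by fastforce
  have c: "cplx q = Complex (fst q) (snd q)" for q by (simp add: cplx_def complex_eq_iff)
  have "winding_number (\<lambda>s. Complex (fst (\<gamma> s)) (snd (\<gamma> s))) (Complex a b) = 1"
    using ccw True unfolding counterclockwise_def ab by auto
  then show ?thesis using True by (simp add: c ab)
next
  case False
  then have out: "p \<in> outside (path_image \<gamma>)"
    using p by (metis ComplI UnE inside_Un_outside)
  let ?\<Gamma> = "\<lambda>s. cplx (\<gamma> s)"
  have path: "path ?\<Gamma>" "pathfinish ?\<Gamma> = pathstart ?\<Gamma>"
    using \<gamma> by (auto simp: path_def pathfinish_def pathstart_def intro: continuous_intros)
  define C where "C = connected_component_set (- path_image \<gamma>) p"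
  have C: "\<not> bounded C" "p \<in> C" "C \<subseteq> - path_image \<gamma>"
    using out p by (auto simp: outside_def C_def connected_component_refl dest: connected_component_in)
  have cC: "connected (cplx ` C)"
    unfolding C_def by (intro connected_continuous_image continuous_intros connected_connected_component)
  have inj: "cplx x = cplx y \<longleftrightarrow> x = y" for x y
    by (metis cplx_diff cplx_eq_0_iff eq_iff_diff_eq_0)
  have disj: "cplx ` C \<inter> path_image ?\<Gamma> = {}"
    using C(3) by (auto simp: path_image_def inj)
  obtain B where B: "\<And>z. B \<le> norm z \<Longrightarrow> winding_number ?\<Gamma> z = 0"
    using winding_number_zero_at_infinity[OF path] by blast
  obtain p' where p': "p' \<in> C" "norm p' > B"
    using C(1) unfolding bounded_iff by (meson not_le)
  have "norm (cplx p') = norm p'"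
    using norm_cplx_sq[of p'] by (simp add: norm_prod_def real_sqrt_unique)
  then have "winding_number ?\<Gamma> (cplx p') = 0" using B p' by simp
  moreover have "winding_number ?\<Gamma> constant_on (cplx ` C)"
    by (rule winding_number_constant[OF path cC disj])
  ultimately have "winding_number ?\<Gamma> (cplx p) = 0"
    using C(2) p'(1) unfolding constant_on_def by (metis imageI)
  then show ?thesis using False by simp
qed

section \<open>Winding of the boundary curve and vanishing of the boundary integral\<close>

context analytic_boundary
begin

abbreviation "curve t \<equiv> (x1 t, x2 t)"

lemma boundary_curve_image: "path_image (boundary_curve x1 x2) = curve ` {- pi..pi}"
proof -
  have "linepath (- pi) pi ` {0..1} = {- pi..pi}"
    by (simp add: linepath_image_01 closed_segment_eq_real_ivl)
  then show ?thesis unfolding path_image_def boundary_curve_def image_comp[symmetric] by simp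
qed

lemma continuous_curve: "continuous_on {- pi..pi} curve"
proof -
  have "continuous_on {- pi..pi} x1" by (rule DERIV_continuous_on[OF x_deriv_within(1)])
  moreover have "continuous_on {- pi..pi} x2" by (rule DERIV_continuous_on[OF x_deriv_within(2)])
  ultimately show ?thesis by (intro continuous_intros)
qed

lemma curve_speed: "continuous_on {- pi..pi} (\<lambda>t. Re (deriv X1 (of_real t)))" "continuous_on {- pi..pi} (\<lambda>t. Re (deriv X2 (of_real t)))"
proof -
  have "continuous_on {- pi..pi} (\<lambda>t. h (complex_of_real t))" if "h holomorphic_on T" for h
    by (rule continuous_on_compose2[OF holomorphic_on_imp_continuous_on[OF that]])
       (use T(2) in \<open>auto intro!: continuous_intros\<close>)
  from this[OF holo_deriv_X(1)] this[OF holo_deriv_X(2)] show "continuous_on {- pi..pi} (\<lambda>t. Re (deriv X1 (of_real t)))" "continuous_on {- pi..pi} (\<lambda>t. Re (deriv X2 (of_real t)))"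
    by (auto intro: continuous_intros)
qed

lemma negligible_curve: "negligible (curve ` {- pi..pi})"
proof (rule negligible_differentiable_image_lowdim)
  show "DIM(real) < DIM(real \<times> real)" by simp
  show "curve differentiable_on {- pi..pi}"
    unfolding differentiable_on_def
  proof
    fix t assume "t \<in> {- pi..pi}"
    from x_deriv_within(1,2)[OF this]
    have "(x1 has_derivative (\<lambda>h. Re (deriv X1 (of_real t)) * h)) (at t within {- pi..pi})"
      "(x2 has_derivative (\<lambda>h. Re (deriv X2 (of_real t)) * h)) (at t within {- pi..pi})"
      by (simp_all add: has_field_derivative_def)
    from has_derivative_Pair[OF this] show "curve differentiable at t within {- pi..pi}"
      unfolding differentiable_def by blast
  qed
qed

text \<open>The curve is the composite of the analytic function \<open>g\<close> with a straight
  path, which is a valid path even where the velocity vanishes. Pulling the contour integral back to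
  the interval produces \<open>deriv g\<close>, the complex velocity.\<close>

lemma curve_winding_integral:
  assumes \<gamma>: "path (boundary_curve x1 x2)" "pathfinish (boundary_curve x1 x2) = pathstart (boundary_curve x1 x2)"
    and ccw: "counterclockwise (boundary_curve x1 x2)" and p: "p \<notin> curve ` {- pi..pi}"
  shows "integral {- pi..pi} (\<lambda>t. (of_real (Re (deriv X1 (of_real t))) + \<i> * of_real (Re (deriv X2 (of_real t))))
     / (cplx (curve t) - cplx p)) = 2 * of_real pi * \<i> * indicator (inside (path_image (boundary_curve x1 x2))) p"
proof -
  let ?L = "linepath (- complex_of_real pi) (of_real pi)"
  have "closed_segment (- complex_of_real pi) (of_real pi) = of_real ` {- pi..pi}"
    using closed_segment_of_real[of "- pi" pi] by (simp add: closed_segment_eq_real_ivl)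
  then have im: "path_image ?L = of_real ` {- pi..pi}" by simp
  then have imT: "path_image ?L \<subseteq> T" using T(2) by simp
  have gc: "g (of_real t) = cplx (curve t)" if "t \<in> {- pi..pi}" for t
    using real_point[OF that] by (simp add: g_ext_def cplx_def)
  have cong: "cplx (boundary_curve x1 x2 s) = (g \<circ> ?L) s" if "0 \<le> s" "s \<le> 1" for s
  proof -
    have L: "?L s = of_real (linepath (- pi) pi s)" by (simp add: linepath_def scaleR_conv_of_real)
    have "linepath (- pi) pi s \<in> {- pi..pi}"
      using that linepath_image_01[of "- pi" pi] by (auto simp: closed_segment_eq_real_ivl)
    from gc[OF this] show ?thesis by (simp add: L boundary_curve_def)
  qed
  have vp: "valid_path (g \<circ> ?L)"
    by (rule valid_path_compose_holomorphic[OF valid_path_linepath holo_g T(1) imT])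
  have inj: "cplx x = cplx y \<longleftrightarrow> x = y" for x y
    by (metis cplx_diff cplx_eq_0_iff eq_iff_diff_eq_0)
  have np: "cplx p \<notin> path_image (g \<circ> ?L)"
    using p gc unfolding path_image_compose im by (auto simp: inj)
  have "indicator (inside (path_image (boundary_curve x1 x2))) p = winding_number (\<lambda>s. cplx (boundary_curve x1 x2 s)) (cplx p)"
    using winding_number_inside_real_prod[OF \<gamma> ccw] p by (simp add: boundary_curve_image)
  also have "\<dots> = winding_number (g \<circ> ?L) (cplx p)" by (rule winding_number_cong) (rule cong)
  also have "\<dots> = 1 / (2 * of_real pi * \<i>) * contour_integral (g \<circ> ?L) (\<lambda>w. 1 / (w - cplx p))"
    using winding_number_valid_path[OF vp np] by simp
  also have "contour_integral (g \<circ> ?L) (\<lambda>w. 1 / (w - cplx p)) = contour_integral ?L (\<lambda>t. deriv g t * (1 / (g t - cplx p)))"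
    by (rule contour_integral_comp_analyticW[OF _ valid_path_linepath imT])
       (simp add: analytic_on_open[OF T(1)] holo_g)
  also have "\<dots> = integral {- pi..pi} (\<lambda>t. deriv g (of_real t) * (1 / (g (of_real t) - cplx p)))"
    by (subst contour_integral_linepath_Reals_eq) auto
  also have "\<dots> = integral {- pi..pi} (\<lambda>t. (of_real (Re (deriv X1 (of_real t))) + \<i> * of_real (Re (deriv X2 (of_real t))))
     / (cplx (curve t) - cplx p))"
  proof (rule integral_cong)
    fix t assume t: "t \<in> {- pi..pi}"
    have "deriv g (of_real t) = of_real (Re (deriv X1 (of_real t))) + \<i> * of_real (Re (deriv X2 (of_real t)))"
      using x_deriv_within(3,4)[OF t] g_deriv[OF real_point(3)[OF t]] by simp
    then show "deriv g (of_real t) * (1 / (g (of_real t) - cplx p)) =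
      (of_real (Re (deriv X1 (of_real t))) + \<i> * of_real (Re (deriv X2 (of_real t)))) / (cplx (curve t) - cplx p)"
      by (simp add: gc[OF t])
  qed
  finally show ?thesis by simp
qed

text \<open>Test functions are real, so the exponential enters as
  \<open>exp (lam x) cos (\<theta> + \<kappa> y)\<close> with \<open>\<kappa> = lam + lt\<close>;
  the phases 0 and \<open>- pi / 2\<close> give its real and imaginary parts. Green's formula is
  applied to the components \<open>fA\<close>, \<open>fB\<close> of
  \<open>\<phi> grad uin - uin grad \<phi>\<close>, whose divergence is a multiple of
  \<open>\<phi> uin\<close> in \<open>D\<close> and so integrates to zero.\<close>

lemma nonscattering_boundary_integral_zero:
  assumes kq: "k \<noteq> 0" "q \<ge> 0" "q \<noteq> 1"
    and \<gamma>: "path (boundary_curve x1 x2)" "pathfinish (boundary_curve x1 x2) = pathstart (boundary_curve x1 x2)"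
      "counterclockwise (boundary_curve x1 x2)"
    and ns: "nonscattering k q (inside (path_image (boundary_curve x1 x2))) uin"
  shows "boundary_integral k q uin x1 x2 lam = 0"
proof -
  define D where "D = inside (path_image (boundary_curve x1 x2))"
  have cI: "compact (curve ` {- pi..pi})" by (intro compact_continuous_image continuous_curve) auto
  have D: "open D" "bounded D"
    using cI unfolding D_def boundary_curve_image by (auto intro: open_inside bounded_inside compact_imp_closed compact_imp_bounded)
  have "bounded (D \<union> curve ` {- pi..pi})" by (simp add: D(2) compact_imp_bounded[OF cI])
  \<comment> \<open>The box contains the curve as well as \<open>D\<close>: the cut-off must not
    alter the values read off in the boundary integral.\<close>
  then obtain M where M: "M > 0" "\<forall>p\<in>D \<union> curve ` {- pi..pi}. norm p < M"
    unfolding bounded_pos_less by blast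
  have comp: "\<bar>fst p\<bar> < M" "\<bar>snd p\<bar> < M" if "p \<in> D \<union> curve ` {- pi..pi}" for p
  proof -
    have "norm p < M" using M(2) that by blast
    then show "\<bar>fst p\<bar> < M" "\<bar>snd p\<bar> < M"
      using norm_fst_le[of "fst p" "snd p"] norm_snd_le[of "snd p" "fst p"] by simp_all
  qed
  define \<kappa> where "\<kappa> = lam + lambda_tilde k q lam"
  have "lam\<^sup>2 + k\<^sup>2 * q \<ge> 0" using kq by (intro add_nonneg_nonneg mult_nonneg_nonneg) auto
  from lambda_tilde_mult[OF this] have \<kappa>: "\<kappa>\<^sup>2 = lam\<^sup>2 + k\<^sup>2 * q"
    by (simp add: \<kappa>_def power2_eq_square algebra_simps)
  define d1 where "d1 t = Re (deriv X1 (of_real t))" for t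
  define d2 where "d2 t = Re (deriv X2 (of_real t))" for t
  have cd: "continuous_on {- pi..pi} d1" "continuous_on {- pi..pi} d2"
    unfolding d1_def d2_def by (rule curve_speed)+
  define ux where "ux = partial_deriv (1, 0) uin"
  define uy where "uy = partial_deriv (0, 1) uin"
  define uxx where "uxx = partial_deriv (1, 0) ux"
  define uxy where "uxy = partial_deriv (0, 1) ux"
  define uyx where "uyx = partial_deriv (1, 0) uy"
  define uyy where "uyy = partial_deriv (0, 1) uy"
  have diff: "uin differentiable (at p)" "ux differentiable (at p)" "uy differentiable (at p)" for p
    unfolding ux_def uy_def by (rule C_k_2D[OF C2])+
  have u_eq: "partial_deriv (1, 0) uin p = ux p" "partial_deriv (0, 1) uin p = uy p"
    "partial_deriv (1, 0) ux p = uxx p" "partial_deriv (0, 1) ux p = uxy p"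
    "partial_deriv (1, 0) uy p = uyx p" "partial_deriv (0, 1) uy p = uyy p" for p
    by (simp_all add: ux_def uy_def uxx_def uxy_def uyx_def uyy_def)
  have du: "((\<lambda>r. uin (r, b)) has_vector_derivative ux (a, b)) (at a)"
    "((\<lambda>r. uin (a, r)) has_vector_derivative uy (a, b)) (at b)"
    "((\<lambda>r. ux (r, b)) has_vector_derivative uxx (a, b)) (at a)"
    "((\<lambda>r. ux (a, r)) has_vector_derivative uxy (a, b)) (at b)"
    "((\<lambda>r. uy (r, b)) has_vector_derivative uyx (a, b)) (at a)"
    "((\<lambda>r. uy (a, r)) has_vector_derivative uyy (a, b)) (at b)" for a b
    by (intro has_derivative_vector_slices[OF diff(1), unfolded u_eq]
        has_derivative_vector_slices[OF diff(2), unfolded u_eq]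
        has_derivative_vector_slices[OF diff(3), unfolded u_eq])+
  have cu: "continuous_on UNIV uin" "continuous_on UNIV ux" "continuous_on UNIV uy"
    by (intro continuous_at_imp_continuous_on ballI differentiable_imp_continuous_within diff)+
  have cuu: "continuous_on UNIV uxx" "continuous_on UNIV uxy" "continuous_on UNIV uyx" "continuous_on UNIV uyy"
    using C2 unfolding uxx_def uxy_def uyx_def uyy_def ux_def uy_def
    by (simp_all add: eval_nat_numeral Basis_real_prod)
  have helm: "uxx p + uyy p = - of_real (k\<^sup>2) * uin p" for p
    using Helmholtz[of p] by (simp add: laplacian_real_prod uxx_def uyy_def ux_def uy_def eq_neg_iff_add_eq_0)
  have main: "integral {- pi..pi} (\<lambda>t. of_real (exp (lam * x1 t)) *
      (of_real (cos (\<theta> + \<kappa> * x2 t)) * (ux (curve t) * of_real (d2 t) - uy (curve t) * of_real (d1 t))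
       - uin (curve t) * of_real (lam * cos (\<theta> + \<kappa> * x2 t) * d2 t + \<kappa> * sin (\<theta> + \<kappa> * x2 t) * d1 t))) = 0"
    for \<theta>
  proof -
    have da: "((\<lambda>x. 1 * exp (lam * x)) has_real_derivative lam * exp (lam * x)) (at x)"
      "((\<lambda>x. lam * exp (lam * x)) has_real_derivative lam\<^sup>2 * exp (lam * x)) (at x)" for x
      by (auto intro!: derivative_eq_intros simp: power2_eq_square)
    obtain a a1 a2 where
      a: "\<And>n. Cn n a" "\<And>x. (a has_real_derivative a1 x) (at x)"
      "\<And>x. (a1 has_real_derivative a2 x) (at x)" "continuous_on UNIV a1" "continuous_on UNIV a2"
      "\<And>x. \<bar>x\<bar> > M + 1 \<Longrightarrow> a x = 0 \<and> a1 x = 0 \<and> a2 x = 0"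
      "\<And>x. \<bar>x\<bar> < M \<Longrightarrow> a x = 1 * exp (lam * x) \<and> a1 x = lam * exp (lam * x) \<and> a2 x = lam\<^sup>2 * exp (lam * x)"
      by (rule smooth_cutoff[OF Cn_exp da M(1)]) (rule that)
    have db: "((\<lambda>x. 1 * cos (\<theta> + \<kappa> * x)) has_real_derivative - \<kappa> * sin (\<theta> + \<kappa> * x)) (at x)"
      "((\<lambda>x. - \<kappa> * sin (\<theta> + \<kappa> * x)) has_real_derivative - (\<kappa>\<^sup>2) * cos (\<theta> + \<kappa> * x)) (at x)" for x
      by (auto intro!: derivative_eq_intros simp: power2_eq_square)
    obtain b b1 b2 where
      b: "\<And>n. Cn n b" "\<And>x. (b has_real_derivative b1 x) (at x)"
      "\<And>x. (b1 has_real_derivative b2 x) (at x)" "continuous_on UNIV b1" "continuous_on UNIV b2"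
      "\<And>x. \<bar>x\<bar> > M + 1 \<Longrightarrow> b x = 0 \<and> b1 x = 0 \<and> b2 x = 0"
      "\<And>x. \<bar>x\<bar> < M \<Longrightarrow> b x = 1 * cos (\<theta> + \<kappa> * x) \<and> b1 x = - \<kappa> * sin (\<theta> + \<kappa> * x) \<and> b2 x = - (\<kappa>\<^sup>2) * cos (\<theta> + \<kappa> * x)"
      by (rule smooth_cutoff[OF Cn_cos db M(1)]) (rule that)
    define \<phi> where "\<phi> p = a (fst p) * b (snd p)" for p
    have test: "test_function \<phi>"
      unfolding \<phi>_def[abs_def] by (rule test_function_prod_fun[OF a(1) b(1), of "M + 1"]) (use a(6) b(6) in auto)
    have lap: "laplacian \<phi> p = a2 (fst p) * b (snd p) + a (fst p) * b2 (snd p)" for p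
      unfolding laplacian_real_prod \<phi>_def[abs_def] partial_deriv_prod_fun[OF a(2) b(2)]
      using fun_cong[OF partial_deriv_prod_fun(1)[OF a(3) b(2)], of p]
        fun_cong[OF partial_deriv_prod_fun(2)[OF a(2) b(3)], of p] by simp
    have lapD: "a2 (fst p) * b (snd p) + a (fst p) * b2 (snd p) = - (k\<^sup>2 * q) * \<phi> p" if "p \<in> D" for p
    proof -
      have m: "p \<in> D \<union> curve ` {- pi..pi}" using that by simp
      show ?thesis
        by (simp add: \<phi>_def a(7)[OF comp(1)[OF m]] b(7)[OF comp(2)[OF m]] \<kappa> algebra_simps)
    qed
    have orth: "(LINT x:D|lborel. \<phi> x *\<^sub>R uin x) = 0"
      by (rule nonscattering_orthogonal[OF ns[folded D_def] D(1) kq(1,3) cu(1) test])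
         (use lapD in \<open>simp add: lap\<close>)
    have z: "a x = 0 \<and> a1 x = 0" "b x = 0 \<and> b1 x = 0" "a1 x = 0 \<and> a2 x = 0" "b1 x = 0 \<and> b2 x = 0" if "\<bar>x\<bar> > M + 1" for x
      using a(6) b(6) that by auto
    note A = C1_compact_support_diff[OF
      C1_compact_support_product[OF du(3,4) cu(2) cuu(1,2) a(2,4) b(2,4) z(1,2)]
      C1_compact_support_product[OF du(1,2) cu(1,2,3) a(3,5) b(2,4) z(3,2)]]
    note B = C1_compact_support_diff[OF
      C1_compact_support_product[OF du(5,6) cu(3) cuu(3,4) a(2,4) b(2,4) z(1,2)]
      C1_compact_support_product[OF du(1,2) cu(1,2,3) a(2,4) b(3,5) z(1,4)]]
    have w: "integral {- pi..pi} (\<lambda>t. (of_real (d1 t) + \<i> * of_real (d2 t)) / (cplx (curve t) - cplx p))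
       = 2 * of_real pi * \<i> * indicator D p" if "p \<notin> curve ` {- pi..pi}" for p
      unfolding d1_def d2_def D_def by (rule curve_winding_integral[OF \<gamma> that])
    define fA where "fA p = complex_of_real (a (fst p) * b (snd p)) * ux p - of_real (a1 (fst p) * b (snd p)) * uin p" for p
    define fB where "fB p = complex_of_real (a (fst p) * b (snd p)) * uy p - of_real (a (fst p) * b1 (snd p)) * uin p" for p
    define fAx where "fAx p = (complex_of_real (a (fst p) * b (snd p)) * uxx p + of_real (a1 (fst p) * b (snd p)) * ux p)
       - (of_real (a1 (fst p) * b (snd p)) * ux p + of_real (a2 (fst p) * b (snd p)) * uin p)" for p
    define fBy where "fBy p = (complex_of_real (a (fst p) * b (snd p)) * uyy p + of_real (a (fst p) * b1 (snd p)) * uy p)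
       - (of_real (a (fst p) * b1 (snd p)) * uy p + of_real (a (fst p) * b2 (snd p)) * uin p)" for p
    have GA: "of_real bump_mass * integral {- pi..pi} (\<lambda>t. fA (curve t) * of_real (d2 t)) = of_real pi * (LINT p:D|lborel. fAx p)"
      unfolding fA_def fAx_def by (rule Green_rectilinear(2)[OF A continuous_curve cd negligible_curve D(1) w])
    have GB: "of_real bump_mass * integral {- pi..pi} (\<lambda>t. fB (curve t) * of_real (d1 t)) = - of_real pi * (LINT p:D|lborel. fBy p)"
      unfolding fB_def fBy_def by (rule Green_rectilinear(1)[OF B continuous_curve cd negligible_curve D(1) w])
    interpret A: C1_compact_support fA fAx "\<lambda>p. (complex_of_real (a (fst p) * b (snd p)) * uxy p + of_real (a (fst p) * b1 (snd p)) * ux p)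
       - (of_real (a1 (fst p) * b (snd p)) * uy p + of_real (a1 (fst p) * b1 (snd p)) * uin p)" "M + 1"
      unfolding fA_def fAx_def by (rule A)
    interpret B: C1_compact_support fB "\<lambda>p. (complex_of_real (a (fst p) * b (snd p)) * uyx p + of_real (a1 (fst p) * b (snd p)) * uy p)
       - (of_real (a (fst p) * b1 (snd p)) * ux p + of_real (a1 (fst p) * b1 (snd p)) * uin p)" fBy "M + 1"
      unfolding fB_def fBy_def by (rule B)
    have cA: "continuous_on {- pi..pi} (\<lambda>t. fA (curve t))" "continuous_on {- pi..pi} (\<lambda>t. fB (curve t))"
      by (rule continuous_on_compose2[OF A.cont(1) continuous_curve] continuous_on_compose2[OF B.cont(1) continuous_curve]; simp)+
    have int: "set_integrable lborel D h" if "continuous_on UNIV h" "\<And>p. p \<notin> cbox (- (M + 1), - (M + 1)) (M + 1, M + 1) \<Longrightarrow> h p = 0"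
      for h :: "real \<times> real \<Rightarrow> complex"
      unfolding set_integrable_def
      by (rule integrable_mult_indicator) (use D integrable_continuous_compact_support[OF that] in auto)
    have iA: "set_integrable lborel D fAx" by (rule int[OF A.cont(2)]) (use A.supp in blast)
    have iB: "set_integrable lborel D fBy" by (rule int[OF B.cont(3)]) (use B.supp in blast)
    have "(LINT p:D|lborel. fAx p) + (LINT p:D|lborel. fBy p) = (LINT p:D|lborel. fAx p + fBy p)"
      by (rule set_integral_add(2)[OF iA iB, symmetric])
    also have "\<dots> = (LINT p:D|lborel. of_real (k\<^sup>2 * (q - 1)) * (\<phi> p *\<^sub>R uin p))"
    proof (rule set_lebesgue_integral_cong)
      \<comment> \<open>The products of first derivatives cancel, leaving
        \<open>\<phi> \<Delta>uin - uin \<Delta>\<phi>\<close>; the two Helmholtz equations, with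
        constants \<open>k^2\<close> and \<open>k^2 q\<close>, leave the factor
        \<open>k^2 (q - 1)\<close>.\<close>
      show "\<forall>p. p \<in> D \<longrightarrow> fAx p + fBy p = of_real (k\<^sup>2 * (q - 1)) * (\<phi> p *\<^sub>R uin p)"
      proof (intro allI impI)
        fix p assume p: "p \<in> D"
        have "fAx p + fBy p = of_real (\<phi> p) * (uxx p + uyy p) - of_real (a2 (fst p) * b (snd p) + a (fst p) * b2 (snd p)) * uin p"
          by (simp add: fAx_def fBy_def \<phi>_def algebra_simps)
        also have "\<dots> = of_real (k\<^sup>2 * (q - 1)) * (\<phi> p *\<^sub>R uin p)"
          unfolding helm lapD[OF p] by (simp add: scaleR_conv_of_real algebra_simps)
        finally show "fAx p + fBy p = of_real (k\<^sup>2 * (q - 1)) * (\<phi> p *\<^sub>R uin p)" .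
      qed
    qed (use D in simp)
    also have "\<dots> = of_real (k\<^sup>2 * (q - 1)) * (LINT p:D|lborel. \<phi> p *\<^sub>R uin p)"
      by (rule set_integral_mult_right)
    also have "\<dots> = 0" by (simp add: orth)
    finally have area: "(LINT p:D|lborel. fAx p) + (LINT p:D|lborel. fBy p) = 0" .
    have "of_real bump_mass * integral {- pi..pi} (\<lambda>t. fA (curve t) * of_real (d2 t) - fB (curve t) * of_real (d1 t))
      = of_real bump_mass * integral {- pi..pi} (\<lambda>t. fA (curve t) * of_real (d2 t))
        - of_real bump_mass * integral {- pi..pi} (\<lambda>t. fB (curve t) * of_real (d1 t))"
      unfolding right_diff_distrib[symmetric]
      by (subst integral_diff) (intro integrable_continuous_interval continuous_intros cA cd refl)+
    also have "\<dots> = of_real pi * ((LINT p:D|lborel. fAx p) + (LINT p:D|lborel. fBy p))"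
      unfolding GA GB by (simp add: algebra_simps)
    finally have "integral {- pi..pi} (\<lambda>t. fA (curve t) * of_real (d2 t) - fB (curve t) * of_real (d1 t)) = 0"
      using bump_mass_pos by (simp add: area)
    moreover have "integral {- pi..pi} (\<lambda>t. fA (curve t) * of_real (d2 t) - fB (curve t) * of_real (d1 t)) =
      integral {- pi..pi} (\<lambda>t. of_real (exp (lam * x1 t)) *
      (of_real (cos (\<theta> + \<kappa> * x2 t)) * (ux (curve t) * of_real (d2 t) - uy (curve t) * of_real (d1 t))
       - uin (curve t) * of_real (lam * cos (\<theta> + \<kappa> * x2 t) * d2 t + \<kappa> * sin (\<theta> + \<kappa> * x2 t) * d1 t)))"
    proof (rule integral_cong)
      fix t assume "t \<in> {- pi..pi}"
      then have m: "curve t \<in> D \<union> curve ` {- pi..pi}" by blast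
      note ab = a(7)[OF comp(1)[OF m], unfolded fst_conv] b(7)[OF comp(2)[OF m], unfolded snd_conv]
      show "fA (curve t) * of_real (d2 t) - fB (curve t) * of_real (d1 t) = of_real (exp (lam * x1 t)) *
      (of_real (cos (\<theta> + \<kappa> * x2 t)) * (ux (curve t) * of_real (d2 t) - uy (curve t) * of_real (d1 t))
       - uin (curve t) * of_real (lam * cos (\<theta> + \<kappa> * x2 t) * d2 t + \<kappa> * sin (\<theta> + \<kappa> * x2 t) * d1 t))"
        unfolding fA_def fB_def fst_conv snd_conv by (simp add: ab algebra_simps)
    qed
    ultimately show ?thesis by simp
  qed
  \<comment> \<open>The integrand of \<open>main\<close> as a function of the phase;
    \<open>J 0 + i J (- pi / 2)\<close> recombines cosine and sine into the exponential.\<close>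
  define J where "J \<theta> t = of_real (exp (lam * x1 t)) *
      (of_real (cos (\<theta> + \<kappa> * x2 t)) * (ux (curve t) * of_real (d2 t) - uy (curve t) * of_real (d1 t))
       - uin (curve t) * of_real (lam * cos (\<theta> + \<kappa> * x2 t) * d2 t + \<kappa> * sin (\<theta> + \<kappa> * x2 t) * d1 t))" for \<theta> t
  have cx: "continuous_on {- pi..pi} x1" "continuous_on {- pi..pi} x2"
    using continuous_on_fst[OF continuous_curve] continuous_on_snd[OF continuous_curve] by simp_all
  have cuc: "continuous_on {- pi..pi} (\<lambda>t. h (curve t))" if "continuous_on UNIV h" for h :: "real \<times> real \<Rightarrow> complex"
    by (rule continuous_on_compose2[OF that continuous_curve]) simp
  have iJ: "J \<theta> integrable_on {- pi..pi}" for \<theta>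
    unfolding J_def by (intro integrable_continuous_interval continuous_intros cx cd cuc cu)
  have "boundary_integral k q uin x1 x2 lam = integral {- pi..pi} (\<lambda>t. boundary_integrand q lam (of_real t))"
    unfolding boundary_integral_contour by (subst contour_integral_linepath_Reals_eq) auto
  also have "\<dots> = integral {- pi..pi} (\<lambda>t. J 0 t + \<i> * J (- (pi / 2)) t)"
  proof (rule integral_cong)
    fix t assume t: "t \<in> {- pi..pi}"
    note rp = real_point[OF t] g_deriv[OF real_point(3)[OF t]]
    have dX: "deriv X1 (of_real t) = of_real (d1 t)" "deriv X2 (of_real t) = of_real (d2 t)"
      unfolding d1_def d2_def using x_deriv_within(3,4)[OF t] .
    define c where "c = cos (\<kappa> * x2 t)"
    define s where "s = sin (\<kappa> * x2 t)"
    have cs: "cos (- (pi / 2) + \<kappa> * x2 t) = s" "sin (- (pi / 2) + \<kappa> * x2 t) = - c"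
      by (simp_all add: c_def s_def cos_add sin_add cos_diff sin_diff)
    have ex: "of_real lam * g (of_real t) + \<i> * of_real (lambda_tilde k q lam) * X2 (of_real t)
        = of_real (lam * x1 t) + \<i> * of_real (\<kappa> * x2 t)"
      unfolding g_ext_def rp by (simp add: \<kappa>_def algebra_simps)
    have "cis (\<kappa> * x2 t) = of_real c + \<i> * of_real s"
      by (simp add: c_def s_def complex_eq_iff)
    then have E: "plane_wave q lam (of_real t) = of_real (exp (lam * x1 t)) * (of_real c + \<i> * of_real s)"
      unfolding plane_wave_def ex exp_add exp_of_real cis_conv_exp[symmetric] by (rule arg_cong)
    have lt: "lambda_tilde k q lam = \<kappa> - lam" by (simp add: \<kappa>_def)
    show "boundary_integrand q lam (of_real t) = J 0 t + \<i> * J (- (pi / 2)) t"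
      unfolding boundary_integrand_def E rp dX J_def cs lt u_eq
      by (simp add: c_def[symmetric] s_def[symmetric] algebra_simps)
  qed
  also have "\<dots> = integral {- pi..pi} (J 0) + \<i> * integral {- pi..pi} (J (- (pi / 2)))"
    by (subst integral_add) (use iJ in \<open>auto intro: integrable_on_mult_right\<close>)
  also have "\<dots> = 0" using main[folded J_def] by simp
  finally show ?thesis .
qed

end

section \<open>The branch of the root, the value of the coefficient, and scattering\<close>

theorem theorem3p4:
  fixes k q :: real and uin :: "real \<times> real \<Rightarrow> complex"
    and x1 x2 :: "real \<Rightarrow> real" and X1 X2 g :: "complex \<Rightarrow> complex"
    and T :: "complex set" and D :: "(real \<times> real) set"
    and t0 :: complex and c :: "real \<Rightarrow> complex" and s0 \<omega> \<omega>0 :: real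
    and U :: "complex \<times> complex \<Rightarrow> complex" and W :: "(complex \<times> complex) set"
    and C1 C2 :: complex
  assumes k: "k > 0" and q: "q > 0" "q \<noteq> 1"
    and wave: "incident_wave k uin"
    and T: "open T" "complex_of_real ` {- pi..pi} \<subseteq> T"
    and ext: "X1 holomorphic_on T" "X2 holomorphic_on T"
      "\<forall>t\<in>{- pi..pi}. X1 (of_real t) = of_real (x1 t) \<and> X2 (of_real t) = of_real (x2 t)"
    and curve: "simple_path (boundary_curve x1 x2)"
      "pathfinish (boundary_curve x1 x2) = pathstart (boundary_curve x1 x2)"
      "counterclockwise (boundary_curve x1 x2)"
      "finite {t \<in> {- pi..pi}. deriv X1 (of_real t) = 0 \<and> deriv X2 (of_real t) = 0}"
    and D: "D = inside (path_image (boundary_curve x1 x2))"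
    and g: "g = g_ext X1 X2"
    and t0: "t0 \<in> T" "deriv g t0 = 0" "(deriv ^^ 2) g t0 \<noteq> 0"
      "t0 \<noteq> - of_real pi" "t0 \<noteq> of_real pi"
    and contour: "valid_path c" "pathstart c = - of_real pi" "pathfinish c = of_real pi"
      "path_image c \<subseteq> T" "homotopic_paths T (linepath (- of_real pi) (of_real pi)) c"
      "s0 \<in> {0..1}" "\<forall>s\<in>{0..1}. c s = t0 \<longleftrightarrow> s = s0"
      "\<forall>t\<in>path_image c - {t0}. Re (g t) < Re (g t0)"
    and branch: "arg_along c s0 t0 \<omega>"
      "- (deriv ^^ 2) g t0 = rcis (cmod ((deriv ^^ 2) g t0)) \<omega>0" "\<bar>\<omega>0 + 2 * \<omega>\<bar> \<le> pi / 2"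
      "arrives_opposite c s0 t0 \<omega>0"
    and uext: "open W" "(\<lambda>t. (X1 t, X2 t)) ` T \<subseteq> W" "holomorphic2_on U W"
      "\<forall>a b :: real. (of_real a, of_real b) \<in> W \<longrightarrow> U (of_real a, of_real b) = uin (a, b)"
    and C1: "C1 = C1_coeff k q U X1 X2 t0 \<omega>0"
    and C2: "C2 = C2_coeff k q U X1 X2 t0 \<omega>0"
    and C1_zero: "C1 = 0"
  shows "(\<exists>R. R \<in> O[at_top](\<lambda>lam. complex_of_real (1 / lam)) \<and>
           (\<forall>lam>0. boundary_integral k q uin x1 x2 lam
              = of_real (1 / lam powr (5/2)) * exp (of_real lam * g t0) * (C2 + R lam)))
         \<and> (C2 \<noteq> 0 \<longrightarrow> scattered k q D uin)"
proof -
  note C1_eq = C1 and C2_eq = C2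
  have ends: "boundary_curve x1 x2 0 = (x1 (- pi), x2 (- pi))" "boundary_curve x1 x2 1 = (x1 pi, x2 pi)"
    by (simp_all add: boundary_curve_def linepath_def)
  interpret analytic_boundary k uin x1 x2 X1 X2 T U W
  proof
    show "x1 pi = x1 (- pi)" "x2 pi = x2 (- pi)"
      using curve(2) ends by (simp_all add: pathstart_def pathfinish_def)
  qed (fact wave T ext uext)+
  define g2 where "g2 = (deriv ^^ 2) g t0"
  define \<rho> where "\<rho> = sqrt (2 / cmod g2)"
  \<comment> \<open>The square root of \<open>-2 / g2\<close> with argument
    \<open>- \<omega>0 / 2\<close>, that is on the prescribed branch; it points into the valley by
    which the contour leaves.\<close>
  define a where "a = of_real \<rho> * cis (- \<omega>0 / 2)"
  have g2: "g2 \<noteq> 0" "- g2 = of_real (cmod g2) * cis \<omega>0"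
    using t0(3) branch(2) by (simp_all add: g2_def rcis_def)
  have \<rho>: "\<rho> > 0" "\<rho>\<^sup>2 = 2 / cmod g2" using g2(1) by (simp_all add: \<rho>_def)
  have a2: "a\<^sup>2 * g2 = - 2"
  proof -
    have "a\<^sup>2 * g2 = - (of_real (\<rho>\<^sup>2) * (cis (- \<omega>0 / 2))\<^sup>2 * (- g2))"
      by (simp add: a_def power_mult_distrib)
    also have "(cis (- \<omega>0 / 2))\<^sup>2 = cis (- \<omega>0)"
      by (simp only: Complex.DeMoivre) simp
    also have "- (of_real (\<rho>\<^sup>2) * cis (- \<omega>0) * (- g2)) = - (of_real (2 / cmod g2 * cmod g2) * (cis (- \<omega>0) * cis \<omega>0))"
      unfolding g2(2) \<rho>(2) by (simp add: mult_ac)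
    also have "\<dots> = - 2" using g2(1) by (simp add: cis_mult)
    finally show ?thesis .
  qed
  have over_a: "z / a = z * cis (\<omega>0 / 2) / of_real \<rho>" for z
  proof -
    have "a * (cis (\<omega>0 / 2) / of_real \<rho>) = cis (- \<omega>0 / 2) * cis (\<omega>0 / 2)"
      using \<rho>(1) by (simp add: a_def)
    also have "\<dots> = 1" unfolding cis_mult by simp
    finally have "inverse a = cis (\<omega>0 / 2) / of_real \<rho>" by (rule inverse_unique)
    then show ?thesis unfolding divide_inverse[of z a] by simp
  qed
  have cs0: "c s0 = t0" using contour(7)[THEN bspec, OF contour(6)] by (simp only: simp_thms)
  have s0: "s0 \<in> {0<..<1}"
  proof -
    have "s0 \<noteq> 0" "s0 \<noteq> 1"
      using cs0 contour(2,3) t0(4,5) by (auto simp: pathstart_def pathfinish_def)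
    then show ?thesis using contour(6) by auto
  qed
  have val: "\<forall>s\<in>{0..1} - {s0}. Re (g (c s)) < Re (g t0)"
  proof
    fix s assume s: "s \<in> {0..1} - {s0}"
    then have "c s \<noteq> t0" using contour(7)[THEN bspec, of s] by simp
    moreover have "c s \<in> path_image c" using s by (auto simp: path_image_def)
    ultimately show "Re (g (c s)) < Re (g t0)" by (intro contour(8)[THEN bspec]) simp
  qed
  \<comment> \<open>The branch condition bounds the angle between the limiting direction
    \<open>cis \<omega>\<close> and \<open>a\<close> by \<open>pi / 4\<close>, so the quotient has
    positive real part in the limit and hence nearby.\<close>
  have right: "\<forall>\<^sub>F s in at_right s0. Re ((c s - t0) / a) > 0"
  proof -
    have "((\<lambda>r. Re (sgn (c r - t0) / a)) \<longlongrightarrow> Re (cis \<omega> / a)) (at_right s0)"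
      using branch(1) unfolding arg_along_def by (intro tendsto_intros) (use \<rho>(1) in \<open>auto simp: a_def\<close>)
    moreover have "Re (cis \<omega> / a) = cos (\<omega> + \<omega>0 / 2) / \<rho>"
      unfolding over_a cis_mult by simp
    moreover have "cos (\<omega> + \<omega>0 / 2) > 0"
    proof -
      have "\<bar>\<omega> + \<omega>0 / 2\<bar> \<le> pi / 4"
        using branch(3) by linarith
      then show ?thesis using pi_gt_zero by (intro cos_gt_zero_pi) linarith+
    qed
    ultimately have "((\<lambda>r. Re (sgn (c r - t0) / a)) \<longlongrightarrow> cos (\<omega> + \<omega>0 / 2) / \<rho>) (at_right s0)"
      "cos (\<omega> + \<omega>0 / 2) / \<rho> > 0"
      using \<rho>(1) by simp_all
    then have "\<forall>\<^sub>F r in at_right s0. Re (sgn (c r - t0) / a) > 0"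
      by (rule order_tendstoD(1))
    then show ?thesis
    proof eventually_elim
      case (elim r)
      then have nz: "c r - t0 \<noteq> 0" by auto
      have "(c r - t0) / a = of_real (norm (c r - t0)) * (sgn (c r - t0) / a)"
        using nz by (simp add: sgn_eq)
      then have "Re ((c r - t0) / a) = Re (of_real (norm (c r - t0)) * (sgn (c r - t0) / a))"
        by (rule arg_cong)
      also have "\<dots> = norm (c r - t0) * Re (sgn (c r - t0) / a)" by (simp only: times_complex.sel Re_complex_of_real Im_complex_of_real mult_zero_left diff_zero)
      finally have "Re ((c r - t0) / a) = norm (c r - t0) * Re (sgn (c r - t0) / a)" .
      then show ?case using elim nz by simp
    qed
  qed
  have left: "\<forall>\<^sub>F s in at_left s0. Re ((c s - t0) / a) < 0"
    using branch(4) unfolding arrives_opposite_def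
    by eventually_elim (use \<rho>(1) in \<open>simp add: over_a divide_neg_pos\<close>)
  \<comment> \<open>Contour and interval meet at \<open>pi\<close>, so their union is connected and
    joins \<open>t0\<close> to 0 within \<open>T\<close>.\<close>
  have comp: "t0 \<in> connected_component_set T (of_real 0)"
  proof -
    let ?S = "path_image c \<union> complex_of_real ` {- pi..pi}"
    have "connected ?S"
    proof (rule connected_Un)
      show "connected (path_image c)" using contour(1) by (simp add: connected_path_image valid_path_imp_path)
      show "connected (complex_of_real ` {- pi..pi})"
        by (intro connected_continuous_image continuous_intros) auto
      have "c 1 \<in> path_image c" by (simp add: path_image_def)
      moreover have "c 1 \<in> complex_of_real ` {- pi..pi}"
        using contour(3) by (simp add: pathfinish_def)
      ultimately show "path_image c \<inter> complex_of_real ` {- pi..pi} \<noteq> {}" by blast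
    qed
    moreover have "?S \<subseteq> T" using contour(4) T(2) by blast
    moreover have "complex_of_real 0 \<in> ?S" by auto
    ultimately have "?S \<subseteq> connected_component_set T (of_real 0)"
      by (intro connected_component_maximal)
    moreover have "t0 \<in> path_image c" using cs0 contour(6) by (auto simp: path_image_def)
    ultimately show ?thesis by blast
  qed
  have crit: "deriv (g_ext X1 X2) t0 = 0" using t0(2) by (simp add: g)
  have br: "branch_powr \<omega>0 z p \<noteq> 0" if "z \<noteq> 0" for z p using that by (simp add: branch_powr_def rcis_def)
  \<comment> \<open>\<open>C1\<close> is the value of \<open>f\<close> at the critical point times
    the nonzero number \<open>sqrt (2 pi)\<close> over the square root of
    \<open>- g2\<close>.\<close>
  have f0: "f_ext k q U X1 X2 t0 = 0"
  proof -
    have "of_real (k\<^sup>2 * (q - 1)) * (of_real (sqrt (2 * pi)) / branch_powr \<omega>0 (- g2) (1/2)) * v t0 * deriv X2 t0 = 0"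
      using C1_zero unfolding C1_eq C1_coeff_def Let_def g2_def g by simp
    then show ?thesis
      unfolding f_at_critical_point[OF comp crit] using g2(1) br[of "- g2"] by auto
  qed
  define F where "F = f_ext k q U X1 X2"
  define B where "B = deriv X2 t0 * (\<i> * V1 t0 + V2 t0)"
  obtain K where K: "\<forall>lam\<ge>1. norm (of_real (lam powr (5/2)) / exp (of_real lam * g t0) * boundary_integral k q uin x1 x2 lam
     - of_real (sqrt pi) * (a ^ 3 * ((deriv ^^ 2) F t0 - deriv F t0 * (deriv ^^ 3) g t0 / g2) / 4
         + of_real (k\<^sup>2 * q / 2) * \<i> * B * a)) \<le> K / lam"
    using boundary_integral_asymptotics[OF q(1) contour(1,4,5) s0 cs0 crit _ val[unfolded g] right left f0]
      a2 unfolding F_def B_def g2_def g by blast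
  have coeff: "of_real (sqrt pi) * (a ^ 3 * ((deriv ^^ 2) F t0 - deriv F t0 * (deriv ^^ 3) g t0 / g2) / 4
         + of_real (k\<^sup>2 * q / 2) * \<i> * B * a) = C2"
  proof -
    \<comment> \<open>\<open>4 powr (3/2) = 8\<close>: this is how \<open>a ^ 3 / 4\<close> becomes
      2 over the three-halves power in \<open>C2\<close>.\<close>
    have n: "(2 * cmod g2) powr (3/2) * \<rho> ^ 3 = 8"
    proof -
      have "\<rho> ^ 3 = (2 / cmod g2) powr (3/2)"
        using g2(1) by (simp add: \<rho>_def powr_half_sqrt[symmetric] powr_power)
      then have "(2 * cmod g2) powr (3/2) * \<rho> ^ 3 = ((2 * cmod g2) * (2 / cmod g2)) powr (3/2)"
        using g2(1) by (simp only: powr_mult[symmetric])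
      also have "(2 * cmod g2) * (2 / cmod g2) = 4" using g2(1) by simp
      also have "(4::real) powr (3/2) = (2 powr 2) powr (3/2)" by simp
      also have "\<dots> = 8" unfolding powr_powr by simp
      finally show ?thesis .
    qed
    have c3: "cis (- \<omega>0 / 2) ^ 3 = cis (- (3/2 * \<omega>0))"
      by (simp only: Complex.DeMoivre) simp
    have "branch_powr \<omega>0 (- 2 * g2) (3/2) * a ^ 3 = of_real ((2 * cmod g2) powr (3/2) * \<rho> ^ 3) * (cis (3/2 * \<omega>0) * cis (- (3/2 * \<omega>0)))"
      unfolding a_def power_mult_distrib c3 branch_powr_def rcis_def by (simp add: norm_mult mult_ac)
    also have "\<dots> = 8" unfolding n cis_mult by simp
    finally have a34: "a ^ 3 / 4 = 2 / branch_powr \<omega>0 (- 2 * g2) (3/2)"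
      using br[of "- 2 * g2" "3/2"] g2(1) by (simp add: field_simps)
    have "C2 = of_real (sqrt pi) * (a ^ 3 / 4 * ((deriv ^^ 2) F t0 - deriv F t0 * (deriv ^^ 3) g t0 / g2
        - \<i> * of_real (k\<^sup>2 * q) * g2 * B))"
      unfolding a34 unfolding C2_eq C2_coeff_def Let_def F_def B_def g2_def g
      by (simp only: of_real_mult of_real_numeral times_divide_eq_left times_divide_eq_right mult_ac)
    \<comment> \<open>The relation \<open>a^2 g2 = - 2\<close> exchanges the single factor
      \<open>a\<close> of the last summand for the common factor \<open>a ^ 3 / 4\<close>, which is
      why \<open>g2\<close> multiplies that summand in \<open>C2\<close>.\<close>
    also have "a ^ 3 / 4 * ((deriv ^^ 2) F t0 - deriv F t0 * (deriv ^^ 3) g t0 / g2 - \<i> * of_real (k\<^sup>2 * q) * g2 * B)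
      = a ^ 3 * ((deriv ^^ 2) F t0 - deriv F t0 * (deriv ^^ 3) g t0 / g2) / 4 - (a\<^sup>2 * g2) * a * \<i> * of_real (k\<^sup>2 * q) * B / 4"
      by (simp add: algebra_simps power2_eq_square power3_eq_cube diff_divide_distrib)
    finally show ?thesis unfolding a2 by (simp add: algebra_simps add_divide_distrib)
  qed
  \<comment> \<open>\<open>R\<close> is read off from the claimed identity, which therefore holds
    for every positive \<open>lam\<close>; only the size of \<open>R\<close> is an asymptotic
    statement.\<close>
  define R where "R lam = of_real (lam powr (5/2)) / exp (of_real lam * g t0) * boundary_integral k q uin x1 x2 lam - C2" for lam
  have R: "norm (R lam) \<le> K / lam" if "lam \<ge> 1" for lam
    using K that unfolding coeff R_def by blast
  show ?thesis
  proof
    show "\<exists>R. R \<in> O[at_top](\<lambda>lam. complex_of_real (1 / lam)) \<and>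
           (\<forall>lam>0. boundary_integral k q uin x1 x2 lam
              = of_real (1 / lam powr (5/2)) * exp (of_real lam * g t0) * (C2 + R lam))"
    proof (intro exI conjI allI impI)
      show "R \<in> O[at_top](\<lambda>lam. complex_of_real (1 / lam))"
      proof (rule bigoI[of _ K])
        show "\<forall>\<^sub>F lam in at_top. norm (R lam) \<le> K * norm (complex_of_real (1 / lam))"
          using eventually_ge_at_top[of 1]
        proof eventually_elim
          case (elim lam)
          then show ?case using R[OF elim] by (simp add: norm_divide)
        qed
      qed
      fix lam :: real assume "lam > 0"
      then show "boundary_integral k q uin x1 x2 lam
              = of_real (1 / lam powr (5/2)) * exp (of_real lam * g t0) * (C2 + R lam)"
        by (simp add: R_def)
    qed
    show "C2 \<noteq> 0 \<longrightarrow> scattered k q D uin"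
    proof (intro impI, unfold scattered_def, rule notI)
      assume nz: "C2 \<noteq> 0" and ns: "nonscattering k q D uin"
      have Z: "boundary_integral k q uin x1 x2 lam = 0" for lam
        by (rule nonscattering_boundary_integral_zero[OF _ _ q(2) simple_path_imp_path[OF curve(1)] curve(2,3) ns[unfolded D]])
           (use k q in auto)
      \<comment> \<open>An explicit parameter instead of a limit: a vanishing boundary integral
        makes \<open>R lam = - C2\<close>, so \<open>norm C2 * lam \<le> K\<close>, whereas this
        choice gives \<open>norm C2 * lam = norm C2 + \<bar>K\<bar>\<close>.\<close>
      define lam where "lam = 1 + \<bar>K\<bar> / norm C2"
      have lam: "lam \<ge> 1" by (simp add: lam_def)
      have "norm C2 \<le> K / lam" using R[OF lam] by (simp add: R_def Z)
      then have "norm C2 * lam \<le> K" using lam by (simp add: pos_le_divide_eq)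
      moreover have "norm C2 * lam = norm C2 + \<bar>K\<bar>" using nz by (simp add: lam_def algebra_simps)
      ultimately show False using nz abs_ge_self[of K] zero_less_norm_iff[of C2] by linarith
    qed
  qed
qed

end
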